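(* Let $F$ be a finite group acting by group automorphisms on a finite group $G$, and let $F$ act on a $G$-graded fusion category $\mathcal{C}=\bigoplus_{g\in G}\mathcal{C}_g$ coherently with respect to this action. Let $\Gamma\subset G$ be a set of representatives for the orbits of $F$ on $G$, and for $g\in G$ let $F_g\le F$ be the stabilizer of $g$. Then the set of (isomorphism classes of) simple objects of $\mathcal{C}^F$ is parametrized by pairs $(g,M)$, where $g\in\Gamma$ and $M\in\mathcal{C}_g^{F_g}$ is a simple object (up to isomorphism). The simple object associated to the pair $(g,M)$ is the induced object $\mathrm{Ind}_{F_g}^F(M)$.
   Context: $k$ is an algebraically closed field. A fusion category over $k$ is a rigid semisimple $k$-linear tensor category with finitely many simple objects (up to isomorphism), finite dimensional Hom spaces and simple unit object. $G$-graded means $\mathcal{C}=\bigoplus_{g\in G}\mathcal{C}_g$ as abelian categories with $\mathcal{C}_g\otimes\mathcal{C}_h\subset\mathcal{C}_{gh}$. Action. $F$ acts on $\mathcal{C}$ by tensor autoequivalences: there are $k$-linear tensor autoequivalences $T^x$ ($x\in F$) and natural isomorphisms of tensor functors $T_2^{x,y}:T^xT^y\to T^{xy}$ with $(T_2^{xy,z})_M(T_2^{x,y})_{T^z(M)}=(T_2^{x,yz})_MT^x((T_2^{y,z})_M)$, normalized so that $T^1=\mathrm{id}$, $T_2^{x,1}$, $T_2^{1,x}$ are identities. The action is coherent with respect to the action $(x,g)\mapsto{}^xg$ of $F$ on $G$ if $T^x(\mathcal{C}_g)\subset\mathcal{C}_{{}^xg}$ for all $x\in F$, $g\in G$. Equivariantization.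 For $H\le F$ and a subcategory $\mathcal{D}$ of $\mathcal{C}$ stable under $T^h$, $h\in H$, $\mathcal{D}^H$ is the category of pairs $(M,\mu)$, $M\in\mathcal{D}$, $\mu=(\mu^h:T^h(M)\xrightarrow{\sim}M)_{h\in H}$ with $\mu^{h}T^{h}(\mu^{h'})=\mu^{hh'}(T_2^{h,h'})_M$, $\mu^1=\mathrm{id}$; morphisms are morphisms of $\mathcal{C}$ commuting with the $\mu$'s. Thus $\mathcal{C}_g^{F_g}\subset\mathcal{C}^{F_g}$. Induction. For a set $\mathcal{R}$ of representatives of $F/H$, $\mathrm{Ind}_H^F(V,\mu)=(\bigoplus_{t\in\mathcal{R}}T^t(V),\nu)$ with $\nu^a$ ($a\in F$) given on $T^aT^t(V)$ by $T^s(\mu^h)(T_2^{s,h})_V^{-1}(T_2^{a,t})_V:T^aT^t(V)\to T^s(V)$, where $at=sh$, $s\in\mathcal{R}$, $h\in H$. *)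

theory Defs
  imports
    "HOL-Algebra.Algebra"
    "Jordan_Normal_Form.Missing_VectorSpace"
begin

section \<open>Linear categories\<close>

text \<open>
  A category is given by a set of objects and, for each pair of objects, a Hom module (a
  HOL-Algebra module record, whose ring multiplication and unit are ignored, as usual). Hom sets
  belonging to different pairs of objects need not be disjoint. Composition is written in the
  order of functions. All axioms are relative to \<open>Obj\<close>; values elsewhere are irrelevant.
\<close>

record ('k, 'o, 'm) category_data =
  Obj :: "'o set"
  Hom :: "'o \<Rightarrow> 'o \<Rightarrow> ('k, 'm) module"
  Comp :: "'m \<Rightarrow> 'm \<Rightarrow> 'm" (infixl "\<cdot>\<index>" 70)
  Ident :: "'o \<Rightarrow> 'm"

abbreviation arr :: "('k, 'o, 'm, 'z) category_data_scheme \<Rightarrow> 'o \<Rightarrow> 'o \<Rightarrow> 'm set"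
  where "arr C A Y \<equiv> carrier (Hom C A Y)"

definition is_iso :: "('k, 'o, 'm, 'z) category_data_scheme \<Rightarrow> 'o \<Rightarrow> 'o \<Rightarrow> 'm \<Rightarrow> bool"
  where "is_iso C A Y f \<longleftrightarrow> f \<in> arr C A Y \<and>
    (\<exists>g\<in>arr C Y A. g \<cdot>\<^bsub>C\<^esub> f = Ident C A \<and> f \<cdot>\<^bsub>C\<^esub> g = Ident C Y)"

definition inv_arr :: "('k, 'o, 'm, 'z) category_data_scheme \<Rightarrow> 'o \<Rightarrow> 'o \<Rightarrow> 'm \<Rightarrow> 'm"
  where "inv_arr C A Y f =
    (THE g. g \<in> arr C Y A \<and> g \<cdot>\<^bsub>C\<^esub> f = Ident C A \<and> f \<cdot>\<^bsub>C\<^esub> g = Ident C Y)"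

definition isomorphic :: "('k, 'o, 'm, 'z) category_data_scheme \<Rightarrow> 'o \<Rightarrow> 'o \<Rightarrow> bool"
  where "isomorphic C A Y \<longleftrightarrow> (\<exists>f. is_iso C A Y f)"

definition is_mono :: "('k, 'o, 'm, 'z) category_data_scheme \<Rightarrow> 'o \<Rightarrow> 'o \<Rightarrow> 'm \<Rightarrow> bool"
  where "is_mono C A Y f \<longleftrightarrow> f \<in> arr C A Y \<and>
    (\<forall>Z\<in>Obj C. \<forall>u\<in>arr C Z A. \<forall>v\<in>arr C Z A. f \<cdot>\<^bsub>C\<^esub> u = f \<cdot>\<^bsub>C\<^esub> v \<longrightarrow> u = v)"

definition is_epi :: "('k, 'o, 'm, 'z) category_data_scheme \<Rightarrow> 'o \<Rightarrow> 'o \<Rightarrow> 'm \<Rightarrow> bool"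
  where "is_epi C A Y f \<longleftrightarrow> f \<in> arr C A Y \<and>
    (\<forall>Z\<in>Obj C. \<forall>u\<in>arr C Y Z. \<forall>v\<in>arr C Y Z. u \<cdot>\<^bsub>C\<^esub> f = v \<cdot>\<^bsub>C\<^esub> f \<longrightarrow> u = v)"

definition is_zero_object :: "('k, 'o, 'm, 'z) category_data_scheme \<Rightarrow> 'o \<Rightarrow> bool"
  where "is_zero_object C A \<longleftrightarrow> A \<in> Obj C \<and>
    (\<forall>Y\<in>Obj C. (\<exists>!f. f \<in> arr C A Y) \<and> (\<exists>!f. f \<in> arr C Y A))"

definition is_kernel ::
  "('k, 'o, 'm, 'z) category_data_scheme \<Rightarrow> 'o \<Rightarrow> 'o \<Rightarrow> 'm \<Rightarrow> 'o \<Rightarrow> 'm \<Rightarrow> bool"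
  where "is_kernel C A Y f L k \<longleftrightarrow>
    L \<in> Obj C \<and> k \<in> arr C L A \<and> f \<cdot>\<^bsub>C\<^esub> k = \<zero>\<^bsub>Hom C L Y\<^esub> \<and>
    (\<forall>B\<in>Obj C. \<forall>h\<in>arr C B A. f \<cdot>\<^bsub>C\<^esub> h = \<zero>\<^bsub>Hom C B Y\<^esub> \<longrightarrow>
      (\<exists>!u. u \<in> arr C B L \<and> k \<cdot>\<^bsub>C\<^esub> u = h))"

definition is_cokernel ::
  "('k, 'o, 'm, 'z) category_data_scheme \<Rightarrow> 'o \<Rightarrow> 'o \<Rightarrow> 'm \<Rightarrow> 'o \<Rightarrow> 'm \<Rightarrow> bool"
  where "is_cokernel C A Y f L c \<longleftrightarrow>
    L \<in> Obj C \<and> c \<in> arr C Y L \<and> c \<cdot>\<^bsub>C\<^esub> f = \<zero>\<^bsub>Hom C A L\<^esub> \<and>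
    (\<forall>B\<in>Obj C. \<forall>h\<in>arr C Y B. h \<cdot>\<^bsub>C\<^esub> f = \<zero>\<^bsub>Hom C A B\<^esub> \<longrightarrow>
      (\<exists>!u. u \<in> arr C L B \<and> u \<cdot>\<^bsub>C\<^esub> c = h))"

text \<open>
  \<open>A\<close> is the direct sum of the finite family \<open>Y\<close> indexed by \<open>I\<close>, with inclusions \<open>\<iota>\<close> and
  projections \<open>\<pi>\<close>. For empty \<open>I\<close> this says that \<open>A\<close> is a zero object.
\<close>

definition is_biproduct ::
  "('k, 'o, 'm, 'z) category_data_scheme \<Rightarrow> 'i set \<Rightarrow> ('i \<Rightarrow> 'o) \<Rightarrow> 'o \<Rightarrow>
    ('i \<Rightarrow> 'm) \<Rightarrow> ('i \<Rightarrow> 'm) \<Rightarrow> bool"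
  where "is_biproduct C I Y A \<iota> \<pi> \<longleftrightarrow>
    finite I \<and> A \<in> Obj C \<and>
    (\<forall>i\<in>I. Y i \<in> Obj C \<and> \<iota> i \<in> arr C (Y i) A \<and> \<pi> i \<in> arr C A (Y i)) \<and>
    (\<forall>i\<in>I. \<forall>j\<in>I. \<pi> j \<cdot>\<^bsub>C\<^esub> \<iota> i = (if i = j then Ident C (Y i) else \<zero>\<^bsub>Hom C (Y i) (Y j)\<^esub>)) \<and>
    (\<Oplus>\<^bsub>Hom C A A\<^esub>i\<in>I. \<iota> i \<cdot>\<^bsub>C\<^esub> \<pi> i) = Ident C A"

definition simple_object :: "('k, 'o, 'm, 'z) category_data_scheme \<Rightarrow> 'o \<Rightarrow> bool"
  where "simple_object C A \<longleftrightarrow> A \<in> Obj C \<and> \<not> is_zero_object C A \<and>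
    (\<forall>Y\<in>Obj C. \<forall>f. is_mono C Y A f \<longrightarrow> f = \<zero>\<^bsub>Hom C Y A\<^esub> \<or> is_iso C Y A f)"

definition iso_class :: "('k, 'o, 'm, 'z) category_data_scheme \<Rightarrow> 'o \<Rightarrow> 'o set"
  where "iso_class C A = {Y \<in> Obj C. isomorphic C A Y}"

definition simple_classes :: "('k, 'o, 'm, 'z) category_data_scheme \<Rightarrow> 'o set set"
  where "simple_classes C = iso_class C ` {A. simple_object C A}"

locale linear_category = field K for K :: "('k, 'c) ring_scheme"
    and C :: "('k, 'o, 'm, 'z) category_data_scheme" (structure) +
  assumes hom_vectorspace: "\<lbrakk>A \<in> Obj C; Y \<in> Obj C\<rbrakk> \<Longrightarrow> vectorspace K (Hom C A Y)"
    and ident_arr: "A \<in> Obj C \<Longrightarrow> Ident C A \<in> arr C A A"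
    and comp_linear_left:
      "\<lbrakk>A \<in> Obj C; Y \<in> Obj C; Z \<in> Obj C; f \<in> arr C A Y\<rbrakk> \<Longrightarrow>
        (\<lambda>g. g \<cdot> f) \<in> module_hom K (Hom C Y Z) (Hom C A Z)"
    and comp_linear_right:
      "\<lbrakk>A \<in> Obj C; Y \<in> Obj C; Z \<in> Obj C; g \<in> arr C Y Z\<rbrakk> \<Longrightarrow>
        (\<lambda>f. g \<cdot> f) \<in> module_hom K (Hom C A Y) (Hom C A Z)"
    and comp_ident_left: "\<lbrakk>A \<in> Obj C; Y \<in> Obj C; f \<in> arr C A Y\<rbrakk> \<Longrightarrow> Ident C Y \<cdot> f = f"
    and comp_ident_right: "\<lbrakk>A \<in> Obj C; Y \<in> Obj C; f \<in> arr C A Y\<rbrakk> \<Longrightarrow> f \<cdot> Ident C A = f"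
    and comp_assoc:
      "\<lbrakk>W \<in> Obj C; A \<in> Obj C; Y \<in> Obj C; Z \<in> Obj C;
        f \<in> arr C W A; g \<in> arr C A Y; h \<in> arr C Y Z\<rbrakk> \<Longrightarrow> (h \<cdot> g) \<cdot> f = h \<cdot> (g \<cdot> f)"

locale abelian_category = linear_category K C
  for K :: "('k, 'c) ring_scheme" and C :: "('k, 'o, 'm, 'z) category_data_scheme" (structure) +
  assumes zero_object: "\<exists>Z. is_zero_object C Z"
    and direct_sums:
      "\<lbrakk>A \<in> Obj C; Y \<in> Obj C\<rbrakk> \<Longrightarrow>
        \<exists>S \<iota> \<pi>. is_biproduct C (UNIV :: bool set) (\<lambda>b. if b then A else Y) S \<iota> \<pi>"
    and kernels: "\<lbrakk>A \<in> Obj C; Y \<in> Obj C; f \<in> arr C A Y\<rbrakk> \<Longrightarrow> \<exists>L k. is_kernel C A Y f L k"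
    and cokernels: "\<lbrakk>A \<in> Obj C; Y \<in> Obj C; f \<in> arr C A Y\<rbrakk> \<Longrightarrow> \<exists>L c. is_cokernel C A Y f L c"
    and mono_normal: "\<lbrakk>A \<in> Obj C; Y \<in> Obj C; is_mono C A Y f\<rbrakk> \<Longrightarrow>
        \<exists>Z\<in>Obj C. \<exists>g\<in>arr C Y Z. is_kernel C Y Z g A f"
    and epi_normal: "\<lbrakk>A \<in> Obj C; Y \<in> Obj C; is_epi C A Y f\<rbrakk> \<Longrightarrow>
        \<exists>Z\<in>Obj C. \<exists>g\<in>arr C Z A. is_cokernel C Z A g Y f"

locale semisimple_category = abelian_category K C
  for K :: "('k, 'c) ring_scheme" and C :: "('k, 'o, 'm, 'z) category_data_scheme" (structure) +
  assumes semisimple: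
    "A \<in> Obj C \<Longrightarrow> \<exists>(n::nat) S \<iota> \<pi>. (\<forall>i<n. simple_object C (S i)) \<and> is_biproduct C {..<n} S A \<iota> \<pi>"


section \<open>Fusion categories\<close>

record ('k, 'o, 'm) tensor_category_data = "('k, 'o, 'm) category_data" +
  tens :: "'o \<Rightarrow> 'o \<Rightarrow> 'o" (infixl "\<otimes>\<^sub>o\<index>" 75)
  tensm :: "'m \<Rightarrow> 'm \<Rightarrow> 'm" (infixl "\<otimes>\<^sub>m\<index>" 75)
  tunit :: "'o"
  assoc :: "'o \<Rightarrow> 'o \<Rightarrow> 'o \<Rightarrow> 'm"
  lunit :: "'o \<Rightarrow> 'm"
  runit :: "'o \<Rightarrow> 'm"

text \<open>
  A tensor category is an abelian linear category with a bilinear monoidal structure: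
  \<open>assoc A Y Z : (A \<otimes> Y) \<otimes> Z \<rightarrow> A \<otimes> (Y \<otimes> Z)\<close>, \<open>lunit A : 1 \<otimes> A \<rightarrow> A\<close> and \<open>runit A : A \<otimes> 1 \<rightarrow> A\<close>.
\<close>

locale tensor_category = abelian_category K C
  for K :: "('k, 'c) ring_scheme" and C :: "('k, 'o, 'm, 'z) tensor_category_data_scheme" (structure) +
  assumes tens_obj: "\<lbrakk>A \<in> Obj C; Y \<in> Obj C\<rbrakk> \<Longrightarrow> A \<otimes>\<^sub>o Y \<in> Obj C"
    and tunit_obj: "tunit C \<in> Obj C"
    and tens_linear_left:
      "\<lbrakk>A \<in> Obj C; Y \<in> Obj C; A' \<in> Obj C; Y' \<in> Obj C; g \<in> arr C A' Y'\<rbrakk> \<Longrightarrow>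
        (\<lambda>f. f \<otimes>\<^sub>m g) \<in> module_hom K (Hom C A Y) (Hom C (A \<otimes>\<^sub>o A') (Y \<otimes>\<^sub>o Y'))"
    and tens_linear_right:
      "\<lbrakk>A \<in> Obj C; Y \<in> Obj C; A' \<in> Obj C; Y' \<in> Obj C; f \<in> arr C A Y\<rbrakk> \<Longrightarrow>
        (\<lambda>g. f \<otimes>\<^sub>m g) \<in> module_hom K (Hom C A' Y') (Hom C (A \<otimes>\<^sub>o A') (Y \<otimes>\<^sub>o Y'))"
    and tens_ident:
      "\<lbrakk>A \<in> Obj C; Y \<in> Obj C\<rbrakk> \<Longrightarrow> Ident C A \<otimes>\<^sub>m Ident C Y = Ident C (A \<otimes>\<^sub>o Y)"
    and tens_comp:
      "\<lbrakk>A \<in> Obj C; Y \<in> Obj C; Z \<in> Obj C; A' \<in> Obj C; Y' \<in> Obj C; Z' \<in> Obj C;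
        f \<in> arr C A Y; g \<in> arr C Y Z; f' \<in> arr C A' Y'; g' \<in> arr C Y' Z'\<rbrakk> \<Longrightarrow>
        (g \<cdot> f) \<otimes>\<^sub>m (g' \<cdot> f') = (g \<otimes>\<^sub>m g') \<cdot> (f \<otimes>\<^sub>m f')"
    and assoc_iso:
      "\<lbrakk>A \<in> Obj C; Y \<in> Obj C; Z \<in> Obj C\<rbrakk> \<Longrightarrow>
        is_iso C ((A \<otimes>\<^sub>o Y) \<otimes>\<^sub>o Z) (A \<otimes>\<^sub>o (Y \<otimes>\<^sub>o Z)) (assoc C A Y Z)"
    and assoc_natural:
      "\<lbrakk>A \<in> Obj C; Y \<in> Obj C; Z \<in> Obj C; A' \<in> Obj C; Y' \<in> Obj C; Z' \<in> Obj C;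
        f \<in> arr C A A'; g \<in> arr C Y Y'; h \<in> arr C Z Z'\<rbrakk> \<Longrightarrow>
        assoc C A' Y' Z' \<cdot> ((f \<otimes>\<^sub>m g) \<otimes>\<^sub>m h) = (f \<otimes>\<^sub>m (g \<otimes>\<^sub>m h)) \<cdot> assoc C A Y Z"
    and lunit_iso: "A \<in> Obj C \<Longrightarrow> is_iso C (tunit C \<otimes>\<^sub>o A) A (lunit C A)"
    and lunit_natural: "\<lbrakk>A \<in> Obj C; Y \<in> Obj C; f \<in> arr C A Y\<rbrakk> \<Longrightarrow>
        lunit C Y \<cdot> (Ident C (tunit C) \<otimes>\<^sub>m f) = f \<cdot> lunit C A"
    and runit_iso: "A \<in> Obj C \<Longrightarrow> is_iso C (A \<otimes>\<^sub>o tunit C) A (runit C A)"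
    and runit_natural: "\<lbrakk>A \<in> Obj C; Y \<in> Obj C; f \<in> arr C A Y\<rbrakk> \<Longrightarrow>
        runit C Y \<cdot> (f \<otimes>\<^sub>m Ident C (tunit C)) = f \<cdot> runit C A"
    and triangle: "\<lbrakk>A \<in> Obj C; Y \<in> Obj C\<rbrakk> \<Longrightarrow>
        (Ident C A \<otimes>\<^sub>m lunit C Y) \<cdot> assoc C A (tunit C) Y = runit C A \<otimes>\<^sub>m Ident C Y"
    and pentagon: "\<lbrakk>W \<in> Obj C; A \<in> Obj C; Y \<in> Obj C; Z \<in> Obj C\<rbrakk> \<Longrightarrow>
        assoc C W A (Y \<otimes>\<^sub>o Z) \<cdot> assoc C (W \<otimes>\<^sub>o A) Y Z =
        (Ident C W \<otimes>\<^sub>m assoc C A Y Z) \<cdot> assoc C W (A \<otimes>\<^sub>o Y) Z \<cdot> (assoc C W A Y \<otimes>\<^sub>m Ident C Z)"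

text \<open>
  \<open>A'\<close> is a left dual of \<open>A\<close> (equivalently \<open>A\<close> is a right dual of \<open>A'\<close>). The unitors in the two
  snake identities are moved to the right-hand sides.
\<close>

definition dual_pair ::
  "('k, 'o, 'm, 'z) tensor_category_data_scheme \<Rightarrow> 'o \<Rightarrow> 'o \<Rightarrow> 'm \<Rightarrow> 'm \<Rightarrow> bool"
  where "dual_pair C A' A ev coev \<longleftrightarrow>
    ev \<in> arr C (A' \<otimes>\<^sub>o\<^bsub>C\<^esub> A) (tunit C) \<and> coev \<in> arr C (tunit C) (A \<otimes>\<^sub>o\<^bsub>C\<^esub> A') \<and>
    runit C A \<cdot>\<^bsub>C\<^esub> (Ident C A \<otimes>\<^sub>m\<^bsub>C\<^esub> ev) \<cdot>\<^bsub>C\<^esub> assoc C A A' A \<cdot>\<^bsub>C\<^esub> (coev \<otimes>\<^sub>m\<^bsub>C\<^esub> Ident C A)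
      = lunit C A \<and>
    lunit C A' \<cdot>\<^bsub>C\<^esub> (ev \<otimes>\<^sub>m\<^bsub>C\<^esub> Ident C A') \<cdot>\<^bsub>C\<^esub>
      inv_arr C ((A' \<otimes>\<^sub>o\<^bsub>C\<^esub> A) \<otimes>\<^sub>o\<^bsub>C\<^esub> A') (A' \<otimes>\<^sub>o\<^bsub>C\<^esub> (A \<otimes>\<^sub>o\<^bsub>C\<^esub> A')) (assoc C A' A A') \<cdot>\<^bsub>C\<^esub>
      (Ident C A' \<otimes>\<^sub>m\<^bsub>C\<^esub> coev)
      = runit C A'"

locale fusion_category = tensor_category K C + semisimple_category K C
  for K :: "('k, 'c) ring_scheme" and C :: "('k, 'o, 'm, 'z) tensor_category_data_scheme" (structure) +
  assumes left_duals: "A \<in> Obj C \<Longrightarrow> \<exists>A'\<in>Obj C. \<exists>ev coev. dual_pair C A' A ev coev"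
    and right_duals: "A \<in> Obj C \<Longrightarrow> \<exists>A'\<in>Obj C. \<exists>ev coev. dual_pair C A A' ev coev"
    and finite_simples: "finite (simple_classes C)"
    and finite_dim: "\<lbrakk>A \<in> Obj C; Y \<in> Obj C\<rbrakk> \<Longrightarrow> vectorspace.fin_dim K (Hom C A Y)"
    and simple_unit: "simple_object C (tunit C)"

text \<open>
  A grading is given by the object sets of full subcategories. That \<open>C\<close> is their direct sum means
  that there are no nonzero morphisms between different components and every object is a direct sum
  of objects of the components. It follows that each component is itself abelian, so this is not
  assumed separately. The components need not be closed under isomorphism.
\<close>

locale graded_fusion_category = fusion_category K C + G: group G
  for K :: "('k, 'c) ring_scheme" and C :: "('k, 'o, 'm, 'z) tensor_category_data_scheme" (structure)
    and G :: "('g, 'b) monoid_scheme" +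
  fixes Cg :: "'g \<Rightarrow> 'o set"
  assumes component_sub: "g \<in> carrier G \<Longrightarrow> Cg g \<subseteq> Obj C"
    and component_zero: "g \<in> carrier G \<Longrightarrow> \<exists>Z\<in>Cg g. is_zero_object C Z"
    and component_orthogonal:
      "\<lbrakk>g \<in> carrier G; h \<in> carrier G; g \<noteq> h; A \<in> Cg g; Y \<in> Cg h\<rbrakk> \<Longrightarrow> arr C A Y = {\<zero>\<^bsub>Hom C A Y\<^esub>}"
    and component_decomp:
      "A \<in> Obj C \<Longrightarrow> \<exists>S I \<iota> \<pi>. I \<subseteq> carrier G \<and> (\<forall>g\<in>I. S g \<in> Cg g) \<and> is_biproduct C I S A \<iota> \<pi>"
    and component_tens:
      "\<lbrakk>g \<in> carrier G; h \<in> carrier G; A \<in> Cg g; Y \<in> Cg h\<rbrakk> \<Longrightarrow> A \<otimes>\<^sub>o Y \<in> Cg (g \<otimes>\<^bsub>G\<^esub> h)"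


section \<open>Tensor functors and group actions\<close>

text \<open>
  \<open>FTens T A Y : T A \<otimes> T Y \<rightarrow> T (A \<otimes> Y)\<close> and \<open>FUnit T : 1 \<rightarrow> T 1\<close> are the structure
  isomorphisms of a tensor endofunctor \<open>T\<close>.
\<close>

record ('o, 'm) tensor_functor_data =
  FObj :: "'o \<Rightarrow> 'o"
  FMor :: "'m \<Rightarrow> 'm"
  FTens :: "'o \<Rightarrow> 'o \<Rightarrow> 'm"
  FUnit :: "'m"

definition is_functor ::
  "('k, 'o, 'm, 'z) category_data_scheme \<Rightarrow> ('o \<Rightarrow> 'o) \<Rightarrow> ('m \<Rightarrow> 'm) \<Rightarrow> bool"
  where "is_functor C S s \<longleftrightarrow>
    (\<forall>A\<in>Obj C. S A \<in> Obj C \<and> s (Ident C A) = Ident C (S A)) \<and>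
    (\<forall>A\<in>Obj C. \<forall>Y\<in>Obj C. \<forall>f\<in>arr C A Y. s f \<in> arr C (S A) (S Y)) \<and>
    (\<forall>A\<in>Obj C. \<forall>Y\<in>Obj C. \<forall>Z\<in>Obj C. \<forall>f\<in>arr C A Y. \<forall>g\<in>arr C Y Z.
      s (g \<cdot>\<^bsub>C\<^esub> f) = s g \<cdot>\<^bsub>C\<^esub> s f)"

definition is_natural_iso ::
  "('k, 'o, 'm, 'z) category_data_scheme \<Rightarrow> ('o \<Rightarrow> 'o) \<Rightarrow> ('m \<Rightarrow> 'm) \<Rightarrow>
    ('o \<Rightarrow> 'o) \<Rightarrow> ('m \<Rightarrow> 'm) \<Rightarrow> ('o \<Rightarrow> 'm) \<Rightarrow> bool"
  where "is_natural_iso C S s U u \<alpha> \<longleftrightarrow>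
    (\<forall>A\<in>Obj C. is_iso C (S A) (U A) (\<alpha> A)) \<and>
    (\<forall>A\<in>Obj C. \<forall>Y\<in>Obj C. \<forall>f\<in>arr C A Y. \<alpha> Y \<cdot>\<^bsub>C\<^esub> s f = u f \<cdot>\<^bsub>C\<^esub> \<alpha> A)"

definition is_autoequivalence ::
  "('k, 'o, 'm, 'z) category_data_scheme \<Rightarrow> ('o \<Rightarrow> 'o) \<Rightarrow> ('m \<Rightarrow> 'm) \<Rightarrow> bool"
  where "is_autoequivalence C S s \<longleftrightarrow> is_functor C S s \<and>
    (\<exists>U u \<alpha> \<beta>. is_functor C U u \<and>
      is_natural_iso C (U \<circ> S) (u \<circ> s) id id \<alpha> \<and> is_natural_iso C (S \<circ> U) (s \<circ> u) id id \<beta>)"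

definition is_tensor_functor ::
  "('k, 'o, 'm, 'z) tensor_category_data_scheme \<Rightarrow> ('o, 'm) tensor_functor_data \<Rightarrow> bool"
  where "is_tensor_functor C T \<longleftrightarrow> is_functor C (FObj T) (FMor T) \<and>
    is_iso C (tunit C) (FObj T (tunit C)) (FUnit T) \<and>
    (\<forall>A\<in>Obj C. \<forall>Y\<in>Obj C.
      is_iso C (FObj T A \<otimes>\<^sub>o\<^bsub>C\<^esub> FObj T Y) (FObj T (A \<otimes>\<^sub>o\<^bsub>C\<^esub> Y)) (FTens T A Y)) \<and>
    (\<forall>A\<in>Obj C. \<forall>Y\<in>Obj C. \<forall>A'\<in>Obj C. \<forall>Y'\<in>Obj C. \<forall>f\<in>arr C A A'. \<forall>g\<in>arr C Y Y'.
      FTens T A' Y' \<cdot>\<^bsub>C\<^esub> (FMor T f \<otimes>\<^sub>m\<^bsub>C\<^esub> FMor T g) = FMor T (f \<otimes>\<^sub>m\<^bsub>C\<^esub> g) \<cdot>\<^bsub>C\<^esub> FTens T A Y) \<and>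
    (\<forall>A\<in>Obj C. \<forall>Y\<in>Obj C. \<forall>Z\<in>Obj C.
      FMor T (assoc C A Y Z) \<cdot>\<^bsub>C\<^esub> FTens T (A \<otimes>\<^sub>o\<^bsub>C\<^esub> Y) Z \<cdot>\<^bsub>C\<^esub>
        (FTens T A Y \<otimes>\<^sub>m\<^bsub>C\<^esub> Ident C (FObj T Z)) =
      FTens T A (Y \<otimes>\<^sub>o\<^bsub>C\<^esub> Z) \<cdot>\<^bsub>C\<^esub> (Ident C (FObj T A) \<otimes>\<^sub>m\<^bsub>C\<^esub> FTens T Y Z) \<cdot>\<^bsub>C\<^esub>
        assoc C (FObj T A) (FObj T Y) (FObj T Z)) \<and>
    (\<forall>A\<in>Obj C.
      FMor T (lunit C A) \<cdot>\<^bsub>C\<^esub> FTens T (tunit C) A \<cdot>\<^bsub>C\<^esub> (FUnit T \<otimes>\<^sub>m\<^bsub>C\<^esub> Ident C (FObj T A))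
        = lunit C (FObj T A) \<and>
      FMor T (runit C A) \<cdot>\<^bsub>C\<^esub> FTens T A (tunit C) \<cdot>\<^bsub>C\<^esub> (Ident C (FObj T A) \<otimes>\<^sub>m\<^bsub>C\<^esub> FUnit T)
        = runit C (FObj T A))"

definition is_linear_tensor_autoequivalence ::
  "('k, 'c) ring_scheme \<Rightarrow> ('k, 'o, 'm, 'z) tensor_category_data_scheme \<Rightarrow>
    ('o, 'm) tensor_functor_data \<Rightarrow> bool"
  where "is_linear_tensor_autoequivalence K C T \<longleftrightarrow>
    is_tensor_functor C T \<and> is_autoequivalence C (FObj T) (FMor T) \<and>
    (\<forall>A\<in>Obj C. \<forall>Y\<in>Obj C. FMor T \<in> module_hom K (Hom C A Y) (Hom C (FObj T A) (FObj T Y)))"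

definition comp_tensor_functor ::
  "('k, 'o, 'm, 'z) tensor_category_data_scheme \<Rightarrow> ('o, 'm) tensor_functor_data \<Rightarrow>
    ('o, 'm) tensor_functor_data \<Rightarrow> ('o, 'm) tensor_functor_data"
  where "comp_tensor_functor C S T =
    \<lparr>FObj = FObj S \<circ> FObj T,
     FMor = FMor S \<circ> FMor T,
     FTens = (\<lambda>A Y. FMor S (FTens T A Y) \<cdot>\<^bsub>C\<^esub> FTens S (FObj T A) (FObj T Y)),
     FUnit = FMor S (FUnit T) \<cdot>\<^bsub>C\<^esub> FUnit S\<rparr>"

definition is_tensor_natural_iso ::
  "('k, 'o, 'm, 'z) tensor_category_data_scheme \<Rightarrow> ('o, 'm) tensor_functor_data \<Rightarrow>
    ('o, 'm) tensor_functor_data \<Rightarrow> ('o \<Rightarrow> 'm) \<Rightarrow> bool"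
  where "is_tensor_natural_iso C S T \<alpha> \<longleftrightarrow>
    is_natural_iso C (FObj S) (FMor S) (FObj T) (FMor T) \<alpha> \<and>
    (\<forall>A\<in>Obj C. \<forall>Y\<in>Obj C.
      \<alpha> (A \<otimes>\<^sub>o\<^bsub>C\<^esub> Y) \<cdot>\<^bsub>C\<^esub> FTens S A Y = FTens T A Y \<cdot>\<^bsub>C\<^esub> (\<alpha> A \<otimes>\<^sub>m\<^bsub>C\<^esub> \<alpha> Y)) \<and>
    \<alpha> (tunit C) \<cdot>\<^bsub>C\<^esub> FUnit S = FUnit T"

text \<open>Equality with the identity tensor functor, on objects and arrows of \<open>C\<close>.\<close>

definition is_identity_tensor_functor ::
  "('k, 'o, 'm, 'z) tensor_category_data_scheme \<Rightarrow> ('o, 'm) tensor_functor_data \<Rightarrow> bool"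
  where "is_identity_tensor_functor C T \<longleftrightarrow>
    (\<forall>A\<in>Obj C. FObj T A = A) \<and>
    (\<forall>A\<in>Obj C. \<forall>Y\<in>Obj C. \<forall>f\<in>arr C A Y. FMor T f = f) \<and>
    (\<forall>A\<in>Obj C. \<forall>Y\<in>Obj C. FTens T A Y = Ident C (A \<otimes>\<^sub>o\<^bsub>C\<^esub> Y)) \<and>
    FUnit T = Ident C (tunit C)"

locale tensor_action = tensor_category K C + F: group F
  for K :: "('k, 'c) ring_scheme" and C :: "('k, 'o, 'm, 'z) tensor_category_data_scheme" (structure)
    and F :: "('f, 'a) monoid_scheme" +
  fixes T :: "'f \<Rightarrow> ('o, 'm) tensor_functor_data"
    and T2 :: "'f \<Rightarrow> 'f \<Rightarrow> 'o \<Rightarrow> 'm"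
  assumes autoequivalence: "x \<in> carrier F \<Longrightarrow> is_linear_tensor_autoequivalence K C (T x)"
    and T2_iso: "\<lbrakk>x \<in> carrier F; y \<in> carrier F\<rbrakk> \<Longrightarrow>
        is_tensor_natural_iso C (comp_tensor_functor C (T x) (T y)) (T (x \<otimes>\<^bsub>F\<^esub> y)) (T2 x y)"
    and T2_assoc: "\<lbrakk>x \<in> carrier F; y \<in> carrier F; z \<in> carrier F; M \<in> Obj C\<rbrakk> \<Longrightarrow>
        T2 (x \<otimes>\<^bsub>F\<^esub> y) z M \<cdot> T2 x y (FObj (T z) M) = T2 x (y \<otimes>\<^bsub>F\<^esub> z) M \<cdot> FMor (T x) (T2 y z M)"
    and T_one: "is_identity_tensor_functor C (T \<one>\<^bsub>F\<^esub>)"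
    and T2_one: "\<lbrakk>x \<in> carrier F; M \<in> Obj C\<rbrakk> \<Longrightarrow>
        T2 x \<one>\<^bsub>F\<^esub> M = Ident C (FObj (T x) M) \<and> T2 \<one>\<^bsub>F\<^esub> x M = Ident C (FObj (T x) M)"


section \<open>Equivariantization and induction\<close>

text \<open>
  \<open>equivariantization C F T T2 D H\<close> is the category \<open>D\<^sup>H\<close>, for the full subcategory of \<open>C\<close> with
  object set \<open>D\<close> (stable under \<open>T h\<close>, \<open>h \<in> H\<close>) and a subgroup \<open>H\<close> of \<open>F\<close>. Families indexed by
  \<open>H\<close> are functions extensional on \<open>H\<close>.
\<close>

definition equivariantization ::
  "('k, 'o, 'm, 'z) category_data_scheme \<Rightarrow> ('f, 'a) monoid_scheme \<Rightarrow>
    ('f \<Rightarrow> ('o, 'm) tensor_functor_data) \<Rightarrow> ('f \<Rightarrow> 'f \<Rightarrow> 'o \<Rightarrow> 'm) \<Rightarrow> 'o set \<Rightarrow> 'f set \<Rightarrow>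
    ('k, 'o \<times> ('f \<Rightarrow> 'm), 'm) category_data"
  where "equivariantization C F T T2 D H =
    \<lparr>Obj = {(M, \<mu>). M \<in> D \<and> \<mu> \<in> extensional H \<and>
       (\<forall>h\<in>H. is_iso C (FObj (T h) M) M (\<mu> h)) \<and>
       (\<forall>h\<in>H. \<forall>h'\<in>H. \<mu> h \<cdot>\<^bsub>C\<^esub> FMor (T h) (\<mu> h') = \<mu> (h \<otimes>\<^bsub>F\<^esub> h') \<cdot>\<^bsub>C\<^esub> T2 h h' M) \<and>
       \<mu> \<one>\<^bsub>F\<^esub> = Ident C M},
     Hom = (\<lambda>(M, \<mu>) (N, \<nu>). (Hom C M N)
       \<lparr>carrier := {f \<in> arr C M N. \<forall>h\<in>H. f \<cdot>\<^bsub>C\<^esub> \<mu> h = \<nu> h \<cdot>\<^bsub>C\<^esub> FMor (T h) f}\<rparr>),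
     Comp = Comp C,
     Ident = (\<lambda>(M, \<mu>). Ident C M)\<rparr>"

definition left_transversal :: "('f, 'a) monoid_scheme \<Rightarrow> 'f set \<Rightarrow> 'f set \<Rightarrow> bool"
  where "left_transversal F H R \<longleftrightarrow> R \<subseteq> carrier F \<and>
    (\<forall>x\<in>carrier F. \<exists>!t. t \<in> R \<and> x \<in> t <#\<^bsub>F\<^esub> H)"

definition transversal_rep :: "('f, 'a) monoid_scheme \<Rightarrow> 'f set \<Rightarrow> 'f set \<Rightarrow> 'f \<Rightarrow> 'f"
  where "transversal_rep F H R x = (THE s. s \<in> R \<and> x \<in> s <#\<^bsub>F\<^esub> H)"

text \<open>
  The direct sum underlying an induced object is only determined up to isomorphism, so induction
  from \<open>H\<close> to \<open>F\<close> along the representatives \<open>R\<close> of \<open>F/H\<close> is a relation: it holds for every choice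
  of direct sum \<open>A\<close> of the \<open>T t V\<close>, \<open>t \<in> R\<close>. The arrow \<open>\<nu> a : T a A \<rightarrow> A\<close> is assembled from its
  components \<open>T a (T t V) \<rightarrow> T s V\<close>, \<open>a t = s h\<close>; \<open>T a A\<close> has the projections \<open>T a (\<pi> t)\<close>.
\<close>

definition is_induced ::
  "('k, 'o, 'm, 'z) category_data_scheme \<Rightarrow> ('f, 'a) monoid_scheme \<Rightarrow>
    ('f \<Rightarrow> ('o, 'm) tensor_functor_data) \<Rightarrow> ('f \<Rightarrow> 'f \<Rightarrow> 'o \<Rightarrow> 'm) \<Rightarrow> 'f set \<Rightarrow> 'f set \<Rightarrow>
    'o \<times> ('f \<Rightarrow> 'm) \<Rightarrow> 'o \<times> ('f \<Rightarrow> 'm) \<Rightarrow> bool"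
  where "is_induced C F T T2 H R = (\<lambda>(V, \<mu>) (A, \<nu>). \<exists>\<iota> \<pi>.
    is_biproduct C R (\<lambda>t. FObj (T t) V) A \<iota> \<pi> \<and>
    \<nu> = (\<lambda>a\<in>carrier F. \<Oplus>\<^bsub>Hom C (FObj (T a) A) A\<^esub>t\<in>R.
      (let s = transversal_rep F H R (a \<otimes>\<^bsub>F\<^esub> t); h = inv\<^bsub>F\<^esub> s \<otimes>\<^bsub>F\<^esub> (a \<otimes>\<^bsub>F\<^esub> t)
       in \<iota> s \<cdot>\<^bsub>C\<^esub> FMor (T s) (\<mu> h) \<cdot>\<^bsub>C\<^esub>
          inv_arr C (FObj (T s) (FObj (T h) V)) (FObj (T (s \<otimes>\<^bsub>F\<^esub> h)) V) (T2 s h V) \<cdot>\<^bsub>C\<^esub>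
          T2 a t V \<cdot>\<^bsub>C\<^esub> FMor (T a) (\<pi> t))))"

definition orbit_representatives ::
  "('f, 'a) monoid_scheme \<Rightarrow> 'g set \<Rightarrow> ('f \<Rightarrow> 'g \<Rightarrow> 'g) \<Rightarrow> 'g set \<Rightarrow> bool"
  where "orbit_representatives F E \<phi> \<Gamma> \<longleftrightarrow> \<Gamma> \<subseteq> E \<and> (\<forall>O'\<in>orbits F E \<phi>. \<exists>!g. g \<in> \<Gamma> \<inter> O')"

end

theory Submission
  imports Defs
begin

text \<open>
  Every object of a graded category has canonical idempotents onto its homogeneous parts. They are
  natural, and \<open>T x\<close> maps the idempotent of degree \<open>g\<close> to the one of degree \<open>\<phi> x g\<close>. For an
  \<open>F\<close>-equivariant object \<open>N\<close>, the part of degree \<open>g\<close> is therefore an \<open>F_g\<close>-equivariant object, and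
  an \<open>F\<close>-equivariant morphism is determined on the degrees in the orbit of \<open>g\<close> by its restriction to
  degree \<open>g\<close>. Conversely, transporting an \<open>F_g\<close>-equivariant morphism of \<open>g\<close>-components along the orbit
  extends it to an \<open>F\<close>-equivariant morphism. Hence taking the \<open>g\<close>-component is fully faithful on objects
  supported on the orbit of \<open>g\<close>, and it is inverse to induction. A simple equivariant object is
  supported on a single orbit, because the object induced from a component is a direct summand.
\<close>

text \<open>The sets \<open>Cg g\<close> need not be closed under isomorphism and a homogeneous
  decomposition involves choices, so there is no canonical functor onto a component. The idempotents
  are free of choices, and \<open>component g M N j p\<close> relates \<open>N\<close> to any
  \<open>M\<close> in degree \<open>g\<close> through which its idempotent splits. The same relation
  describes a part cut out of a given \<open>N\<close> and a given \<open>M\<close> sitting inside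
  an object induced from it, so the two situations share all lemmas.

  Extension along an orbit rests on an action: \<open>F\<close> acts on the arrows between
  underlying objects by conjugation with structure arrows, its fixed points are the equivariant
  arrows, and \<open>t\<close> moves what happens in degree \<open>g\<close> to degree
  \<open>\<phi> t g\<close>.

  Simplicity is the delicate point. A monomorphism of an equivariantization is tested against
  objects of that category only, so being monic cannot be read off in \<open>C\<close>. To pass
  between \<open>Eg g\<close> and \<open>EG\<close> the test objects themselves are moved: those of
  \<open>Eg g\<close> by induction, those of \<open>EG\<close> by taking components.\<close>

no_notation ideal_prod (infixl "\<cdot>\<index>" 80)

section \<open>Arrows with source and target\<close>

text \<open>
  Hom sets of different pairs of objects may overlap, so a bare arrow does not determine its
  source and target. Carrying both along makes the side conditions of associativity decidable by
  rewriting.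
\<close>

datatype ('o, 'm) arrow = Arrow (src: 'o) (mor: 'm) (tgt: 'o)

lemma arrow_eqI: "\<lbrakk>src f = src g; mor f = mor g; tgt f = tgt g\<rbrakk> \<Longrightarrow> f = g"
  by (cases f; cases g) simp

section \<open>Finite sums under additive maps\<close>

lemma finsum_additive:
  assumes "abelian_monoid M" "abelian_monoid N" "finite I"
    and h: "h \<in> carrier M \<rightarrow> carrier N"
    and add: "\<And>x y. \<lbrakk>x \<in> carrier M; y \<in> carrier M\<rbrakk> \<Longrightarrow> h (x \<oplus>\<^bsub>M\<^esub> y) = h x \<oplus>\<^bsub>N\<^esub> h y"
    and zero: "h \<zero>\<^bsub>M\<^esub> = \<zero>\<^bsub>N\<^esub>"
    and f: "f \<in> I \<rightarrow> carrier M"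
  shows "h (finsum M f I) = finsum N (\<lambda>i. h (f i)) I"
  using assms(3) f
proof (induction I rule: finite_induct)
  case empty
  then show ?case
    using zero by (simp add: abelian_monoid.finsum_empty[OF assms(1)] abelian_monoid.finsum_empty[OF assms(2)])
next
  case (insert i I)
  have *: "f i \<in> carrier M" "f \<in> I \<rightarrow> carrier M" "(\<lambda>i. h (f i)) \<in> I \<rightarrow> carrier N" "h (f i) \<in> carrier N"
    using insert.prems h by (auto simp: Pi_iff)
  then show ?case
    using insert.hyps insert.IH
    by (simp add: abelian_monoid.finsum_insert[OF assms(1)] abelian_monoid.finsum_insert[OF assms(2)]
        add abelian_monoid.finsum_closed[OF assms(1)])
qed

section \<open>Calculus of arrows in a linear category\<close>

context linear_category
begin

lemma hom_abelian_group: "\<lbrakk>A \<in> Obj C; Y \<in> Obj C\<rbrakk> \<Longrightarrow> abelian_group (Hom C A Y)"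
  using hom_vectorspace[of A Y] by (simp add: vectorspace_def module_def)

lemma hom_abelian_monoid: "\<lbrakk>A \<in> Obj C; Y \<in> Obj C\<rbrakk> \<Longrightarrow> abelian_monoid (Hom C A Y)"
  using hom_abelian_group[of A Y] by (simp add: abelian_group_def)

lemma hom_zero_arr: "\<lbrakk>A \<in> Obj C; Y \<in> Obj C\<rbrakk> \<Longrightarrow> \<zero>\<^bsub>Hom C A Y\<^esub> \<in> arr C A Y"
  by (rule abelian_monoid.zero_closed[OF hom_abelian_monoid])

lemma module_hom_zero:
  assumes "h \<in> module_hom K (Hom C A Y) (Hom C A' Y')"
    and "A \<in> Obj C" "Y \<in> Obj C" "A' \<in> Obj C" "Y' \<in> Obj C"
  shows "h \<zero>\<^bsub>Hom C A Y\<^esub> = \<zero>\<^bsub>Hom C A' Y'\<^esub>"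
proof -
  let ?M = "Hom C A Y" and ?N = "Hom C A' Y'"
  interpret M: abelian_group ?M using assms hom_abelian_group by blast
  interpret N: abelian_group ?N using assms hom_abelian_group by blast
  have "h (\<zero>\<^bsub>?M\<^esub> \<oplus>\<^bsub>?M\<^esub> \<zero>\<^bsub>?M\<^esub>) = h \<zero>\<^bsub>?M\<^esub> \<oplus>\<^bsub>?N\<^esub> h \<zero>\<^bsub>?M\<^esub>" "h \<zero>\<^bsub>?M\<^esub> \<in> carrier ?N"
    using assms(1) M.zero_closed unfolding module_hom_def by blast+
  then show ?thesis
    by (metis M.zero_closed M.r_zero N.r_zero N.zero_closed N.add.l_cancel)
qed

lemma module_hom_finsum:
  assumes "h \<in> module_hom K (Hom C A Y) (Hom C A' Y')"
    and "A \<in> Obj C" "Y \<in> Obj C" "A' \<in> Obj C" "Y' \<in> Obj C"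
    and "finite I" "f \<in> I \<rightarrow> arr C A Y"
  shows "h (finsum (Hom C A Y) f I) = finsum (Hom C A' Y') (\<lambda>i. h (f i)) I"
  by (rule finsum_additive)
    (use assms module_hom_zero[OF assms(1-5)] in \<open>auto simp: hom_abelian_monoid module_hom_def\<close>)

lemma comp_arr:
  "\<lbrakk>A \<in> Obj C; Y \<in> Obj C; Z \<in> Obj C; f \<in> arr C A Y; g \<in> arr C Y Z\<rbrakk> \<Longrightarrow> g \<cdot> f \<in> arr C A Z"
  using comp_linear_left[of A Y Z f] by (auto simp: module_hom_def Pi_iff)

definition valid :: "('o, 'm) arrow \<Rightarrow> bool"
  where "valid f \<longleftrightarrow> src f \<in> Obj C \<and> tgt f \<in> Obj C \<and> mor f \<in> arr C (src f) (tgt f)"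

text \<open>The ends are those of the outer factors whether or not the inner ends match. The
  endpoint rules are thus unconditional, and composability is a side condition only where the arrow
  itself matters.\<close>

definition cmp :: "('o, 'm) arrow \<Rightarrow> ('o, 'm) arrow \<Rightarrow> ('o, 'm) arrow" (infixr "\<star>" 72)
  where "g \<star> f = Arrow (src f) (mor g \<cdot> mor f) (tgt g)"

definition idt :: "'o \<Rightarrow> ('o, 'm) arrow"
  where "idt A = Arrow A (Ident C A) A"

definition zer :: "'o \<Rightarrow> 'o \<Rightarrow> ('o, 'm) arrow"
  where "zer A B = Arrow A \<zero>\<^bsub>Hom C A B\<^esub> B"

lemma src_tgt_simps [simp]:
  "src (g \<star> f) = src f" "tgt (g \<star> f) = tgt g"
  "src (idt A) = A" "tgt (idt A) = A" "src (zer A B) = A" "tgt (zer A B) = B"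
  by (simp_all add: cmp_def idt_def zer_def)

lemma mor_simps: "mor (g \<star> f) = mor g \<cdot> mor f" "mor (idt A) = Ident C A" "mor (zer A B) = \<zero>\<^bsub>Hom C A B\<^esub>"
  by (simp_all add: cmp_def idt_def zer_def)

lemma valid_src [simp]: "valid f \<Longrightarrow> src f \<in> Obj C"
  and valid_tgt [simp]: "valid f \<Longrightarrow> tgt f \<in> Obj C"
  and valid_mor [simp]: "\<lbrakk>valid f; src f = A; tgt f = B\<rbrakk> \<Longrightarrow> mor f \<in> arr C A B"
  by (auto simp add: valid_def)

lemma valid_Arrow [simp]: "valid (Arrow A f B) \<longleftrightarrow> A \<in> Obj C \<and> B \<in> Obj C \<and> f \<in> arr C A B"
  by (simp add: valid_def)

lemma valid_cmp [simp]: "\<lbrakk>valid f; valid g; tgt f = src g\<rbrakk> \<Longrightarrow> valid (g \<star> f)"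
  by (auto simp: cmp_def intro: comp_arr[of _ "src g"])

lemma valid_idt [simp]: "A \<in> Obj C \<Longrightarrow> valid (idt A)"
  by (simp add: idt_def ident_arr)

lemma valid_zer [simp]: "\<lbrakk>A \<in> Obj C; B \<in> Obj C\<rbrakk> \<Longrightarrow> valid (zer A B)"
  by (simp add: zer_def hom_zero_arr)

lemma cmp_assoc [simp]:
  "\<lbrakk>valid f; valid g; valid h; tgt f = src g; tgt g = src h\<rbrakk> \<Longrightarrow> (h \<star> g) \<star> f = h \<star> g \<star> f"
  by (rule arrow_eqI) (auto simp: mor_simps intro!: comp_assoc[of "src f" "src g" "src h" "tgt h"])

lemma idt_cmp [simp]: "\<lbrakk>valid f; tgt f = A\<rbrakk> \<Longrightarrow> idt A \<star> f = f"
  by (rule arrow_eqI) (auto simp: mor_simps intro!: comp_ident_left[of "src f"])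

lemma cmp_idt [simp]: "\<lbrakk>valid f; src f = A\<rbrakk> \<Longrightarrow> f \<star> idt A = f"
  by (rule arrow_eqI) (auto simp: mor_simps intro!: comp_ident_right[of _ "tgt f"])

lemma zer_cmp [simp]: "\<lbrakk>valid f; tgt f = A; B \<in> Obj C\<rbrakk> \<Longrightarrow> zer A B \<star> f = zer (src f) B"
  by (rule arrow_eqI)
    (auto simp: mor_simps intro!: module_hom_zero[where h = "\<lambda>g. g \<cdot> mor f"] comp_linear_left)

lemma cmp_zer [simp]: "\<lbrakk>valid f; src f = B; A \<in> Obj C\<rbrakk> \<Longrightarrow> f \<star> zer A B = zer A (tgt f)"
  by (rule arrow_eqI)
    (auto simp: mor_simps intro!: module_hom_zero[where h = "\<lambda>g. mor f \<cdot> g"] comp_linear_right)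

text \<open>Since \<open>cmp_assoc\<close> nests composites to the right, an equation for
  \<open>g \<star> f\<close> does not match inside \<open>g \<star> f \<star> x\<close>. This
  supplies the form with a trailing factor.\<close>

lemma cmp_reassoc:
  "\<lbrakk>g \<star> f = k; valid f; valid g; tgt f = src g; valid x; tgt x = src f\<rbrakk> \<Longrightarrow> g \<star> f \<star> x = k \<star> x"
  by (metis cmp_assoc)

section \<open>Isomorphisms and inverses\<close>

definition isom :: "('o, 'm) arrow \<Rightarrow> bool"
  where "isom f \<longleftrightarrow> valid f \<and> is_iso C (src f) (tgt f) (mor f)"

definition inv_of :: "('o, 'm) arrow \<Rightarrow> ('o, 'm) arrow"
  where "inv_of f = Arrow (tgt f) (inv_arr C (src f) (tgt f) (mor f)) (src f)"

lemma src_inv_of [simp]: "src (inv_of f) = tgt f" and tgt_inv_of [simp]: "tgt (inv_of f) = src f"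
  by (simp_all add: inv_of_def)

lemma isomI:
  assumes "valid f" "valid g" "src g = tgt f" "tgt g = src f"
    and "g \<star> f = idt (src f)" "f \<star> g = idt (tgt f)"
  shows "isom f"
  using assms unfolding isom_def is_iso_def
  by (auto simp: cmp_def idt_def intro!: bexI[of _ "mor g"])

lemma isom_valid [simp]: "isom f \<Longrightarrow> valid f"
  by (simp add: isom_def)

lemma isomE:
  assumes "isom f"
  obtains g where "valid g" "src g = tgt f" "tgt g = src f" "g \<star> f = idt (src f)" "f \<star> g = idt (tgt f)"
proof -
  obtain g where "g \<in> arr C (tgt f) (src f)" "g \<cdot> mor f = Ident C (src f)" "mor f \<cdot> g = Ident C (tgt f)"
    using assms unfolding isom_def is_iso_def by blast
  moreover have "valid f" using assms by simp
  ultimately show thesis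
    by (intro that[of "Arrow (tgt f) g (src f)"] arrow_eqI) (simp_all add: mor_simps)
qed

lemma inverse_unique:
  assumes "valid f" "valid g" "valid h" "src g = tgt f" "tgt g = src f" "src h = tgt f" "tgt h = src f"
    and "g \<star> f = idt (src f)" "f \<star> h = idt (tgt f)"
  shows "g = h"
proof -
  have "g = g \<star> f \<star> h" using assms by simp
  also have "\<dots> = (g \<star> f) \<star> h" using assms by (intro cmp_assoc[symmetric]) auto
  also have "\<dots> = h" using assms by (simp del: cmp_assoc)
  finally show ?thesis .
qed

text \<open>\<open>inv_arr\<close> is a definite description, so it becomes usable only through
  uniqueness of the inverse.\<close>

lemma inv_of_eq:
  assumes "valid f" "valid g" "src g = tgt f" "tgt g = src f"
    and "g \<star> f = idt (src f)" "f \<star> g = idt (tgt f)"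
  shows "inv_of f = g"
proof -
  have "inv_arr C (src f) (tgt f) (mor f) = mor g"
    unfolding inv_arr_def
  proof (rule the_equality)
    show "mor g \<in> arr C (tgt f) (src f) \<and> mor g \<cdot> mor f = Ident C (src f) \<and> mor f \<cdot> mor g = Ident C (tgt f)"
      using assms by (auto simp: cmp_def idt_def)
  next
    fix h assume h: "h \<in> arr C (tgt f) (src f) \<and> h \<cdot> mor f = Ident C (src f) \<and> mor f \<cdot> h = Ident C (tgt f)"
    have "Arrow (tgt f) h (src f) = g"
      using h assms(1-4,6)
      by - (rule inverse_unique[of f _ g], simp_all add: cmp_def idt_def)
    then show "h = mor g" by auto
  qed
  then show ?thesis using assms by (intro arrow_eqI) (auto simp: inv_of_def)
qed

lemma inv_of_props:
  assumes "isom f"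
  shows valid_inv_of [simp]: "valid (inv_of f)"
    and inv_of_cmp [simp]: "inv_of f \<star> f = idt (src f)"
    and cmp_inv_of [simp]: "f \<star> inv_of f = idt (tgt f)"
  using isomE[OF assms] inv_of_eq isom_valid[OF assms] by metis+

lemma inv_of_cancel [simp]:
  assumes "isom f" "valid x"
  shows "tgt x = src f \<Longrightarrow> inv_of f \<star> f \<star> x = x" "tgt x = tgt f \<Longrightarrow> f \<star> inv_of f \<star> x = x"
  using assms by (simp_all add: cmp_reassoc[OF inv_of_cmp] cmp_reassoc[OF cmp_inv_of])

lemma isom_inv_of [simp]: "isom f \<Longrightarrow> isom (inv_of f)"
  by (rule isomI[of _ f]) simp_all

lemma isom_idt [simp]: "A \<in> Obj C \<Longrightarrow> isom (idt A)"
  by (rule isomI[of _ "idt A"]) simp_all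

lemma isom_cmp [simp]: "\<lbrakk>isom f; isom g; tgt f = src g\<rbrakk> \<Longrightarrow> isom (g \<star> f)"
  by (rule isomI[of _ "inv_of f \<star> inv_of g"]) simp_all

lemma isom_monic: "\<lbrakk>isom g; valid f; valid f'; tgt f = src g; tgt f' = src g; g \<star> f = g \<star> f'\<rbrakk> \<Longrightarrow> f = f'"
  by (metis inv_of_cancel(1))

lemma isom_epic: "\<lbrakk>isom g; valid f; valid f'; src f = tgt g; src f' = tgt g; f \<star> g = f' \<star> g\<rbrakk> \<Longrightarrow> f = f'"
  by (metis cmp_assoc cmp_idt cmp_inv_of inv_of_props(1) isom_valid tgt_inv_of)


subsection \<open>Biproducts\<close>

abbreviation inc :: "('i \<Rightarrow> 'o) \<Rightarrow> 'o \<Rightarrow> ('i \<Rightarrow> 'm) \<Rightarrow> 'i \<Rightarrow> ('o, 'm) arrow"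
  where "inc Y A \<iota> i \<equiv> Arrow (Y i) (\<iota> i) A"

abbreviation prj :: "('i \<Rightarrow> 'o) \<Rightarrow> 'o \<Rightarrow> ('i \<Rightarrow> 'm) \<Rightarrow> 'i \<Rightarrow> ('o, 'm) arrow"
  where "prj Y A \<pi> i \<equiv> Arrow A (\<pi> i) (Y i)"

lemma biproduct_valid:
  assumes "is_biproduct C I Y A \<iota> \<pi>"
  shows "i \<in> I \<Longrightarrow> valid (inc Y A \<iota> i)" "i \<in> I \<Longrightarrow> valid (prj Y A \<pi> i)"
    "i \<in> I \<Longrightarrow> Y i \<in> Obj C" "A \<in> Obj C"
  using assms by (auto simp: is_biproduct_def)

lemma biproduct_cmp:
  assumes "is_biproduct C I Y A \<iota> \<pi>" "i \<in> I" "j \<in> I"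
  shows "prj Y A \<pi> j \<star> inc Y A \<iota> i = (if i = j then idt (Y i) else zer (Y i) (Y j))"
  using assms by (auto simp: is_biproduct_def mor_simps intro!: arrow_eqI)

lemma biproduct_summand_arr:
  assumes "is_biproduct C I Y A \<iota> \<pi>"
  shows "(\<lambda>i. \<iota> i \<cdot> \<pi> i) \<in> I \<rightarrow> arr C A A"
proof
  fix i assume "i \<in> I"
  then show "\<iota> i \<cdot> \<pi> i \<in> arr C A A"
    using assms comp_arr[of A "Y i" A] by (auto simp: is_biproduct_def)
qed

text \<open>Precomposition with \<open>\<iota> j\<close> is linear and kills every term but one. The
  sum is kept explicit because the structure arrows in \<open>is_induced\<close> have exactly this
  shape.\<close>

lemma biproduct_glue:
  assumes bi: "is_biproduct C I Y A \<iota> \<pi>" and Z: "Z \<in> Obj C"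
    and f: "\<And>i. i \<in> I \<Longrightarrow> f i \<in> arr C (Y i) Z"
  defines "s \<equiv> (\<Oplus>\<^bsub>Hom C A Z\<^esub>i\<in>I. f i \<cdot> \<pi> i)"
  shows "s \<in> arr C A Z" "j \<in> I \<Longrightarrow> s \<cdot> \<iota> j = f j"
proof -
  have I: "finite I" and A: "A \<in> Obj C" and Y: "\<And>i. i \<in> I \<Longrightarrow> Y i \<in> Obj C"
    and \<iota>: "\<And>i. i \<in> I \<Longrightarrow> \<iota> i \<in> arr C (Y i) A" and \<pi>: "\<And>i. i \<in> I \<Longrightarrow> \<pi> i \<in> arr C A (Y i)"
    using bi by (auto simp: is_biproduct_def)
  have fp: "(\<lambda>i. f i \<cdot> \<pi> i) \<in> I \<rightarrow> arr C A Z"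
    using A Y \<pi> f Z by (auto intro: comp_arr)
  show "s \<in> arr C A Z"
    unfolding s_def using fp A Z by (intro abelian_monoid.finsum_closed hom_abelian_monoid)
  assume j: "j \<in> I"
  have "s \<cdot> \<iota> j = (\<Oplus>\<^bsub>Hom C (Y j) Z\<^esub>i\<in>I. (f i \<cdot> \<pi> i) \<cdot> \<iota> j)"
    unfolding s_def using A Z I fp Y[OF j] \<iota>[OF j]
    by (intro module_hom_finsum[where h = "\<lambda>g. g \<cdot> \<iota> j"] comp_linear_left)
  also have "\<dots> = (\<Oplus>\<^bsub>Hom C (Y j) Z\<^esub>i\<in>I. if j = i then f j else \<zero>\<^bsub>Hom C (Y j) Z\<^esub>)"
  proof (rule abelian_monoid.finsum_cong'[OF hom_abelian_monoid[OF Y[OF j] Z] refl])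
    show "(\<lambda>i. if j = i then f j else \<zero>\<^bsub>Hom C (Y j) Z\<^esub>) \<in> I \<rightarrow> arr C (Y j) Z"
      using f Y[OF j] Z by (auto intro: hom_zero_arr)
    fix i assume i: "i \<in> I"
    have "(Arrow (Y i) (f i) Z \<star> prj Y A \<pi> i) \<star> inc Y A \<iota> j = Arrow (Y i) (f i) Z \<star> prj Y A \<pi> i \<star> inc Y A \<iota> j"
      using biproduct_valid[OF bi] i j f Z by (intro cmp_assoc) auto
    also have "\<dots> = Arrow (Y j) (if j = i then f j else \<zero>\<^bsub>Hom C (Y j) Z\<^esub>) Z"
      using i j f[OF i] Y Z by (cases "j = i") (auto simp: biproduct_cmp[OF bi] simp flip: zer_def)
    finally show "(f i \<cdot> \<pi> i) \<cdot> \<iota> j = (if j = i then f j else \<zero>\<^bsub>Hom C (Y j) Z\<^esub>)"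
      by (simp add: cmp_def)
  qed
  also have "\<dots> = f j"
    using f[OF j] j I
    by (intro abelian_monoid.finsum_singleton[OF hom_abelian_monoid[OF Y[OF j] Z], where f = "\<lambda>_. f j"]) auto
  finally show "s \<cdot> \<iota> j = f j" .
qed

text \<open>Expanding the identity of \<open>A\<close> as the sum of all
  \<open>\<iota> i \<cdot> \<pi> i\<close> writes any arrow out of \<open>A\<close> in terms of its
  restrictions.\<close>

lemma biproduct_ext:
  assumes bi: "is_biproduct C I Y A \<iota> \<pi>" and "valid f" "valid f'" "src f = A" "src f' = A" "tgt f = tgt f'"
    and eq: "\<And>i. i \<in> I \<Longrightarrow> f \<star> inc Y A \<iota> i = f' \<star> inc Y A \<iota> i"
  shows "f = f'"
proof -
  have I: "finite I" and A: "A \<in> Obj C" and p: "(\<lambda>i. \<iota> i \<cdot> \<pi> i) \<in> I \<rightarrow> arr C A A"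
    using bi biproduct_summand_arr[OF bi] by (simp_all add: is_biproduct_def)
  have sum: "mor g = (\<Oplus>\<^bsub>Hom C A (tgt g)\<^esub>i\<in>I. mor ((g \<star> inc Y A \<iota> i) \<star> prj Y A \<pi> i))"
    if g: "valid g" "src g = A" for g
  proof -
    have "mor g = mor g \<cdot> Ident C A"
      using g cmp_idt[of g A] by (simp add: cmp_def idt_def) (metis arrow.sel(2))
    also have "Ident C A = (\<Oplus>\<^bsub>Hom C A A\<^esub>i\<in>I. \<iota> i \<cdot> \<pi> i)"
      using bi by (simp add: is_biproduct_def)
    also have "mor g \<cdot> \<dots> = (\<Oplus>\<^bsub>Hom C A (tgt g)\<^esub>i\<in>I. mor g \<cdot> (\<iota> i \<cdot> \<pi> i))"
      using g A I p by (intro module_hom_finsum[where h = "\<lambda>f. mor g \<cdot> f"] comp_linear_right)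
        auto
    also have "\<dots> = (\<Oplus>\<^bsub>Hom C A (tgt g)\<^esub>i\<in>I. mor ((g \<star> inc Y A \<iota> i) \<star> prj Y A \<pi> i))"
    proof (rule abelian_monoid.finsum_cong'[OF hom_abelian_monoid refl])
      show "(\<lambda>i. mor ((g \<star> inc Y A \<iota> i) \<star> prj Y A \<pi> i)) \<in> I \<rightarrow> arr C A (tgt g)"
        using biproduct_valid[OF bi] g valid_cmp by fastforce
      fix i assume "i \<in> I"
      then show "mor g \<cdot> (\<iota> i \<cdot> \<pi> i) = mor ((g \<star> inc Y A \<iota> i) \<star> prj Y A \<pi> i)"
        using biproduct_valid[OF bi] g by (simp add: mor_simps)
    qed (use g A in auto)
    finally show ?thesis .
  qed
  have "mor f = mor f'"
    unfolding sum[OF assms(2,4)] sum[OF assms(3,5)] assms(6)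
  proof (rule abelian_monoid.finsum_cong'[OF hom_abelian_monoid refl])
    show "(\<lambda>i. mor ((f' \<star> inc Y A \<iota> i) \<star> prj Y A \<pi> i)) \<in> I \<rightarrow> arr C A (tgt f')"
      using biproduct_valid[OF bi] assms(3,5) valid_cmp by fastforce
  qed (use assms eq A in auto)
  then show ?thesis using assms by (intro arrow_eqI) auto
qed

lemma biproduct_coext:
  assumes bi: "is_biproduct C I Y A \<iota> \<pi>" and f: "valid f" "valid f'" "tgt f = A" "tgt f' = A" "src f = src f'"
    and eq: "\<And>i. i \<in> I \<Longrightarrow> prj Y A \<pi> i \<star> f = prj Y A \<pi> i \<star> f'"
  shows "f = f'"
proof -
  have I: "finite I" and A: "A \<in> Obj C" and p: "(\<lambda>i. \<iota> i \<cdot> \<pi> i) \<in> I \<rightarrow> arr C A A"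
    using bi biproduct_summand_arr[OF bi] by (simp_all add: is_biproduct_def)
  have sum: "mor g = (\<Oplus>\<^bsub>Hom C (src g) A\<^esub>i\<in>I. mor (inc Y A \<iota> i \<star> prj Y A \<pi> i \<star> g))"
    if g: "valid g" "tgt g = A" for g
  proof -
    have "mor g = Ident C A \<cdot> mor g"
      using g idt_cmp[of g A] by (simp add: cmp_def idt_def) (metis arrow.sel(2))
    also have "Ident C A = (\<Oplus>\<^bsub>Hom C A A\<^esub>i\<in>I. \<iota> i \<cdot> \<pi> i)"
      using bi by (simp add: is_biproduct_def)
    also have "\<dots> \<cdot> mor g = (\<Oplus>\<^bsub>Hom C (src g) A\<^esub>i\<in>I. (\<iota> i \<cdot> \<pi> i) \<cdot> mor g)"
      using g A I p by (intro module_hom_finsum[where h = "\<lambda>f. f \<cdot> mor g"] comp_linear_left)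
        auto
    also have "\<dots> = (\<Oplus>\<^bsub>Hom C (src g) A\<^esub>i\<in>I. mor (inc Y A \<iota> i \<star> prj Y A \<pi> i \<star> g))"
    proof (rule abelian_monoid.finsum_cong'[OF hom_abelian_monoid refl])
      show "(\<lambda>i. mor (inc Y A \<iota> i \<star> prj Y A \<pi> i \<star> g)) \<in> I \<rightarrow> arr C (src g) A"
        using biproduct_valid[OF bi] g valid_cmp by fastforce
      fix i assume "i \<in> I"
      then have "(inc Y A \<iota> i \<star> prj Y A \<pi> i) \<star> g = inc Y A \<iota> i \<star> prj Y A \<pi> i \<star> g"
        using biproduct_valid[OF bi] g by (intro cmp_assoc) auto
      then show "(\<iota> i \<cdot> \<pi> i) \<cdot> mor g = mor (inc Y A \<iota> i \<star> prj Y A \<pi> i \<star> g)"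
        by (simp add: cmp_def)
    qed (use g A in auto)
    finally show ?thesis .
  qed
  have "mor f = mor f'"
    unfolding sum[OF f(1,3)] sum[OF f(2,4)] f(5)
  proof (rule abelian_monoid.finsum_cong'[OF hom_abelian_monoid refl])
    show "(\<lambda>i. mor (inc Y A \<iota> i \<star> prj Y A \<pi> i \<star> f')) \<in> I \<rightarrow> arr C (src f') A"
      using biproduct_valid[OF bi] f valid_cmp by fastforce
  qed (use f eq A in auto)
  then show ?thesis using f by (intro arrow_eqI) auto
qed

end

section \<open>Finite direct sums from binary ones\<close>

lemma (in abelian_category) biproduct_exists:
  assumes "finite I" "\<And>i. i \<in> I \<Longrightarrow> Y i \<in> Obj C"
  shows "\<exists>A \<iota> \<pi>. is_biproduct C I Y A \<iota> \<pi>"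
  using assms
proof (induction I rule: finite_induct)
  case empty
  \<comment> \<open>The empty sum is zero, so the identity has to vanish here; it does on a zero
    object, which has a single endomorphism.\<close>
  obtain Z where Z: "is_zero_object C Z" using zero_object by blast
  then have "Z \<in> Obj C" "Ident C Z = \<zero>\<^bsub>Hom C Z Z\<^esub>"
    using ident_arr hom_zero_arr unfolding is_zero_object_def by metis+
  then show ?case
    by (intro exI[of _ Z]) (simp add: is_biproduct_def abelian_monoid.finsum_empty hom_abelian_monoid)
next
  case (insert i I)
  then obtain A \<iota> \<pi> where bi: "is_biproduct C I Y A \<iota> \<pi>" by auto
  note A = biproduct_valid[OF bi]
  have Yi: "Y i \<in> Obj C" using insert.prems by auto
  obtain S \<iota>2 \<pi>2 where bi2: "is_biproduct C UNIV (\<lambda>b. if b then Y i else A) S \<iota>2 \<pi>2"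
    using direct_sums[OF Yi A(4)] by blast
  let ?Y = "\<lambda>b. if b then Y i else A"
  define u where "u = Arrow (Y i) (\<iota>2 True) S"
  define v where "v = Arrow A (\<iota>2 False) S"
  define p where "p = Arrow S (\<pi>2 True) (Y i)"
  define q where "q = Arrow S (\<pi>2 False) A"
  have S: "S \<in> Obj C" using biproduct_valid[OF bi2] by simp
  have [simp]: "valid u" "valid v" "valid p" "valid q" "src u = Y i" "src v = A" "src p = S" "src q = S"
    "tgt u = S" "tgt v = S" "tgt p = Y i" "tgt q = A"
    using biproduct_valid(1,2)[OF bi2, of True] biproduct_valid(1,2)[OF bi2, of False]
    by (simp_all add: u_def v_def p_def q_def)
  have pq: "p \<star> u = idt (Y i)" "q \<star> v = idt A" "p \<star> v = zer A (Y i)" "q \<star> u = zer (Y i) A"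
    using biproduct_cmp[OF bi2, of True True] biproduct_cmp[OF bi2, of False False]
      biproduct_cmp[OF bi2, of False True] biproduct_cmp[OF bi2, of True False]
    by (simp_all add: u_def v_def p_def q_def)
  \<comment> \<open>The new summand is the first factor of the binary sum; the old ones enter
    through the second factor \<open>A\<close>.\<close>
  define \<iota>' where "\<iota>' j = (if j = i then mor u else mor (v \<star> inc Y A \<iota> j))" for j
  define \<pi>' where "\<pi>' j = (if j = i then mor p else mor (prj Y A \<pi> j \<star> q))" for j
  have inc': "inc Y S \<iota>' j = (if j = i then u else v \<star> inc Y A \<iota> j)" for j
    by (auto intro!: arrow_eqI simp: \<iota>'_def)
  have prj': "prj Y S \<pi>' j = (if j = i then p else prj Y A \<pi> j \<star> q)" for j
    by (auto intro!: arrow_eqI simp: \<pi>'_def)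
  have v: "valid (inc Y S \<iota>' j)" "valid (prj Y S \<pi>' j)" if "j \<in> insert i I" for j
    using that A unfolding inc' prj' by auto
  then have arrs: "\<iota>' j \<in> arr C (Y j) S" "\<pi>' j \<in> arr C S (Y j)" if "j \<in> insert i I" for j
    using that by force+
  have comps: "\<iota>' j \<cdot> \<pi>' j \<in> arr C S S" if "j \<in> insert i I" for j
    using comp_arr[OF S _ S, of "Y j"] arrs that insert.prems by blast
  have orth: "prj Y S \<pi>' k \<star> inc Y S \<iota>' j = (if j = k then idt (Y j) else zer (Y j) (Y k))"
    if "j \<in> insert i I" "k \<in> insert i I" for j k
    using that A Yi insert.hyps(2)
    by (auto simp: inc' prj' pq cmp_reassoc[OF pq(1)] cmp_reassoc[OF pq(2)] cmp_reassoc[OF pq(3)]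
        biproduct_cmp[OF bi])
  \<comment> \<open>Summed over \<open>I\<close>, these terms collapse to
    \<open>v \<star> q\<close>, which leaves the two-term sum that is the identity of
    \<open>S\<close>.\<close>
  have summand: "\<iota>' j \<cdot> \<pi>' j = mor v \<cdot> (\<iota> j \<cdot> \<pi> j) \<cdot> mor q" if "j \<in> I" for j
  proof -
    have "(v \<star> inc Y A \<iota> j) \<star> prj Y A \<pi> j \<star> q = (v \<star> inc Y A \<iota> j \<star> prj Y A \<pi> j) \<star> q"
      using that A by simp
    then have "mor ((v \<star> inc Y A \<iota> j) \<star> prj Y A \<pi> j \<star> q) = mor ((v \<star> inc Y A \<iota> j \<star> prj Y A \<pi> j) \<star> q)"
      by simp
    then show ?thesis
      using that insert.hyps(2) by (auto simp: \<iota>'_def \<pi>'_def mor_simps)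
  qed
  have inner: "(\<lambda>j. \<iota> j \<cdot> \<pi> j) \<in> I \<rightarrow> arr C A A"
    by (rule biproduct_summand_arr[OF bi])
  have vq: "(\<lambda>x. mor v \<cdot> x \<cdot> mor q) (\<Oplus>\<^bsub>Hom C A A\<^esub>j\<in>I. \<iota> j \<cdot> \<pi> j)
      = (\<Oplus>\<^bsub>Hom C S S\<^esub>j\<in>I. mor v \<cdot> (\<iota> j \<cdot> \<pi> j) \<cdot> mor q)"
  proof -
    have *: "mor v \<in> arr C A S" "mor q \<in> arr C S A"
      using \<open>valid v\<close> \<open>valid q\<close> by auto
    have "mor v \<cdot> (\<Oplus>\<^bsub>Hom C A A\<^esub>j\<in>I. \<iota> j \<cdot> \<pi> j) = (\<Oplus>\<^bsub>Hom C A S\<^esub>j\<in>I. mor v \<cdot> (\<iota> j \<cdot> \<pi> j))"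
      using * A S inner insert.hyps(1)
      by (intro module_hom_finsum[where h = "\<lambda>x. mor v \<cdot> x"] comp_linear_right)
    moreover have "\<dots> \<cdot> mor q = (\<Oplus>\<^bsub>Hom C S S\<^esub>j\<in>I. mor v \<cdot> (\<iota> j \<cdot> \<pi> j) \<cdot> mor q)"
      using * A S inner insert.hyps(1)
      by (intro module_hom_finsum[where h = "\<lambda>x. x \<cdot> mor q"] comp_linear_left)
        (auto intro!: comp_arr[of A A S])
    ultimately show ?thesis by simp
  qed
  have "(\<Oplus>\<^bsub>Hom C S S\<^esub>j\<in>insert i I. \<iota>' j \<cdot> \<pi>' j)
      = \<iota>' i \<cdot> \<pi>' i \<oplus>\<^bsub>Hom C S S\<^esub> (\<Oplus>\<^bsub>Hom C S S\<^esub>j\<in>I. \<iota>' j \<cdot> \<pi>' j)"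
    using insert.hyps comps S
    by (intro abelian_monoid.finsum_insert[OF hom_abelian_monoid]) auto
  also have "(\<Oplus>\<^bsub>Hom C S S\<^esub>j\<in>I. \<iota>' j \<cdot> \<pi>' j) = (\<Oplus>\<^bsub>Hom C S S\<^esub>j\<in>I. mor v \<cdot> (\<iota> j \<cdot> \<pi> j) \<cdot> mor q)"
    using S comps summand
    by (intro abelian_monoid.finsum_cong'[OF hom_abelian_monoid]) (auto simp flip: summand)
  also have "\<dots> = mor v \<cdot> Ident C A \<cdot> mor q"
    using vq bi by (simp add: is_biproduct_def)
  also have "\<dots> = mor (v \<star> q)"
    by (metis mor_simps(1,2) cmp_idt \<open>valid v\<close> \<open>src v = A\<close>)
  also have "\<iota>' i \<cdot> \<pi>' i \<oplus>\<^bsub>Hom C S S\<^esub> mor (v \<star> q)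
      = (\<Oplus>\<^bsub>Hom C S S\<^esub>b\<in>{True, False}. \<iota>2 b \<cdot> \<pi>2 b)"
  proof -
    have cl: "\<iota>2 b \<cdot> \<pi>2 b \<in> arr C S S" for b
      using bi2 A Yi by (auto simp: is_biproduct_def intro!: comp_arr[of S "?Y b" S])
    interpret S: abelian_monoid "Hom C S S" by (rule hom_abelian_monoid[OF S S])
    have "(\<Oplus>\<^bsub>Hom C S S\<^esub>b\<in>{True, False}. \<iota>2 b \<cdot> \<pi>2 b)
        = \<iota>2 True \<cdot> \<pi>2 True \<oplus>\<^bsub>Hom C S S\<^esub> (\<iota>2 False \<cdot> \<pi>2 False \<oplus>\<^bsub>Hom C S S\<^esub> \<zero>\<^bsub>Hom C S S\<^esub>)"
      using cl by (simp add: S.finsum_insert S.finsum_empty)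
    then show ?thesis
      using cl by (simp add: \<iota>'_def \<pi>'_def mor_simps u_def v_def p_def q_def)
  qed
  also have "{True, False} = UNIV" by auto
  also have "(\<Oplus>\<^bsub>Hom C S S\<^esub>b\<in>UNIV. \<iota>2 b \<cdot> \<pi>2 b) = Ident C S"
    using bi2 by (simp add: is_biproduct_def)
  finally have "(\<Oplus>\<^bsub>Hom C S S\<^esub>j\<in>insert i I. \<iota>' j \<cdot> \<pi>' j) = Ident C S" .
  moreover have "\<pi>' k \<cdot> \<iota>' j = (if j = k then Ident C (Y j) else \<zero>\<^bsub>Hom C (Y j) (Y k)\<^esub>)"
    if "j \<in> insert i I" "k \<in> insert i I" for j k
    using arg_cong[where f = mor, OF orth[OF that]] by (auto simp: mor_simps split: if_splits)
  ultimately have "is_biproduct C (insert i I) Y S \<iota>' \<pi>'"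
    unfolding is_biproduct_def using insert.hyps insert.prems S arrs by auto
  then show ?case by blast
qed

section \<open>Equivariant objects\<close>

context tensor_action
begin

abbreviation ob :: "'f \<Rightarrow> 'o \<Rightarrow> 'o"
  where "ob x A \<equiv> FObj (T x) A"

definition act :: "'f \<Rightarrow> ('o, 'm) arrow \<Rightarrow> ('o, 'm) arrow"
  where "act x f = Arrow (ob x (src f)) (FMor (T x) (mor f)) (ob x (tgt f))"

definition coh :: "'f \<Rightarrow> 'f \<Rightarrow> 'o \<Rightarrow> ('o, 'm) arrow"
  where "coh x y A = Arrow (ob x (ob y A)) (T2 x y A) (ob (x \<otimes>\<^bsub>F\<^esub> y) A)"

lemma src_tgt_act [simp]:
  "src (act x f) = ob x (src f)" "tgt (act x f) = ob x (tgt f)"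
  "src (coh x y A) = ob x (ob y A)" "tgt (coh x y A) = ob (x \<otimes>\<^bsub>F\<^esub> y) A"
  by (simp_all add: act_def coh_def)

lemma functor_act: "x \<in> carrier F \<Longrightarrow> is_functor C (FObj (T x)) (FMor (T x))"
  using autoequivalence[of x] by (simp add: is_linear_tensor_autoequivalence_def is_tensor_functor_def)

lemma act_linear:
  "\<lbrakk>x \<in> carrier F; A \<in> Obj C; Y \<in> Obj C\<rbrakk> \<Longrightarrow> FMor (T x) \<in> module_hom K (Hom C A Y) (Hom C (ob x A) (ob x Y))"
  using autoequivalence[of x] by (simp add: is_linear_tensor_autoequivalence_def)

lemma ob_obj [simp]: "\<lbrakk>x \<in> carrier F; A \<in> Obj C\<rbrakk> \<Longrightarrow> ob x A \<in> Obj C"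
  using functor_act[of x] by (simp add: is_functor_def)

lemma valid_act [simp]: "\<lbrakk>x \<in> carrier F; valid f\<rbrakk> \<Longrightarrow> valid (act x f)"
  using functor_act[of x] by (simp add: is_functor_def act_def)

lemma act_cmp [simp]:
  assumes "x \<in> carrier F" "valid f" "valid g" "tgt f = src g"
  shows "act x (g \<star> f) = act x g \<star> act x f"
proof -
  have "\<lbrakk>A \<in> Obj C; Y \<in> Obj C; Z \<in> Obj C; u \<in> arr C A Y; v \<in> arr C Y Z\<rbrakk> \<Longrightarrow>
      FMor (T x) (v \<cdot> u) = FMor (T x) v \<cdot> FMor (T x) u" for A Y Z u v
    using functor_act[OF assms(1)] by (simp add: is_functor_def)
  from this[of "src f" "src g" "tgt g" "mor f" "mor g"] show ?thesis
    using assms by (simp add: act_def cmp_def)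
qed

lemma act_idt [simp]: "\<lbrakk>x \<in> carrier F; A \<in> Obj C\<rbrakk> \<Longrightarrow> act x (idt A) = idt (ob x A)"
  using functor_act[of x] by (simp add: is_functor_def act_def idt_def)

lemma act_zer [simp]:
  "\<lbrakk>x \<in> carrier F; A \<in> Obj C; B \<in> Obj C\<rbrakk> \<Longrightarrow> act x (zer A B) = zer (ob x A) (ob x B)"
  using module_hom_zero[OF act_linear] by (simp add: act_def zer_def)

lemma ob_one [simp]: "A \<in> Obj C \<Longrightarrow> ob \<one>\<^bsub>F\<^esub> A = A"
  using T_one by (simp add: is_identity_tensor_functor_def)

lemma act_one [simp]:
  assumes "valid f"
  shows "act \<one>\<^bsub>F\<^esub> f = f"
proof -
  have "\<lbrakk>A \<in> Obj C; Y \<in> Obj C; u \<in> arr C A Y\<rbrakk> \<Longrightarrow> FMor (T \<one>\<^bsub>F\<^esub>) u = u" for A Y u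
    using T_one by (simp add: is_identity_tensor_functor_def)
  from this[of "src f" "tgt f" "mor f"] show ?thesis
    using assms by (intro arrow_eqI) (simp_all add: act_def)
qed

lemma isom_act [simp]: "\<lbrakk>x \<in> carrier F; isom f\<rbrakk> \<Longrightarrow> isom (act x f)"
  by (rule isomI[of _ "act x (inv_of f)"]) (simp_all flip: act_cmp)

lemma act_inv_of: "\<lbrakk>x \<in> carrier F; isom f\<rbrakk> \<Longrightarrow> act x (inv_of f) = inv_of (act x f)"
  by (rule inv_of_eq[symmetric]) (simp_all flip: act_cmp)

lemma inv_of_idt [simp]: "A \<in> Obj C \<Longrightarrow> inv_of (idt A) = idt A"
  by (rule inv_of_eq) simp_all

lemma T2_natural_iso:
  assumes "x \<in> carrier F" "y \<in> carrier F"
  shows "is_natural_iso C (FObj (T x) \<circ> FObj (T y)) (FMor (T x) \<circ> FMor (T y))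
    (FObj (T (x \<otimes>\<^bsub>F\<^esub> y))) (FMor (T (x \<otimes>\<^bsub>F\<^esub> y))) (T2 x y)"
  using T2_iso[OF assms] by (simp add: is_tensor_natural_iso_def comp_tensor_functor_def)

lemma isom_coh [simp]: "\<lbrakk>x \<in> carrier F; y \<in> carrier F; A \<in> Obj C\<rbrakk> \<Longrightarrow> isom (coh x y A)"
  using T2_natural_iso[of x y] unfolding is_natural_iso_def isom_def coh_def is_iso_def by auto

lemma coh_natural:
  assumes "x \<in> carrier F" "y \<in> carrier F" "valid f"
  shows "coh x y (tgt f) \<star> act x (act y f) = act (x \<otimes>\<^bsub>F\<^esub> y) f \<star> coh x y (src f)"
proof -
  have "\<lbrakk>A \<in> Obj C; Y \<in> Obj C; u \<in> arr C A Y\<rbrakk> \<Longrightarrow>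
      T2 x y Y \<cdot> FMor (T x) (FMor (T y) u) = FMor (T (x \<otimes>\<^bsub>F\<^esub> y)) u \<cdot> T2 x y A" for A Y u
    using T2_natural_iso[OF assms(1,2)] by (simp add: is_natural_iso_def)
  from this[of "src f" "tgt f" "mor f"] show ?thesis
    using assms by (simp add: act_def coh_def cmp_def)
qed

lemma coh_inv_natural:
  assumes "x \<in> carrier F" "y \<in> carrier F" "valid f"
  shows "inv_of (coh x y (tgt f)) \<star> act (x \<otimes>\<^bsub>F\<^esub> y) f = act x (act y f) \<star> inv_of (coh x y (src f))"
    (is "?l = ?r")
proof (rule isom_epic)
  show "?l \<star> coh x y (src f) = ?r \<star> coh x y (src f)"
    using assms by (simp flip: coh_natural)
qed (use assms in simp_all)

lemma coh_assoc:
  "\<lbrakk>x \<in> carrier F; y \<in> carrier F; z \<in> carrier F; A \<in> Obj C\<rbrakk> \<Longrightarrow>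
    coh (x \<otimes>\<^bsub>F\<^esub> y) z A \<star> coh x y (ob z A) = coh x (y \<otimes>\<^bsub>F\<^esub> z) A \<star> act x (coh y z A)"
  by (rule arrow_eqI) (simp_all add: mor_simps T2_assoc F.m_assoc, simp_all add: act_def coh_def T2_assoc)

text \<open>Composing on the right with \<open>coh x y (ob z A)\<close> gives back
  \<open>coh_assoc\<close>. This form pushes an inverse to the left, as the inverses in
  \<open>ind_comp\<close> require.\<close>

lemma coh_assoc_inv:
  assumes "x \<in> carrier F" "y \<in> carrier F" "z \<in> carrier F" "A \<in> Obj C"
  shows "act x (coh y z A) \<star> inv_of (coh x y (ob z A)) =
    inv_of (coh x (y \<otimes>\<^bsub>F\<^esub> z) A) \<star> coh (x \<otimes>\<^bsub>F\<^esub> y) z A"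
    (is "?l = ?r")
proof (rule isom_epic)
  show "?l \<star> coh x y (ob z A) = ?r \<star> coh x y (ob z A)"
    using assms by (simp add: coh_assoc F.m_assoc)
qed (use assms in \<open>simp_all add: F.m_assoc\<close>)

lemma coh_one [simp]:
  assumes "x \<in> carrier F" "A \<in> Obj C"
  shows "coh x \<one>\<^bsub>F\<^esub> A = idt (ob x A)" "coh \<one>\<^bsub>F\<^esub> x A = idt (ob x A)"
  using T2_one[OF assms] assms by (simp_all add: coh_def idt_def)

text \<open>A biproduct consists of equations between composites and one finite sum;
  \<open>FMor (T x)\<close> is functorial and linear, so it preserves both.\<close>

lemma act_biproduct:
  assumes x: "x \<in> carrier F" and bi: "is_biproduct C I Y A \<iota> \<pi>"
  shows "is_biproduct C I (\<lambda>i. ob x (Y i)) (ob x A) (\<lambda>i. FMor (T x) (\<iota> i)) (\<lambda>i. FMor (T x) (\<pi> i))"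
proof -
  have I: "finite I" "A \<in> Obj C" and sum: "(\<Oplus>\<^bsub>Hom C A A\<^esub>i\<in>I. \<iota> i \<cdot> \<pi> i) = Ident C A"
    using bi by (auto simp: is_biproduct_def)
  note v = biproduct_valid[OF bi]
  have arrs: "FMor (T x) (\<iota> i) \<in> arr C (ob x (Y i)) (ob x A)" "FMor (T x) (\<pi> i) \<in> arr C (ob x A) (ob x (Y i))"
    if "i \<in> I" for i
    using valid_act[OF x v(1)[OF that]] valid_act[OF x v(2)[OF that]] by (simp_all add: act_def)
  have orth: "FMor (T x) (\<pi> j) \<cdot> FMor (T x) (\<iota> i)
      = (if i = j then Ident C (ob x (Y i)) else \<zero>\<^bsub>Hom C (ob x (Y i)) (ob x (Y j))\<^esub>)"
    if "i \<in> I" "j \<in> I" for i j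
  proof -
    have "act x (prj Y A \<pi> j) \<star> act x (inc Y A \<iota> i) = act x (prj Y A \<pi> j \<star> inc Y A \<iota> i)"
      using that x v by (intro act_cmp[symmetric]) auto
    also have "\<dots> = (if i = j then idt (ob x (Y i)) else zer (ob x (Y i)) (ob x (Y j)))"
      using that x v by (simp add: biproduct_cmp[OF bi])
    finally have "mor (act x (prj Y A \<pi> j) \<star> act x (inc Y A \<iota> i))
        = mor (if i = j then idt (ob x (Y i)) else zer (ob x (Y i)) (ob x (Y j)))"
      by simp
    then show ?thesis by (simp add: mor_simps act_def split: if_splits)
  qed
  have "Ident C (ob x A) = FMor (T x) (Ident C A)"
    using functor_act[OF x] I by (simp add: is_functor_def)
  also have "\<dots> = FMor (T x) (\<Oplus>\<^bsub>Hom C A A\<^esub>i\<in>I. \<iota> i \<cdot> \<pi> i)"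
    by (simp add: sum)
  also have "\<dots> = (\<Oplus>\<^bsub>Hom C (ob x A) (ob x A)\<^esub>i\<in>I. FMor (T x) (\<iota> i \<cdot> \<pi> i))"
    using I x biproduct_summand_arr[OF bi] by (intro module_hom_finsum act_linear) auto
  also have "\<dots> = (\<Oplus>\<^bsub>Hom C (ob x A) (ob x A)\<^esub>i\<in>I. FMor (T x) (\<iota> i) \<cdot> FMor (T x) (\<pi> i))"
  proof (rule abelian_monoid.finsum_cong'[OF hom_abelian_monoid refl])
    show "(\<lambda>i. FMor (T x) (\<iota> i) \<cdot> FMor (T x) (\<pi> i)) \<in> I \<rightarrow> arr C (ob x A) (ob x A)"
    proof
      fix i assume "i \<in> I"
      then show "FMor (T x) (\<iota> i) \<cdot> FMor (T x) (\<pi> i) \<in> arr C (ob x A) (ob x A)"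
        using arrs v x comp_arr[of "ob x A" "ob x (Y i)" "ob x A"] by simp
    qed
    fix i assume "i \<in> I"
    then have "act x (inc Y A \<iota> i \<star> prj Y A \<pi> i) = act x (inc Y A \<iota> i) \<star> act x (prj Y A \<pi> i)"
      using v x by (intro act_cmp) auto
    then show "FMor (T x) (\<iota> i \<cdot> \<pi> i) = FMor (T x) (\<iota> i) \<cdot> FMor (T x) (\<pi> i)"
      by (simp add: act_def cmp_def)
  qed (use x I in auto)
  finally show ?thesis
    unfolding is_biproduct_def using I x v arrs orth by auto
qed

section \<open>Structure arrows and equivariant morphisms\<close>

definition str :: "'o \<times> ('f \<Rightarrow> 'm) \<Rightarrow> 'f \<Rightarrow> ('o, 'm) arrow"
  where "str N h = Arrow (ob h (fst N)) (snd N h) (fst N)"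

lemma src_tgt_str [simp]: "src (str N h) = ob h (fst N)" "tgt (str N h) = fst N"
  by (simp_all add: str_def)

abbreviation eqv :: "'o set \<Rightarrow> 'f set \<Rightarrow> ('k, 'o \<times> ('f \<Rightarrow> 'm), 'm) category_data"
  where "eqv D H \<equiv> equivariantization C F T T2 D H"

lemma eqv_obj_iff:
  assumes "D \<subseteq> Obj C" "subgroup H F"
  shows "N \<in> Obj (eqv D H) \<longleftrightarrow> fst N \<in> D \<and> snd N \<in> extensional H \<and> (\<forall>h\<in>H. isom (str N h)) \<and>
    (\<forall>h\<in>H. \<forall>k\<in>H. str N h \<star> act h (str N k) = str N (h \<otimes>\<^bsub>F\<^esub> k) \<star> coh h k (fst N)) \<and>
    str N \<one>\<^bsub>F\<^esub> = idt (fst N)"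
proof -
  have H: "h \<in> carrier F" if "h \<in> H" for h
    using subgroup.mem_carrier[OF assms(2) that] .
  have iso: "isom (str N h) \<longleftrightarrow> is_iso C (ob h (fst N)) (fst N) (snd N h)" if "fst N \<in> D" "h \<in> H" for h
    using that assms(1) H by (auto simp: isom_def str_def is_iso_def)
  have coc: "str N h \<star> act h (str N k) = str N (h \<otimes>\<^bsub>F\<^esub> k) \<star> coh h k (fst N)
      \<longleftrightarrow> snd N h \<cdot> FMor (T h) (snd N k) = snd N (h \<otimes>\<^bsub>F\<^esub> k) \<cdot> T2 h k (fst N)" for h k
    by (simp add: cmp_def str_def act_def coh_def)
  have one: "str N \<one>\<^bsub>F\<^esub> = idt (fst N) \<longleftrightarrow> snd N \<one>\<^bsub>F\<^esub> = Ident C (fst N)" if "fst N \<in> D"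
    using that assms(1) by (auto simp: str_def idt_def)
  have "N \<in> Obj (eqv D H) \<longleftrightarrow> fst N \<in> D \<and> snd N \<in> extensional H \<and>
      (\<forall>h\<in>H. is_iso C (ob h (fst N)) (fst N) (snd N h)) \<and>
      (\<forall>h\<in>H. \<forall>k\<in>H. snd N h \<cdot> FMor (T h) (snd N k) = snd N (h \<otimes>\<^bsub>F\<^esub> k) \<cdot> T2 h k (fst N)) \<and>
      snd N \<one>\<^bsub>F\<^esub> = Ident C (fst N)"
    by (cases N) (simp add: equivariantization_def)
  then show ?thesis
    unfolding coc using iso one by auto
qed

definition eqhom :: "'f set \<Rightarrow> 'o \<times> ('f \<Rightarrow> 'm) \<Rightarrow> 'o \<times> ('f \<Rightarrow> 'm) \<Rightarrow> ('o, 'm) arrow \<Rightarrow> bool"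
  where "eqhom H N N' f \<longleftrightarrow> valid f \<and> src f = fst N \<and> tgt f = fst N' \<and>
    (\<forall>h\<in>H. f \<star> str N h = str N' h \<star> act h f)"

text \<open>Phrased by validity of structure arrows instead of membership in one category, so that
  it also composes arrows between an object with structure for a stabilizer and one with structure
  for all of \<open>F\<close>, such as the inclusion of a component.\<close>

lemma eqhom_cmp_general:
  assumes H: "H \<subseteq> carrier F"
    and v: "\<And>h. h \<in> H \<Longrightarrow> valid (str N h)" "\<And>h. h \<in> H \<Longrightarrow> valid (str N' h)" "\<And>h. h \<in> H \<Longrightarrow> valid (str N'' h)"
    and f: "eqhom H N N' f" and g: "eqhom H N' N'' g"
  shows "eqhom H N N'' (g \<star> f)"
proof -
  have [simp]: "valid f" "valid g" "src f = fst N" "tgt f = fst N'" "src g = fst N'" "tgt g = fst N''"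
    using f g by (auto simp: eqhom_def)
  have "(g \<star> f) \<star> str N h = str N'' h \<star> act h (g \<star> f)" if h: "h \<in> H" for h
  proof -
    have "f \<star> str N h = str N' h \<star> act h f" and e: "g \<star> str N' h = str N'' h \<star> act h g"
      using f g h by (auto simp: eqhom_def)
    then show ?thesis
      using h H v[OF h] by (simp add: cmp_reassoc[OF e] subsetD)
  qed
  then show ?thesis by (simp add: eqhom_def)
qed

end

section \<open>The equivariantization as a category in its own right\<close>

locale equivariant_category = tensor_action K C F T T2
  for K :: "('k, 'c) ring_scheme" and C :: "('k, 'o, 'm, 'z) tensor_category_data_scheme" (structure)
    and F :: "('f, 'a) monoid_scheme" and T T2 +
  fixes D :: "'o set" and H :: "'f set"
  assumes D_sub: "D \<subseteq> Obj C" and H_subgroup: "subgroup H F"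
begin

abbreviation E :: "('k, 'o \<times> ('f \<Rightarrow> 'm), 'm) category_data"
  where "E \<equiv> eqv D H"

lemma H_carrier [simp]: "h \<in> H \<Longrightarrow> h \<in> carrier F"
  using subgroup.mem_carrier[OF H_subgroup] .

lemma E_obj:
  assumes "N \<in> Obj E"
  shows "fst N \<in> D" "fst N \<in> Obj C" "h \<in> H \<Longrightarrow> isom (str N h)" "h \<in> H \<Longrightarrow> valid (str N h)"
    "\<lbrakk>h \<in> H; k \<in> H\<rbrakk> \<Longrightarrow> str N h \<star> act h (str N k) = str N (h \<otimes>\<^bsub>F\<^esub> k) \<star> coh h k (fst N)"
    "str N \<one>\<^bsub>F\<^esub> = idt (fst N)"
  using assms D_sub by (auto simp: eqv_obj_iff[OF D_sub H_subgroup])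

lemma E_simps: "Comp E = Comp C" "Ident E N = Ident C (fst N)" "\<zero>\<^bsub>Hom E N N'\<^esub> = \<zero>\<^bsub>Hom C (fst N) (fst N')\<^esub>"
  by (simp_all add: equivariantization_def split: prod.splits)

lemma E_arr:
  assumes "N \<in> Obj E" "N' \<in> Obj E"
  shows "m \<in> arr E N N' \<longleftrightarrow> eqhom H N N' (Arrow (fst N) m (fst N'))"
  using E_obj(2)[OF assms(1)] E_obj(2)[OF assms(2)]
  by (auto simp: equivariantization_def eqhom_def cmp_def str_def act_def split: prod.splits)

lemma eqhom_mor:
  "\<lbrakk>N \<in> Obj E; N' \<in> Obj E; eqhom H N N' f\<rbrakk> \<Longrightarrow> mor f \<in> arr E N N'"
  by (simp add: E_arr) (metis arrow.collapse eqhom_def)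

lemma eqhom_idt: "N \<in> Obj E \<Longrightarrow> eqhom H N N (idt (fst N))"
  using E_obj[of N] by (simp add: eqhom_def)

lemma eqhom_zer: "\<lbrakk>N \<in> Obj E; N' \<in> Obj E\<rbrakk> \<Longrightarrow> eqhom H N N' (zer (fst N) (fst N'))"
  using E_obj[of N] E_obj[of N'] by (simp add: eqhom_def)

lemma eqhom_cmp:
  assumes "N \<in> Obj E" "N' \<in> Obj E" "N'' \<in> Obj E" "eqhom H N N' f" "eqhom H N' N'' g"
  shows "eqhom H N N'' (g \<star> f)"
  by (rule eqhom_cmp_general) (use assms E_obj(4) in auto)

text \<open>After cancelling the isomorphism \<open>act h f\<close> on the right, what remains is
  the equivariance of \<open>f\<close>.\<close>

lemma eqhom_inv_of:
  assumes "N \<in> Obj E" "N' \<in> Obj E" and f: "eqhom H N N' f" and i: "isom f"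
  shows "eqhom H N' N (inv_of f)"
proof -
  note simps = E_obj(4)[OF assms(1)] E_obj(4)[OF assms(2)]
  have [simp]: "valid f" "src f = fst N" "tgt f = fst N'"
    using f by (auto simp: eqhom_def)
  have "inv_of f \<star> str N' h = str N h \<star> act h (inv_of f)" if h: "h \<in> H" for h
  proof (rule isom_epic[of "act h f"])
    have "f \<star> str N h = str N' h \<star> act h f"
      using f h by (auto simp: eqhom_def)
    then have "(inv_of f \<star> str N' h) \<star> act h f = inv_of f \<star> f \<star> str N h"
      using h simps i by simp
    also have "\<dots> = (str N h \<star> act h (inv_of f)) \<star> act h f"
      using h simps i by (simp add: act_inv_of)
    finally show "(inv_of f \<star> str N' h) \<star> act h f = (str N h \<star> act h (inv_of f)) \<star> act h f" .
  qed (use h simps i in simp_all)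
  then show ?thesis using i by (simp add: eqhom_def)
qed

lemma E_is_iso:
  assumes N: "N \<in> Obj E" "N' \<in> Obj E"
  shows "is_iso E N N' m \<longleftrightarrow> eqhom H N N' (Arrow (fst N) m (fst N')) \<and> isom (Arrow (fst N) m (fst N'))"
    (is "?l \<longleftrightarrow> ?r")
proof
  assume ?l
  then obtain g where "m \<in> arr E N N'" "g \<in> arr E N' N"
    and eq: "g \<cdot> m = Ident C (fst N)" "m \<cdot> g = Ident C (fst N')"
    by (auto simp: is_iso_def E_simps)
  then have hom: "eqhom H N N' (Arrow (fst N) m (fst N'))" "eqhom H N' N (Arrow (fst N') g (fst N))"
    using N by (simp_all add: E_arr)
  then have "isom (Arrow (fst N) m (fst N'))"
    using eq by (intro isomI[of _ "Arrow (fst N') g (fst N)"]) (auto simp: eqhom_def cmp_def idt_def)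
  with hom show ?r by simp
next
  assume r: ?r
  let ?f = "Arrow (fst N) m (fst N')"
  have "mor (inv_of ?f) \<in> arr E N' N" "m \<in> arr E N N'"
    using eqhom_mor[OF N(2,1) eqhom_inv_of] r N by (auto simp: E_arr)
  moreover have "mor (inv_of ?f) \<cdot> m = Ident C (fst N)" "m \<cdot> mor (inv_of ?f) = Ident C (fst N')"
    using r inv_of_cmp[of ?f] cmp_inv_of[of ?f] by (auto simp: cmp_def idt_def)
  ultimately show ?l
    unfolding is_iso_def by (auto simp: E_simps)
qed

lemma E_isomorphic:
  assumes N: "N \<in> Obj E" "N' \<in> Obj E"
  shows "isomorphic E N N' \<longleftrightarrow> (\<exists>f. eqhom H N N' f \<and> isom f)"
  unfolding isomorphic_def E_is_iso[OF assms] by (metis arrow.collapse eqhom_def)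

lemma E_isomorphic_refl: "N \<in> Obj E \<Longrightarrow> isomorphic E N N"
  using eqhom_idt[of N] E_obj(2)[of N] isom_idt[of "fst N"] by (auto simp: E_isomorphic)

lemma E_isomorphic_sym: "\<lbrakk>N \<in> Obj E; N' \<in> Obj E; isomorphic E N N'\<rbrakk> \<Longrightarrow> isomorphic E N' N"
  by (metis E_isomorphic eqhom_inv_of isom_inv_of)

lemma E_isomorphic_trans:
  assumes "N \<in> Obj E" "N' \<in> Obj E" "N'' \<in> Obj E" "isomorphic E N N'" "isomorphic E N' N''"
  shows "isomorphic E N N''"
proof -
  obtain f g where "eqhom H N N' f" "isom f" "eqhom H N' N'' g" "isom g"
    using assms by (auto simp: E_isomorphic)
  moreover from this have "isom (g \<star> f)" by (auto simp: eqhom_def)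
  ultimately show ?thesis
    using eqhom_cmp[OF assms(1-3)] assms by (auto simp: E_isomorphic)
qed

lemma E_iso_class_eq_iff:
  assumes "N \<in> Obj E" "N' \<in> Obj E"
  shows "iso_class E N = iso_class E N' \<longleftrightarrow> isomorphic E N N'"
proof
  assume "iso_class E N = iso_class E N'"
  moreover have "N' \<in> iso_class E N'"
    using assms E_isomorphic_refl by (auto simp: iso_class_def)
  ultimately show "isomorphic E N N'" by (auto simp: iso_class_def)
next
  assume *: "isomorphic E N N'"
  show "iso_class E N = iso_class E N'"
    unfolding iso_class_def
    using E_isomorphic_trans[OF assms(1,2) _ *] E_isomorphic_trans[OF assms(2,1) _ E_isomorphic_sym[OF assms *]]
      E_isomorphic_trans assms E_isomorphic_sym * by blast
qed

text \<open>The test objects \<open>Z\<close> are equivariant, so \<open>f\<close> is not assumed to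
  be monic in \<open>C\<close>. Every transfer of this property to another equivariantization has to
  provide for its test objects.\<close>

definition eqmono :: "'o \<times> ('f \<Rightarrow> 'm) \<Rightarrow> 'o \<times> ('f \<Rightarrow> 'm) \<Rightarrow> ('o, 'm) arrow \<Rightarrow> bool"
  where "eqmono N N' f \<longleftrightarrow> eqhom H N N' f \<and>
    (\<forall>Z\<in>Obj E. \<forall>u v. eqhom H Z N u \<longrightarrow> eqhom H Z N v \<longrightarrow> f \<star> u = f \<star> v \<longrightarrow> u = v)"

lemma E_is_mono:
  assumes N: "N \<in> Obj E" "N' \<in> Obj E"
  shows "is_mono E N N' m \<longleftrightarrow> eqmono N N' (Arrow (fst N) m (fst N'))"
proof -
  let ?f = "Arrow (fst N) m (fst N')"
  have "(\<forall>u\<in>arr E Z N. \<forall>v\<in>arr E Z N. m \<cdot> u = m \<cdot> v \<longrightarrow> u = v) \<longleftrightarrow>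
    (\<forall>u v. eqhom H Z N u \<longrightarrow> eqhom H Z N v \<longrightarrow> ?f \<star> u = ?f \<star> v \<longrightarrow> u = v)" if Z: "Z \<in> Obj E" for Z
  proof safe
    fix u v
    assume *: "\<forall>u\<in>arr E Z N. \<forall>v\<in>arr E Z N. m \<cdot> u = m \<cdot> v \<longrightarrow> u = v"
      and u: "eqhom H Z N u" and v: "eqhom H Z N v" and "?f \<star> u = ?f \<star> v"
    then have "mor u = mor v"
      using eqhom_mor[OF Z N(1) u] eqhom_mor[OF Z N(1) v] by (auto simp: cmp_def)
    then show "u = v" using u v by (intro arrow_eqI) (auto simp: eqhom_def)
  next
    fix u v
    assume *: "\<forall>u v. eqhom H Z N u \<longrightarrow> eqhom H Z N v \<longrightarrow> ?f \<star> u = ?f \<star> v \<longrightarrow> u = v"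
      and "u \<in> arr E Z N" "v \<in> arr E Z N" "m \<cdot> u = m \<cdot> v"
    then have "Arrow (fst Z) u (fst N) = Arrow (fst Z) v (fst N)"
      using Z N by - (rule *[THEN spec, THEN spec, THEN mp, THEN mp, THEN mp], auto simp: E_arr cmp_def)
    then show "u = v" by simp
  qed
  then show ?thesis
    unfolding is_mono_def eqmono_def using E_arr[OF N] by (simp add: E_simps)
qed

text \<open>If the identity is zero, every arrow into or out of the object is zero, as it factors
  through the identity. The criterion is an equation in \<open>C\<close>, so it can be compared
  across different equivariantizations.\<close>

lemma E_is_zero_object:
  assumes N: "N \<in> Obj E"
  shows "is_zero_object E N \<longleftrightarrow> idt (fst N) = zer (fst N) (fst N)"
proof
  assume "is_zero_object E N"
  then have "\<exists>!f. f \<in> arr E N N" using N by (auto simp: is_zero_object_def)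
  moreover have "mor (idt (fst N)) \<in> arr E N N" "mor (zer (fst N) (fst N)) \<in> arr E N N"
    using N eqhom_idt eqhom_zer eqhom_mor by auto
  ultimately have "mor (idt (fst N)) = mor (zer (fst N) (fst N))" by blast
  then show "idt (fst N) = zer (fst N) (fst N)" by (intro arrow_eqI) auto
next
  assume z: "idt (fst N) = zer (fst N) (fst N)"
  note NC = E_obj(2)[OF N]
  have "(\<exists>!f. f \<in> arr E N Y) \<and> (\<exists>!f. f \<in> arr E Y N)" if Y: "Y \<in> Obj E" for Y
  proof -
    note YC = E_obj(2)[OF Y]
    have "m = mor (zer (fst N) (fst Y))" if "m \<in> arr E N Y" for m
    proof -
      have v: "valid (Arrow (fst N) m (fst Y))"
        using that N Y by (simp add: E_arr eqhom_def del: valid_Arrow)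
      then have "Arrow (fst N) m (fst Y) = Arrow (fst N) m (fst Y) \<star> idt (fst N)" by simp
      also have "\<dots> = zer (fst N) (fst Y)" using v NC by (simp add: z)
      finally show ?thesis by (metis arrow.sel(2))
    qed
    moreover have "m = mor (zer (fst Y) (fst N))" if "m \<in> arr E Y N" for m
    proof -
      have v: "valid (Arrow (fst Y) m (fst N))"
        using that N Y by (simp add: E_arr eqhom_def del: valid_Arrow)
      then have "Arrow (fst Y) m (fst N) = idt (fst N) \<star> Arrow (fst Y) m (fst N)" by simp
      also have "\<dots> = zer (fst Y) (fst N)" using v NC by (simp add: z)
      finally show ?thesis by (metis arrow.sel(2))
    qed
    moreover have "mor (zer (fst N) (fst Y)) \<in> arr E N Y" "mor (zer (fst Y) (fst N)) \<in> arr E Y N"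
      using N Y eqhom_zer eqhom_mor by auto
    ultimately show ?thesis by blast
  qed
  then show "is_zero_object E N"
    using N by (simp add: is_zero_object_def)
qed

lemma E_simple_object:
  "simple_object E N \<longleftrightarrow> N \<in> Obj E \<and> idt (fst N) \<noteq> zer (fst N) (fst N) \<and>
    (\<forall>Y\<in>Obj E. \<forall>f. eqmono Y N f \<longrightarrow> f = zer (fst Y) (fst N) \<or> isom f)"
proof (cases "N \<in> Obj E")
  case N: True
  have "(\<forall>m. is_mono E Y N m \<longrightarrow> m = \<zero>\<^bsub>Hom E Y N\<^esub> \<or> is_iso E Y N m) \<longleftrightarrow>
    (\<forall>f. eqmono Y N f \<longrightarrow> f = zer (fst Y) (fst N) \<or> isom f)" if Y: "Y \<in> Obj E" for Y
  proof (intro iffI allI impI)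
    fix f assume *: "\<forall>m. is_mono E Y N m \<longrightarrow> m = \<zero>\<^bsub>Hom E Y N\<^esub> \<or> is_iso E Y N m" and f: "eqmono Y N f"
    have "f = Arrow (fst Y) (mor f) (fst N)"
      using f by (cases f) (auto simp: eqmono_def eqhom_def)
    then show "f = zer (fst Y) (fst N) \<or> isom f"
      using *[rule_format, of "mor f"] f Y N by (auto simp: E_is_mono E_is_iso E_simps zer_def)
  next
    fix m assume *: "\<forall>f. eqmono Y N f \<longrightarrow> f = zer (fst Y) (fst N) \<or> isom f" and m: "is_mono E Y N m"
    then show "m = \<zero>\<^bsub>Hom E Y N\<^esub> \<or> is_iso E Y N m"
      using Y N by (auto simp: E_is_mono E_is_iso E_simps zer_def eqmono_def)
  qed
  then show ?thesis
    unfolding simple_object_def using N E_is_zero_object[OF N] by simp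
qed (simp add: simple_object_def)

end

section \<open>Induced objects\<close>

lemma (in group) left_transversal_decomp:
  assumes "left_transversal G H R" "x \<in> carrier G"
  obtains s h where "s \<in> R" "h \<in> H" "x = s \<otimes> h"
  using assms unfolding left_transversal_def l_coset_def by blast

lemma (in group) transversal_rep_eq:
  assumes R: "left_transversal G H R" and H: "subgroup H G" and sh: "s \<in> R" "h \<in> H"
  shows "transversal_rep G H R (s \<otimes> h) = s"
proof -
  have "s \<otimes> h \<in> carrier G"
    using R sh subgroup.mem_carrier[OF H] by (auto simp: left_transversal_def)
  then have "\<exists>!t. t \<in> R \<and> s \<otimes> h \<in> t <# H"
    using R by (simp add: left_transversal_def)
  moreover have "s \<in> R \<and> s \<otimes> h \<in> s <# H"
    using sh by (auto simp: l_coset_def)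
  ultimately show ?thesis
    unfolding transversal_rep_def by (rule the1_equality)
qed

lemma (in group) left_transversal_exists:
  assumes H: "subgroup H G"
  shows "\<exists>R. left_transversal G H R"
proof -
  \<comment> \<open>The choice sees only the set \<open>x <# H\<close>, so elements of one coset
    receive the same representative.\<close>
  define c where "c x = (SOME t. t \<in> x <# H)" for x
  have self: "x \<in> x <# H" if "x \<in> carrier G" for x
    using that subgroup.one_closed[OF H] by (force simp: l_coset_def)
  have c: "c x \<in> x <# H" if "x \<in> carrier G" for x
    unfolding c_def using self[OF that] by (rule someI)
  have repr: "x <# H = y <# H" if "x \<in> carrier G" "y \<in> x <# H" for x y
    using l_repr_independence[OF that(2,1) H] .
  have sub: "x <# H \<subseteq> carrier G" if "x \<in> carrier G" for x
    using that H by (simp add: l_coset_subset_G subgroup.subset)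
  have "left_transversal G H (c ` carrier G)"
    unfolding left_transversal_def
  proof (intro conjI ballI)
    show "c ` carrier G \<subseteq> carrier G" using c sub by blast
    fix x assume x: "x \<in> carrier G"
    show "\<exists>!t. t \<in> c ` carrier G \<and> x \<in> t <# H"
    proof (rule ex1I[of _ "c x"])
      show "c x \<in> c ` carrier G \<and> x \<in> c x <# H"
        using x self[OF x] repr[OF x c[OF x]] by auto
      fix t assume "t \<in> c ` carrier G \<and> x \<in> t <# H"
      then obtain y where y: "y \<in> carrier G" "t = c y" "x \<in> c y <# H" by auto
      then have "x \<in> y <# H" using repr[OF y(1) c[OF y(1)]] by simp
      then have "y <# H = x <# H" using repr y(1) by blast
      then show "t = c x" using y by (simp add: c_def)
    qed
  qed
  then show ?thesis ..
qed

context tensor_action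
begin

lemma equivariant_category_whole: "equivariant_category K C F T T2 (Obj C) (carrier F)"
  by unfold_locales (use F.subgroup_self in auto)

text \<open>
  For the whole group, invertibility of the structure arrows is automatic: by the cocycle
  condition every one of them is a split epimorphism, and so is the section of each.
\<close>

lemma eqv_whole_objI:
  assumes A: "fst N \<in> Obj C" and ext: "snd N \<in> extensional (carrier F)"
    and valid: "\<And>a. a \<in> carrier F \<Longrightarrow> valid (str N a)"
    and cocycle: "\<And>a b. \<lbrakk>a \<in> carrier F; b \<in> carrier F\<rbrakk> \<Longrightarrow>
      str N a \<star> act a (str N b) = str N (a \<otimes>\<^bsub>F\<^esub> b) \<star> coh a b (fst N)"
    and unit: "str N \<one>\<^bsub>F\<^esub> = idt (fst N)"
  shows "N \<in> Obj (eqv (Obj C) (carrier F))"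
proof -
  \<comment> \<open>The cocycle condition for \<open>a\<close> and its inverse makes
    \<open>str N a \<star> act a (str N b)\<close>, with \<open>b\<close> that inverse, a coherence
    arrow, because the structure arrow of the unit is the identity. Cancelling this arrow leaves a
    section of \<open>str N a\<close>.\<close>
  define g where "g a = act a (str N (inv\<^bsub>F\<^esub> a)) \<star> inv_of (coh a (inv\<^bsub>F\<^esub> a) (fst N))" for a
  have g [simp]: "valid (g a)" "src (g a) = fst N" "tgt (g a) = ob a (fst N)" if "a \<in> carrier F" for a
    using that A valid by (auto simp: g_def)
  have retract: "str N a \<star> g a = idt (fst N)" if "a \<in> carrier F" for a
    using that A valid cocycle[of a "inv\<^bsub>F\<^esub> a"] unit
    by (simp add: g_def cmp_reassoc[OF cocycle[of a "inv\<^bsub>F\<^esub> a"]])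
  have "isom (str N a)" if a: "a \<in> carrier F" for a
  proof -
    let ?b = "inv\<^bsub>F\<^esub> a"
    \<comment> \<open>\<open>act a\<close> applied to the section for the inverse of
      \<open>a\<close> yields a right inverse of \<open>g a\<close>. As \<open>str N a\<close> is a
      left inverse of \<open>g a\<close>, the two agree.\<close>
    let ?k = "coh a ?b (fst N) \<star> act a (g ?b)"
    have k: "valid ?k" "src ?k = ob a (fst N)" "tgt ?k = fst N"
      using a A by auto
    have "act a (str N ?b) \<star> act a (g ?b) = act a (str N ?b \<star> g ?b)"
      using a A valid by (intro act_cmp[symmetric]) auto
    then have "g a \<star> ?k = idt (ob a (fst N))"
      using a A valid retract[of ?b] by (simp add: g_def[of a])
    moreover from this have "str N a = ?k"
      using a A valid retract[OF a] k by - (rule inverse_unique[of "g a"], auto)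
    ultimately show ?thesis
      using a A valid retract[OF a] by (intro isomI[of _ "g a"]) auto
  qed
  then show ?thesis
    using A ext cocycle unit by (subst eqv_obj_iff) (auto simp: F.subgroup_self)
qed

end

section \<open>The structure arrows of an induced object\<close>

context equivariant_category
begin

text \<open>The component of the induced structure from \<open>T a (T t V)\<close> to
  \<open>T s V\<close>. The pair \<open>s\<close>, \<open>h\<close> is a parameter and not computed
  from representatives, so that the cocycle identity can be proved for arbitrary
  factorizations.\<close>

definition ind_comp :: "'o \<times> ('f \<Rightarrow> 'm) \<Rightarrow> 'f \<Rightarrow> 'f \<Rightarrow> 'f \<Rightarrow> 'f \<Rightarrow> ('o, 'm) arrow"
  where "ind_comp M a t s h = act s (str M h) \<star> inv_of (coh s h (fst M)) \<star> coh a t (fst M)"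

lemma ind_comp_valid:
  assumes "M \<in> Obj E" "a \<in> carrier F" "t \<in> carrier F" "s \<in> carrier F" "h \<in> H" "a \<otimes>\<^bsub>F\<^esub> t = s \<otimes>\<^bsub>F\<^esub> h"
  shows "valid (ind_comp M a t s h)" "src (ind_comp M a t s h) = ob a (ob t (fst M))"
    "tgt (ind_comp M a t s h) = ob s (fst M)"
  using assms E_obj(2-4)[OF assms(1)] by (simp_all add: ind_comp_def)

text \<open>From \<open>b t = s h\<close> and \<open>a s = r k\<close> follows
  \<open>(a b) t = r (k h)\<close>, which explains the index \<open>k h\<close> on the right. The
  identity combines naturality of \<open>T2\<close>, the cocycle condition of \<open>M\<close> and
  associativity of \<open>T2\<close>.\<close>

lemma ind_comp_cocycle:
  assumes M: "M \<in> Obj E"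
    and F: "a \<in> carrier F" "b \<in> carrier F" "t \<in> carrier F" "s \<in> carrier F" "r \<in> carrier F"
    and H: "h \<in> H" "k \<in> H" and sh: "b \<otimes>\<^bsub>F\<^esub> t = s \<otimes>\<^bsub>F\<^esub> h" and rk: "a \<otimes>\<^bsub>F\<^esub> s = r \<otimes>\<^bsub>F\<^esub> k"
  shows "ind_comp M a s r k \<star> act a (ind_comp M b t s h) =
    ind_comp M (a \<otimes>\<^bsub>F\<^esub> b) t r (k \<otimes>\<^bsub>F\<^esub> h) \<star> coh a b (ob t (fst M))"
proof -
  let ?V = "fst M"
  have hk: "h \<in> carrier F" "k \<in> carrier F" "k \<otimes>\<^bsub>F\<^esub> h \<in> H"
    using H subgroup.m_closed[OF H_subgroup] by auto
  have V: "?V \<in> Obj C" using E_obj(2)[OF M] .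
  have m: "a \<otimes>\<^bsub>F\<^esub> (s \<otimes>\<^bsub>F\<^esub> h) = r \<otimes>\<^bsub>F\<^esub> (k \<otimes>\<^bsub>F\<^esub> h)"
    using F hk rk by (metis F.m_assoc)
  have v [simp]: "valid (str M h)" "valid (str M k)" "valid (str M (k \<otimes>\<^bsub>F\<^esub> h))"
    using E_obj(4)[OF M] H hk by auto
  note [simp] = F hk(1,2) V
  \<comment> \<open>Facts 1 and 2 carry \<open>str M h\<close> past two coherence arrows until it
    meets \<open>str M k\<close>; fact 3 merges the two; facts 4 to 6 are instances of associativity
    of \<open>T2\<close> that reduce the remaining coherence arrows.\<close>
  have "coh a s ?V \<star> act a (act s (str M h)) = act (a \<otimes>\<^bsub>F\<^esub> s) (str M h) \<star> coh a s (ob h ?V)"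
    using coh_natural[of a s "str M h"] by simp
  note 1 = this cmp_reassoc[OF this]
  have "inv_of (coh r k ?V) \<star> act (r \<otimes>\<^bsub>F\<^esub> k) (str M h) = act r (act k (str M h)) \<star> inv_of (coh r k (ob h ?V))"
    using coh_inv_natural[of r k "str M h"] by simp
  note 2 = this cmp_reassoc[OF this]
  have "act r (str M k) \<star> act r (act k (str M h)) = act r (str M (k \<otimes>\<^bsub>F\<^esub> h)) \<star> act r (coh k h ?V)"
    using E_obj(5)[OF M H(2,1)] by (simp flip: act_cmp)
  note 3 = cmp_reassoc[OF this]
  have "act r (coh k h ?V) \<star> inv_of (coh r k (ob h ?V)) =
      inv_of (coh r (k \<otimes>\<^bsub>F\<^esub> h) ?V) \<star> coh (r \<otimes>\<^bsub>F\<^esub> k) h ?V"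
    by (rule coh_assoc_inv) simp_all
  note 4 = cmp_reassoc[OF this]
  have "coh (r \<otimes>\<^bsub>F\<^esub> k) h ?V \<star> coh a s (ob h ?V) = coh a (s \<otimes>\<^bsub>F\<^esub> h) ?V \<star> act a (coh s h ?V)"
    using coh_assoc[of a s h ?V] by (simp add: rk)
  note 5 = cmp_reassoc[OF this]
  have "coh a (s \<otimes>\<^bsub>F\<^esub> h) ?V \<star> act a (coh b t ?V) = coh (a \<otimes>\<^bsub>F\<^esub> b) t ?V \<star> coh a b (ob t ?V)"
    using coh_assoc[of a b t ?V] by (simp add: sh)
  note 6 = this
  have inv: "act a (inv_of (coh s h ?V)) = inv_of (act a (coh s h ?V))"
    by (rule act_inv_of) simp_all
  have "ind_comp M a s r k \<star> act a (ind_comp M b t s h) =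
      act r (str M k) \<star> inv_of (coh r k ?V) \<star> coh a s ?V \<star> act a (act s (str M h)) \<star>
        inv_of (act a (coh s h ?V)) \<star> act a (coh b t ?V)"
    by (simp add: ind_comp_def rk sh inv)
  also have "\<dots> = act r (str M k) \<star> inv_of (coh r k ?V) \<star> act (r \<otimes>\<^bsub>F\<^esub> k) (str M h) \<star> coh a s (ob h ?V) \<star>
        inv_of (act a (coh s h ?V)) \<star> act a (coh b t ?V)"
    by (simp add: 1 rk sh)
  also have "\<dots> = act r (str M k) \<star> act r (act k (str M h)) \<star> inv_of (coh r k (ob h ?V)) \<star> coh a s (ob h ?V) \<star>
        inv_of (act a (coh s h ?V)) \<star> act a (coh b t ?V)"
    by (simp add: 2 rk sh)
  also have "\<dots> = act r (str M (k \<otimes>\<^bsub>F\<^esub> h)) \<star> act r (coh k h ?V) \<star> inv_of (coh r k (ob h ?V)) \<star> coh a s (ob h ?V) \<star>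
        inv_of (act a (coh s h ?V)) \<star> act a (coh b t ?V)"
    by (simp add: 3 rk sh)
  also have "\<dots> = act r (str M (k \<otimes>\<^bsub>F\<^esub> h)) \<star> inv_of (coh r (k \<otimes>\<^bsub>F\<^esub> h) ?V) \<star> coh (r \<otimes>\<^bsub>F\<^esub> k) h ?V \<star> coh a s (ob h ?V) \<star>
        inv_of (act a (coh s h ?V)) \<star> act a (coh b t ?V)"
    by (simp add: 4 rk sh F.m_assoc)
  also have "\<dots> = act r (str M (k \<otimes>\<^bsub>F\<^esub> h)) \<star> inv_of (coh r (k \<otimes>\<^bsub>F\<^esub> h) ?V) \<star> coh a (s \<otimes>\<^bsub>F\<^esub> h) ?V \<star> act a (coh b t ?V)"
    by (simp add: 5 rk sh F.m_assoc m)
  also have "\<dots> = ind_comp M (a \<otimes>\<^bsub>F\<^esub> b) t r (k \<otimes>\<^bsub>F\<^esub> h) \<star> coh a b (ob t ?V)"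
    by (simp add: 6 ind_comp_def F.m_assoc m sh)
  finally show ?thesis .
qed

lemma induced_exists:
  assumes "M \<in> Obj E" "left_transversal F H R" "finite R"
  shows "\<exists>N. is_induced C F T T2 H R M N"
proof -
  have "\<And>t. t \<in> R \<Longrightarrow> ob t (fst M) \<in> Obj C"
    using assms(2) E_obj(2)[OF assms(1)] by (auto simp: left_transversal_def)
  then obtain A \<iota> \<pi> where bi: "is_biproduct C R (\<lambda>t. ob t (fst M)) A \<iota> \<pi>"
    using biproduct_exists[OF assms(3), of "\<lambda>t. ob t (fst M)"] by blast
  then show ?thesis
    unfolding is_induced_def by (cases M) auto
qed

text \<open>Representatives make the factorization \<open>a t = s h\<close> unique, so the choice
  hidden in \<open>transversal_rep\<close> is the given one. These equations on summands replace the
  defining sum in all later arguments.\<close>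

lemma induced_str:
  assumes M: "M \<in> Obj E" and R: "left_transversal F H R" and ind: "is_induced C F T T2 H R M N"
  obtains \<iota> \<pi> where "is_biproduct C R (\<lambda>t. ob t (fst M)) (fst N) \<iota> \<pi>"
    "snd N \<in> extensional (carrier F)" "\<And>a. a \<in> carrier F \<Longrightarrow> valid (str N a)"
    "\<And>a t s h. \<lbrakk>a \<in> carrier F; t \<in> R; s \<in> R; h \<in> H; a \<otimes>\<^bsub>F\<^esub> t = s \<otimes>\<^bsub>F\<^esub> h\<rbrakk> \<Longrightarrow>
      str N a \<star> act a (inc (\<lambda>t. ob t (fst M)) (fst N) \<iota> t) =
      inc (\<lambda>t. ob t (fst M)) (fst N) \<iota> s \<star> ind_comp M a t s h"
proof -
  let ?V = "fst M" and ?A = "fst N"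
  let ?Y = "\<lambda>t. ob t ?V"
  define s where "s a t = transversal_rep F H R (a \<otimes>\<^bsub>F\<^esub> t)" for a t
  define h where "h a t = inv\<^bsub>F\<^esub> (s a t) \<otimes>\<^bsub>F\<^esub> (a \<otimes>\<^bsub>F\<^esub> t)" for a t
  obtain \<iota> \<pi> where bi: "is_biproduct C R ?Y ?A \<iota> \<pi>"
    and nu: "snd N = (\<lambda>a\<in>carrier F. \<Oplus>\<^bsub>Hom C (ob a ?A) ?A\<^esub>t\<in>R.
        \<iota> (s a t) \<cdot> FMor (T (s a t)) (snd M (h a t)) \<cdot>
          inv_arr C (ob (s a t) (ob (h a t) ?V)) (ob (s a t \<otimes>\<^bsub>F\<^esub> h a t) ?V) (T2 (s a t) (h a t) ?V) \<cdot>
          T2 a t ?V \<cdot> FMor (T a) (\<pi> t))"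
    using ind unfolding is_induced_def s_def h_def Let_def by (cases M; cases N) auto
  have R_F: "t \<in> carrier F" if "t \<in> R" for t
    using that R by (auto simp: left_transversal_def)
  have sh_unique: "s a t = s'" "h a t = h'"
    if "a \<in> carrier F" "t \<in> R" "s' \<in> R" "h' \<in> H" "a \<otimes>\<^bsub>F\<^esub> t = s' \<otimes>\<^bsub>F\<^esub> h'" for a t s' h'
    using that R_F F.transversal_rep_eq[OF R H_subgroup, of s' h'] F.inv_solve_left'[of h' s' "s' \<otimes>\<^bsub>F\<^esub> h'"]
    by (auto simp: s_def h_def F.inv_solve_left')
  have sh: "s a t \<in> R \<and> h a t \<in> H \<and> a \<otimes>\<^bsub>F\<^esub> t = s a t \<otimes>\<^bsub>F\<^esub> h a t" if "a \<in> carrier F" "t \<in> R" for a t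
    using F.left_transversal_decomp[OF R, of "a \<otimes>\<^bsub>F\<^esub> t"] sh_unique[OF that] that R_F by (metis F.m_closed)
  note v = biproduct_valid[OF bi]
  define k where "k a t = inc ?Y ?A \<iota> (s a t) \<star> ind_comp M a t (s a t) (h a t)" for a t
  have k: "valid (k a t)" "src (k a t) = ob a (?Y t)" "tgt (k a t) = ?A" if "a \<in> carrier F" "t \<in> R" for a t
    using sh[OF that] that R_F v(1)[of "s a t"] ind_comp_valid[OF M, of a t "s a t" "h a t"] by (simp_all add: k_def)
  have mor_k: "mor (k a t) = \<iota> (s a t) \<cdot> FMor (T (s a t)) (snd M (h a t)) \<cdot>
      inv_arr C (ob (s a t) (ob (h a t) ?V)) (ob (s a t \<otimes>\<^bsub>F\<^esub> h a t) ?V) (T2 (s a t) (h a t) ?V) \<cdot> T2 a t ?V"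
    if "a \<in> carrier F" "t \<in> R" for a t
  proof -
    have F: "s a t \<in> carrier F" "t \<in> carrier F" "h a t \<in> carrier F" using sh[OF that] that R_F by auto
    \<comment> \<open>Bracketed to the left, because that is how the composite in
      \<open>is_induced\<close> associates and the two have to agree literally.\<close>
    have "k a t = ((inc ?Y ?A \<iota> (s a t) \<star> act (s a t) (str M (h a t))) \<star>
        inv_of (coh (s a t) (h a t) ?V)) \<star> coh a t ?V"
      unfolding k_def ind_comp_def
      using sh[OF that] that F E_obj(2,4)[OF M] v(1)[of "s a t"] by (simp del: valid_Arrow)
    then show ?thesis
      by (simp add: cmp_def act_def str_def coh_def inv_of_def)
  qed
  have A: "?A \<in> Obj C" using v by simp
  have str: "valid (str N a)" "t \<in> R \<Longrightarrow> str N a \<star> act a (inc ?Y ?A \<iota> t) = k a t"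
    if a: "a \<in> carrier F" for a t
  proof -
    have summand: "mor (k a t) \<cdot> FMor (T a) (\<pi> t) \<in> arr C (ob a ?A) ?A" if "t \<in> R" for t
    proof -
      have "valid (k a t \<star> act a (prj ?Y ?A \<pi> t))"
        using k[OF a that] v(2)[OF that] a by (intro valid_cmp valid_act) auto
      then show ?thesis using k[OF a that] by (simp add: cmp_def act_def)
    qed
    have sum: "snd N a = (\<Oplus>\<^bsub>Hom C (ob a ?A) ?A\<^esub>t\<in>R. mor (k a t) \<cdot> FMor (T a) (\<pi> t))"
      unfolding nu restrict_apply'[OF a] using mor_k[OF a] summand a A
      by (intro abelian_monoid.finsum_cong'[OF hom_abelian_monoid]) auto
    have karr: "mor (k a t) \<in> arr C (ob a (?Y t)) ?A" if "t \<in> R" for t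
      using k[OF a that] by simp
    \<comment> \<open>The structure arrow is the arrow glued from the \<open>k a t\<close> on the
      direct sum \<open>T a A\<close>, whose projections are the
      \<open>T a (\<pi> t)\<close>.\<close>
    note glue = biproduct_glue[OF act_biproduct[OF a bi] A karr, folded sum]
    show "valid (str N a)"
      using glue(1) a A by (simp add: str_def)
    show "str N a \<star> act a (inc ?Y ?A \<iota> t) = k a t" if "t \<in> R"
      using glue(2)[OF _ that] k[OF a that] by (intro arrow_eqI) (auto simp: str_def act_def cmp_def)
  qed
  show thesis
  proof (rule that[OF bi])
    show "snd N \<in> extensional (carrier F)" by (simp add: nu)
    show "valid (str N a)" if "a \<in> carrier F" for a using str(1)[OF that] .
    fix a t s' h' assume *: "a \<in> carrier F" "t \<in> R" "s' \<in> R" "h' \<in> H" "a \<otimes>\<^bsub>F\<^esub> t = s' \<otimes>\<^bsub>F\<^esub> h'"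
    show "str N a \<star> act a (inc ?Y ?A \<iota> t) = inc ?Y ?A \<iota> s' \<star> ind_comp M a t s' h'"
      using str(2)[OF *(1,2)] sh_unique[OF *] by (simp add: k_def)
  qed
qed

text \<open>Both conditions are equalities of arrows out of a direct sum, hence can be checked on
  summands, where the cocycle condition becomes \<open>ind_comp_cocycle\<close>. Invertibility of
  the structure arrows comes from \<open>eqv_whole_objI\<close>.\<close>

lemma induced_obj:
  assumes M: "M \<in> Obj E" and R: "left_transversal F H R" and ind: "is_induced C F T T2 H R M N"
  shows "N \<in> Obj (eqv (Obj C) (carrier F))"
proof -
  let ?V = "fst M" and ?A = "fst N"
  let ?Y = "\<lambda>t. ob t ?V"
  obtain \<iota> \<pi> where bi: "is_biproduct C R ?Y ?A \<iota> \<pi>" and ext: "snd N \<in> extensional (carrier F)"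
    and valid: "\<And>a. a \<in> carrier F \<Longrightarrow> valid (str N a)"
    and str: "\<And>a t s h. \<lbrakk>a \<in> carrier F; t \<in> R; s \<in> R; h \<in> H; a \<otimes>\<^bsub>F\<^esub> t = s \<otimes>\<^bsub>F\<^esub> h\<rbrakk> \<Longrightarrow>
      str N a \<star> act a (inc ?Y ?A \<iota> t) = inc ?Y ?A \<iota> s \<star> ind_comp M a t s h"
    using induced_str[OF assms] by blast
  note v = biproduct_valid[OF bi]
  have R_F: "t \<in> carrier F" if "t \<in> R" for t
    using that R by (auto simp: left_transversal_def)
  have V: "?V \<in> Obj C" using E_obj(2)[OF M] .
  have A: "?A \<in> Obj C" using v by simp
  define i where "i t = inc ?Y ?A \<iota> t" for t
  have i [simp]: "valid (i t)" "src (i t) = ob t ?V" "tgt (i t) = ?A" if "t \<in> R" for t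
    using v(1)[OF that] by (simp_all add: i_def del: valid_Arrow)
  note str = str[folded i_def]
  note [simp] = R_F V A valid
  show ?thesis
  proof (rule eqv_whole_objI[OF A ext valid])
    show "str N \<one>\<^bsub>F\<^esub> = idt ?A"
    proof (rule biproduct_ext[OF bi])
      fix t assume t: "t \<in> R"
      have "str N \<one>\<^bsub>F\<^esub> \<star> i t = str N \<one>\<^bsub>F\<^esub> \<star> act \<one>\<^bsub>F\<^esub> (i t)"
        using t by simp
      \<comment> \<open>For the unit of \<open>F\<close> the factorization of \<open>1 t\<close> is
        \<open>t 1\<close>, so source and target summand coincide.\<close>
      also have "\<dots> = i t \<star> ind_comp M \<one>\<^bsub>F\<^esub> t t \<one>\<^bsub>F\<^esub>"
        using t subgroup.one_closed[OF H_subgroup] by (intro str) auto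
      also have "\<dots> = i t"
        using t E_obj(6)[OF M] V by (simp add: ind_comp_def)
      finally show "str N \<one>\<^bsub>F\<^esub> \<star> inc ?Y ?A \<iota> t = idt ?A \<star> inc ?Y ?A \<iota> t"
        using t by (simp flip: i_def)
    qed simp_all
  next
    fix a b assume ab: "a \<in> carrier F" "b \<in> carrier F"
    show "str N a \<star> act a (str N b) = str N (a \<otimes>\<^bsub>F\<^esub> b) \<star> coh a b ?A"
    proof (rule biproduct_ext[OF act_biproduct[OF ab(1) act_biproduct[OF ab(2) bi]]])
      fix t assume t: "t \<in> R"
      obtain s h where sh: "s \<in> R" "h \<in> H" "b \<otimes>\<^bsub>F\<^esub> t = s \<otimes>\<^bsub>F\<^esub> h"
        using F.left_transversal_decomp[OF R, of "b \<otimes>\<^bsub>F\<^esub> t"] ab t by auto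
      obtain r k where rk: "r \<in> R" "k \<in> H" "a \<otimes>\<^bsub>F\<^esub> s = r \<otimes>\<^bsub>F\<^esub> k"
        using F.left_transversal_decomp[OF R, of "a \<otimes>\<^bsub>F\<^esub> s"] ab sh by auto
      have abt: "a \<otimes>\<^bsub>F\<^esub> b \<otimes>\<^bsub>F\<^esub> t = r \<otimes>\<^bsub>F\<^esub> (k \<otimes>\<^bsub>F\<^esub> h)"
        using ab t sh rk by (metis F.m_assoc H_carrier R_F)
      have kh: "k \<otimes>\<^bsub>F\<^esub> h \<in> H" using subgroup.m_closed[OF H_subgroup] sh rk by blast
      have bt: "valid (ind_comp M b t s h)" "src (ind_comp M b t s h) = ob b (ob t ?V)" "tgt (ind_comp M b t s h) = ob s ?V"
        using ind_comp_valid[OF M, of b t s h] ab t sh by auto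
      have as: "valid (ind_comp M a s r k)" "src (ind_comp M a s r k) = ob a (ob s ?V)" "tgt (ind_comp M a s r k) = ob r ?V"
        using ind_comp_valid[OF M, of a s r k] ab rk sh by auto
      have a_bt: "valid (ind_comp M (a \<otimes>\<^bsub>F\<^esub> b) t r (k \<otimes>\<^bsub>F\<^esub> h))"
        "src (ind_comp M (a \<otimes>\<^bsub>F\<^esub> b) t r (k \<otimes>\<^bsub>F\<^esub> h)) = ob (a \<otimes>\<^bsub>F\<^esub> b) (ob t ?V)"
        "tgt (ind_comp M (a \<otimes>\<^bsub>F\<^esub> b) t r (k \<otimes>\<^bsub>F\<^esub> h)) = ob r ?V"
        using ind_comp_valid[OF M, of "a \<otimes>\<^bsub>F\<^esub> b" t r "k \<otimes>\<^bsub>F\<^esub> h"] ab rk t abt kh by auto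
      have "(str N a \<star> act a (str N b)) \<star> act a (act b (i t)) = str N a \<star> act a (str N b \<star> act b (i t))"
        using ab t by simp
      also have "str N b \<star> act b (i t) = i s \<star> ind_comp M b t s h"
        using ab t sh by (intro str)
      also have "str N a \<star> act a \<dots> = (str N a \<star> act a (i s)) \<star> act a (ind_comp M b t s h)"
        using ab sh bt by simp
      also have "str N a \<star> act a (i s) = i r \<star> ind_comp M a s r k"
        using ab rk sh by (intro str)
      also have "\<dots> \<star> act a (ind_comp M b t s h) = i r \<star> ind_comp M a s r k \<star> act a (ind_comp M b t s h)"
        using ab rk sh bt as by simp
      also have "ind_comp M a s r k \<star> act a (ind_comp M b t s h) =
          ind_comp M (a \<otimes>\<^bsub>F\<^esub> b) t r (k \<otimes>\<^bsub>F\<^esub> h) \<star> coh a b (ob t ?V)"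
        using ab rk sh t by (intro ind_comp_cocycle M) auto
      also have "i r \<star> \<dots> = (i r \<star> ind_comp M (a \<otimes>\<^bsub>F\<^esub> b) t r (k \<otimes>\<^bsub>F\<^esub> h)) \<star> coh a b (ob t ?V)"
        using ab rk sh t a_bt by simp
      also have "i r \<star> ind_comp M (a \<otimes>\<^bsub>F\<^esub> b) t r (k \<otimes>\<^bsub>F\<^esub> h) = str N (a \<otimes>\<^bsub>F\<^esub> b) \<star> act (a \<otimes>\<^bsub>F\<^esub> b) (i t)"
        using ab rk t abt kh by (intro str[symmetric]) auto
      also have "\<dots> \<star> coh a b (ob t ?V) = str N (a \<otimes>\<^bsub>F\<^esub> b) \<star> act (a \<otimes>\<^bsub>F\<^esub> b) (i t) \<star> coh a b (ob t ?V)"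
        using ab t by simp
      also have "act (a \<otimes>\<^bsub>F\<^esub> b) (i t) \<star> coh a b (ob t ?V) = coh a b ?A \<star> act a (act b (i t))"
        using coh_natural[of a b "i t"] ab t by simp
      also have "str N (a \<otimes>\<^bsub>F\<^esub> b) \<star> \<dots> = (str N (a \<otimes>\<^bsub>F\<^esub> b) \<star> coh a b ?A) \<star> act a (act b (i t))"
        using ab t by simp
      finally show "(str N a \<star> act a (str N b)) \<star> inc (\<lambda>i. ob a (ob b (ob i ?V))) (ob a (ob b ?A)) (\<lambda>i. FMor (T a) (FMor (T b) (\<iota> i))) t
        = (str N (a \<otimes>\<^bsub>F\<^esub> b) \<star> coh a b ?A) \<star> inc (\<lambda>i. ob a (ob b (ob i ?V))) (ob a (ob b ?A)) (\<lambda>i. FMor (T a) (FMor (T b) (\<iota> i))) t"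
        by (simp add: act_def i_def)
    qed (use ab in simp_all)
  qed
qed

end

section \<open>Homogeneous projections\<close>

locale graded_action = graded_fusion_category K C G Cg + tensor_action K C F T T2
  for K :: "('k, 'c) ring_scheme" and C :: "('k, 'o, 'm, 'z) tensor_category_data_scheme" (structure)
    and G :: "('g, 'b) monoid_scheme" and Cg :: "'g \<Rightarrow> 'o set"
    and F :: "('f, 'a) monoid_scheme" and T T2 +
  fixes \<phi> :: "'f \<Rightarrow> 'g \<Rightarrow> 'g"
  assumes finite_F: "finite (carrier F)"
    and action: "group_action F (carrier G) \<phi>"
    and coherent: "\<lbrakk>x \<in> carrier F; g \<in> carrier G; M \<in> Cg g\<rbrakk> \<Longrightarrow> FObj (T x) M \<in> Cg (\<phi> x g)"
begin

section \<open>The action on degrees\<close>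

lemma \<phi>_closed [simp]: "\<lbrakk>x \<in> carrier F; g \<in> carrier G\<rbrakk> \<Longrightarrow> \<phi> x g \<in> carrier G"
  using group_action.element_image[OF action] by blast

lemma \<phi>_one [simp]: "g \<in> carrier G \<Longrightarrow> \<phi> \<one>\<^bsub>F\<^esub> g = g"
  using group_action.id_eq_one[OF action] by (metis restrict_apply')

lemma \<phi>_mult: "\<lbrakk>x \<in> carrier F; y \<in> carrier F; g \<in> carrier G\<rbrakk> \<Longrightarrow> \<phi> (x \<otimes>\<^bsub>F\<^esub> y) g = \<phi> x (\<phi> y g)"
  using group_action.composition_rule[OF action] by blast

lemma \<phi>_inv [simp]:
  assumes "x \<in> carrier F" "g \<in> carrier G"
  shows "\<phi> x (\<phi> (inv\<^bsub>F\<^esub> x) g) = g" "\<phi> (inv\<^bsub>F\<^esub> x) (\<phi> x g) = g"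
  using assms by (simp_all flip: \<phi>_mult)

lemma \<phi>_eq_iff: "\<lbrakk>x \<in> carrier F; g \<in> carrier G; h \<in> carrier G\<rbrakk> \<Longrightarrow> \<phi> x g = \<phi> x h \<longleftrightarrow> g = h"
  by (metis \<phi>_inv(2))

lemma component_obj [simp]: "\<lbrakk>g \<in> carrier G; A \<in> Cg g\<rbrakk> \<Longrightarrow> A \<in> Obj C"
  using component_sub by blast

lemma orthogonal_arrow:
  assumes "valid f" "g \<in> carrier G" "h \<in> carrier G" "g \<noteq> h" "src f \<in> Cg g" "tgt f \<in> Cg h"
  shows "f = zer (src f) (tgt f)"
  using component_orthogonal[OF assms(2-6)] valid_mor[OF assms(1) refl refl]
  by (intro arrow_eqI) (auto simp: mor_simps)

text \<open>Characterized by the effect on all arrows from homogeneous objects instead of by a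
  chosen decomposition. This makes the idempotent unique, and its compatibility with arrows and with
  \<open>T x\<close> can be tested on homogeneous sources.\<close>

definition is_hproj :: "'g \<Rightarrow> 'o \<Rightarrow> ('o, 'm) arrow \<Rightarrow> bool"
  where "is_hproj g A e \<longleftrightarrow> valid e \<and> src e = A \<and> tgt e = A \<and>
    (\<forall>i\<in>carrier G. \<forall>u. valid u \<longrightarrow> src u \<in> Cg i \<longrightarrow> tgt u = A \<longrightarrow>
      e \<star> u = (if i = g then u else zer (src u) A))"

lemma decompE:
  assumes "A \<in> Obj C"
  obtains I S \<iota> \<pi> where "is_biproduct C I S A \<iota> \<pi>" "I \<subseteq> carrier G" "\<And>i. i \<in> I \<Longrightarrow> S i \<in> Cg i"
  using component_decomp[OF assms] by blast

lemma is_hproj_ex1: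
  assumes A: "A \<in> Obj C" and g: "g \<in> carrier G"
  shows "\<exists>!e. is_hproj g A e"
proof (rule ex_ex1I)
  obtain I S \<iota> \<pi> where bi: "is_biproduct C I S A \<iota> \<pi>" and I: "I \<subseteq> carrier G" "\<And>i. i \<in> I \<Longrightarrow> S i \<in> Cg i"
    using decompE[OF A] by blast
  note v = biproduct_valid[OF bi]
  \<comment> \<open>A decomposition may omit degrees; the idempotent of an omitted degree is
    zero.\<close>
  define e where "e = (if g \<in> I then inc S A \<iota> g \<star> prj S A \<pi> g else zer A A)"
  have e [simp]: "valid e" "src e = A" "tgt e = A"
    using v A by (auto simp: e_def)
  have prj_e: "prj S A \<pi> k \<star> e = (if k = g then prj S A \<pi> k else zer A (S k))" if "k \<in> I" for k
  proof (cases "g \<in> I")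
    case True
    have "prj S A \<pi> k \<star> e = (prj S A \<pi> k \<star> inc S A \<iota> g) \<star> prj S A \<pi> g"
      using True that v by (simp add: e_def)
    then show ?thesis
      using True that v by (simp add: biproduct_cmp[OF bi])
  next
    case False
    then show ?thesis using that v by (auto simp: e_def)
  qed
  have "e \<star> u = (if i = g then u else zer (src u) A)"
    if i: "i \<in> carrier G" and u: "valid u" "src u \<in> Cg i" "tgt u = A" for i u
  proof (rule biproduct_coext[OF bi])
    fix k assume k: "k \<in> I"
    \<comment> \<open>By orthogonality an arrow from degree \<open>i\<close> reaches only the
      summand of degree \<open>i\<close>.\<close>
    have "prj S A \<pi> k \<star> u = zer (src u) (S k)" if "k \<noteq> i"
      using orthogonal_arrow[of "prj S A \<pi> k \<star> u" i k] that k I i u v by auto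
    moreover have "prj S A \<pi> k \<star> e \<star> u = (prj S A \<pi> k \<star> e) \<star> u"
      using k v u by (intro cmp_assoc[symmetric]) auto
    ultimately show "prj S A \<pi> k \<star> e \<star> u = prj S A \<pi> k \<star> (if i = g then u else zer (src u) A)"
      using k v u A prj_e[OF k] by (auto split: if_splits)
  qed (use u A in auto)
  then show "\<exists>e. is_hproj g A e"
    by (intro exI[of _ e]) (simp add: is_hproj_def)
next
  fix e e' assume *: "is_hproj g A e" "is_hproj g A e'"
  obtain I S \<iota> \<pi> where bi: "is_biproduct C I S A \<iota> \<pi>" and I: "I \<subseteq> carrier G" "\<And>i. i \<in> I \<Longrightarrow> S i \<in> Cg i"
    using decompE[OF A] by blast
  show "e = e'"
  proof (rule biproduct_ext[OF bi])
    fix i assume "i \<in> I"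
    then have "valid (inc S A \<iota> i)" "src (inc S A \<iota> i) \<in> Cg i" "tgt (inc S A \<iota> i) = A" "i \<in> carrier G"
      using biproduct_valid(1)[OF bi] I by auto
    then show "e \<star> inc S A \<iota> i = e' \<star> inc S A \<iota> i"
      using * unfolding is_hproj_def by metis
  qed (use * in \<open>auto simp: is_hproj_def\<close>)
qed

definition hproj :: "'g \<Rightarrow> 'o \<Rightarrow> ('o, 'm) arrow"
  where "hproj g A = (THE e. is_hproj g A e)"

lemma is_hproj_hproj: "\<lbrakk>A \<in> Obj C; g \<in> carrier G\<rbrakk> \<Longrightarrow> is_hproj g A (hproj g A)"
  unfolding hproj_def by (rule theI'[OF is_hproj_ex1])

lemma hproj_valid [simp]:
  assumes "A \<in> Obj C" "g \<in> carrier G"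
  shows "valid (hproj g A)" "src (hproj g A) = A" "tgt (hproj g A) = A"
  using is_hproj_hproj[OF assms] by (simp_all add: is_hproj_def)

lemma hproj_cmp_homogeneous:
  "\<lbrakk>valid u; g \<in> carrier G; i \<in> carrier G; src u \<in> Cg i; tgt u = A\<rbrakk> \<Longrightarrow>
    hproj g A \<star> u = (if i = g then u else zer (src u) A)"
  using is_hproj_hproj[of A g] valid_tgt[of u] unfolding is_hproj_def by blast

lemma homogeneous_decompE:
  assumes "A \<in> Obj C"
  obtains I S \<iota> \<pi> where "is_biproduct C I S A \<iota> \<pi>" "I \<subseteq> carrier G" "\<And>i. i \<in> I \<Longrightarrow> S i \<in> Cg i"
    "\<And>i g. \<lbrakk>i \<in> I; g \<in> carrier G\<rbrakk> \<Longrightarrow> hproj g A \<star> inc S A \<iota> i = (if i = g then inc S A \<iota> i else zer (S i) A)"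
proof -
  obtain I S \<iota> \<pi> where *: "is_biproduct C I S A \<iota> \<pi>" "I \<subseteq> carrier G" "\<And>i. i \<in> I \<Longrightarrow> S i \<in> Cg i"
    using decompE[OF assms] by blast
  show thesis
  proof (rule that[OF *])
    fix i g assume "i \<in> I" "g \<in> carrier G"
    then show "hproj g A \<star> inc S A \<iota> i = (if i = g then inc S A \<iota> i else zer (S i) A)"
      using hproj_cmp_homogeneous[of "inc S A \<iota> i" g i A] *(2,3) biproduct_valid(1)[OF *(1)]
      by (metis arrow.sel(1,3) subsetD)
  qed
qed

section \<open>Arrows compared and glued degree by degree\<close>

lemma graded_ext:
  assumes f: "valid f" "valid f'" "src f = A" "src f' = A" "tgt f = tgt f'"
    and eq: "\<And>g. g \<in> carrier G \<Longrightarrow> f \<star> hproj g A = f' \<star> hproj g A"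
  shows "f = f'"
proof -
  have A: "A \<in> Obj C" using f by auto
  obtain I S \<iota> \<pi> where bi: "is_biproduct C I S A \<iota> \<pi>" and I: "I \<subseteq> carrier G" "\<And>i. i \<in> I \<Longrightarrow> S i \<in> Cg i"
    and inc: "\<And>i g. \<lbrakk>i \<in> I; g \<in> carrier G\<rbrakk> \<Longrightarrow> hproj g A \<star> inc S A \<iota> i = (if i = g then inc S A \<iota> i else zer (S i) A)"
    using homogeneous_decompE[OF A] by blast
  show ?thesis
  proof (rule biproduct_ext[OF bi])
    fix i assume i: "i \<in> I"
    then have v: "valid (inc S A \<iota> i)" "i \<in> carrier G"
      using biproduct_valid(1)[OF bi] I by auto
    have "f \<star> inc S A \<iota> i = (f \<star> hproj i A) \<star> inc S A \<iota> i"
      using i v f A inc[OF i v(2)] by simp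
    also have "\<dots> = (f' \<star> hproj i A) \<star> inc S A \<iota> i"
      using eq v by simp
    also have "\<dots> = f' \<star> inc S A \<iota> i"
      using i v f A inc[OF i v(2)] by simp
    finally show "f \<star> inc S A \<iota> i = f' \<star> inc S A \<iota> i" .
  qed (use f in auto)
qed

text \<open>On the summand of degree \<open>i\<close> the glued arrow is \<open>f i\<close>. For a
  degree missing from the chosen decomposition both sides vanish, since its idempotent kills every
  inclusion.\<close>

lemma graded_glue:
  assumes A: "A \<in> Obj C" and B: "B \<in> Obj C"
    and f: "\<And>g. g \<in> carrier G \<Longrightarrow> valid (f g) \<and> src (f g) = A \<and> tgt (f g) = B"
  shows "\<exists>s. valid s \<and> src s = A \<and> tgt s = B \<and> (\<forall>g\<in>carrier G. s \<star> hproj g A = f g \<star> hproj g A)"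
proof -
  obtain I S \<iota> \<pi> where bi: "is_biproduct C I S A \<iota> \<pi>" and I: "I \<subseteq> carrier G" "\<And>i. i \<in> I \<Longrightarrow> S i \<in> Cg i"
    and inc: "\<And>i g. \<lbrakk>i \<in> I; g \<in> carrier G\<rbrakk> \<Longrightarrow> hproj g A \<star> inc S A \<iota> i = (if i = g then inc S A \<iota> i else zer (S i) A)"
    using homogeneous_decompE[OF A] by blast
  have v: "valid (inc S A \<iota> i)" "i \<in> carrier G" "S i \<in> Obj C" if "i \<in> I" for i
    using biproduct_valid(1,3)[OF bi] I that by auto
  define s where "s = Arrow A (\<Oplus>\<^bsub>Hom C A B\<^esub>i\<in>I. mor (f i \<star> inc S A \<iota> i) \<cdot> \<pi> i) B"
  have fi: "mor (f i \<star> inc S A \<iota> i) \<in> arr C (S i) B" if "i \<in> I" for i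
  proof -
    have "valid (f i \<star> inc S A \<iota> i)"
      using v[OF that] f[OF v(2)[OF that]] by (intro valid_cmp) auto
    then show ?thesis using f[OF v(2)[OF that]] by (intro valid_mor) auto
  qed
  note glue = biproduct_glue[OF bi B fi]
  have s: "valid s" "src s = A" "tgt s = B" using glue(1) A B by (simp_all add: s_def)
  have s_inc: "s \<star> inc S A \<iota> i = f i \<star> inc S A \<iota> i" if "i \<in> I" for i
    using glue(2)[OF _ that] f[OF v(2)[OF that]] by (intro arrow_eqI) (auto simp: s_def cmp_def)
  have "s \<star> hproj g A = f g \<star> hproj g A" if g: "g \<in> carrier G" for g
  proof (rule biproduct_ext[OF bi])
    fix i assume i: "i \<in> I"
    show "(s \<star> hproj g A) \<star> inc S A \<iota> i = (f g \<star> hproj g A) \<star> inc S A \<iota> i"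
      using i g v[OF i] f[OF g] s A inc[OF i g] s_inc[OF i] by (simp split: if_splits)
  qed (use s f[OF g] g A in auto)
  then show ?thesis using s by blast
qed

text \<open>Restricted to a summand of \<open>src f\<close>, the arrow \<open>f\<close> still has a
  homogeneous source, so the characterization of the idempotent on \<open>tgt f\<close> applies to
  it.\<close>

lemma hproj_natural:
  assumes f: "valid f" and g: "g \<in> carrier G"
  shows "f \<star> hproj g (src f) = hproj g (tgt f) \<star> f"
proof -
  let ?A = "src f"
  have A: "?A \<in> Obj C" using f by simp
  obtain I S \<iota> \<pi> where bi: "is_biproduct C I S ?A \<iota> \<pi>" and I: "I \<subseteq> carrier G" "\<And>i. i \<in> I \<Longrightarrow> S i \<in> Cg i"
    and inc: "\<And>i g. \<lbrakk>i \<in> I; g \<in> carrier G\<rbrakk> \<Longrightarrow> hproj g ?A \<star> inc S ?A \<iota> i = (if i = g then inc S ?A \<iota> i else zer (S i) ?A)"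
    using homogeneous_decompE[OF A] by blast
  show ?thesis
  proof (rule biproduct_ext[OF bi])
    fix i assume i: "i \<in> I"
    then have v: "valid (inc S ?A \<iota> i)" "i \<in> carrier G" "S i \<in> Cg i" "S i \<in> Obj C"
      using biproduct_valid(1,3)[OF bi] I by auto
    have "hproj g (tgt f) \<star> f \<star> inc S ?A \<iota> i = (if i = g then f \<star> inc S ?A \<iota> i else zer (S i) (tgt f))"
      using hproj_cmp_homogeneous[of "f \<star> inc S ?A \<iota> i" g i "tgt f"] v g f by simp
    then show "(f \<star> hproj g ?A) \<star> inc S ?A \<iota> i = (hproj g (tgt f) \<star> f) \<star> inc S ?A \<iota> i"
      using v f g inc[OF i g] by (simp split: if_splits)
  qed (use f g in auto)
qed

lemma hproj_split:
  assumes A: "A \<in> Obj C" and g: "g \<in> carrier G"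
  obtains V j p where "V \<in> Cg g" "valid j" "src j = V" "tgt j = A" "valid p" "src p = A" "tgt p = V"
    "p \<star> j = idt V" "j \<star> p = hproj g A"
proof -
  obtain I S \<iota> \<pi> where bi: "is_biproduct C I S A \<iota> \<pi>" and I: "I \<subseteq> carrier G" "\<And>i. i \<in> I \<Longrightarrow> S i \<in> Cg i"
    and inc: "\<And>i g. \<lbrakk>i \<in> I; g \<in> carrier G\<rbrakk> \<Longrightarrow> hproj g A \<star> inc S A \<iota> i = (if i = g then inc S A \<iota> i else zer (S i) A)"
    using homogeneous_decompE[OF A] by blast
  note v = biproduct_valid[OF bi]
  show thesis
  proof (cases "g \<in> I")
    case True
    have "inc S A \<iota> g \<star> prj S A \<pi> g = hproj g A"
    proof (rule biproduct_ext[OF bi])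
      fix i assume i: "i \<in> I"
      have "(inc S A \<iota> g \<star> prj S A \<pi> g) \<star> inc S A \<iota> i = inc S A \<iota> g \<star> prj S A \<pi> g \<star> inc S A \<iota> i"
        using v i True by (intro cmp_assoc) auto
      then show "(inc S A \<iota> g \<star> prj S A \<pi> g) \<star> inc S A \<iota> i = hproj g A \<star> inc S A \<iota> i"
        using v i True g by (simp add: inc biproduct_cmp[OF bi])
    qed (use v True A g in auto)
    then show thesis
      using v(1-3)[of g] True I biproduct_cmp[OF bi True True] A
      by (intro that[of "S g" "inc S A \<iota> g" "prj S A \<pi> g"]) auto
  next
    case False
    \<comment> \<open>The splitting object must lie in \<open>Cg g\<close> even when
      \<open>A\<close> has nothing in degree \<open>g\<close>; each component contains a zero object
      for this case.\<close>
    obtain Z where Z: "Z \<in> Cg g" "is_zero_object C Z" using component_zero[OF g] by blast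
    then have ZC: "Z \<in> Obj C" using g by simp
    then have "Ident C Z = \<zero>\<^bsub>Hom C Z Z\<^esub>"
      using Z(2) ident_arr hom_zero_arr unfolding is_zero_object_def by metis
    then have "idt Z = zer Z Z" by (simp add: idt_def zer_def)
    moreover have "zer A A = hproj g A"
      by (rule biproduct_ext[OF bi]) (use A g v False inc in \<open>auto split: if_splits\<close>)
    ultimately show thesis
      using Z ZC A by (intro that[of Z "zer Z A" "zer A Z"]) auto
  qed
qed

text \<open>\<open>T x\<close> turns a homogeneous decomposition of \<open>A\<close> into one of
  \<open>T x A\<close>, moving degree \<open>i\<close> to \<open>\<phi> x i\<close>. Distinct
  degrees stay distinct because \<open>\<phi> x\<close> is injective.\<close>

lemma act_hproj:
  assumes x: "x \<in> carrier F" and A: "A \<in> Obj C" and g: "g \<in> carrier G"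
  shows "act x (hproj g A) = hproj (\<phi> x g) (ob x A)"
proof -
  obtain I S \<iota> \<pi> where bi: "is_biproduct C I S A \<iota> \<pi>" and I: "I \<subseteq> carrier G" "\<And>i. i \<in> I \<Longrightarrow> S i \<in> Cg i"
    and inc: "\<And>i g. \<lbrakk>i \<in> I; g \<in> carrier G\<rbrakk> \<Longrightarrow> hproj g A \<star> inc S A \<iota> i = (if i = g then inc S A \<iota> i else zer (S i) A)"
    using homogeneous_decompE[OF A] by blast
  show ?thesis
  proof (rule biproduct_ext[OF act_biproduct[OF x bi]])
    fix i assume i: "i \<in> I"
    then have v: "valid (inc S A \<iota> i)" "i \<in> carrier G" "S i \<in> Cg i" "S i \<in> Obj C"
      using biproduct_valid(1,3)[OF bi] I by auto
    have "act x (hproj g A) \<star> act x (inc S A \<iota> i) = act x (hproj g A \<star> inc S A \<iota> i)"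
      using v x A g by (intro act_cmp[symmetric]) auto
    also have "\<dots> = (if i = g then act x (inc S A \<iota> i) else zer (ob x (S i)) (ob x A))"
      using inc[OF i g] x v A by simp
    also have "\<dots> = hproj (\<phi> x g) (ob x A) \<star> act x (inc S A \<iota> i)"
      using hproj_cmp_homogeneous[of "act x (inc S A \<iota> i)" "\<phi> x g" "\<phi> x i" "ob x A"] v x g coherent[OF x v(2,3)]
      by (simp add: \<phi>_eq_iff)
    finally show "act x (hproj g A) \<star> inc (\<lambda>i. ob x (S i)) (ob x A) (\<lambda>i. FMor (T x) (\<iota> i)) i
        = hproj (\<phi> x g) (ob x A) \<star> inc (\<lambda>i. ob x (S i)) (ob x A) (\<lambda>i. FMor (T x) (\<iota> i)) i"
      by (simp add: act_def)
  qed (use x A g in auto)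
qed

end

section \<open>Homogeneous components of equivariant objects\<close>

context graded_action
begin

sublocale W: equivariant_category K C F T T2 "Obj C" "carrier F"
  by (rule equivariant_category_whole)

abbreviation St :: "'g \<Rightarrow> 'f set"
  where "St g \<equiv> stabilizer F \<phi> g"

abbreviation EG :: "('k, 'o \<times> ('f \<Rightarrow> 'm), 'm) category_data"
  where "EG \<equiv> eqv (Obj C) (carrier F)"

abbreviation Eg :: "'g \<Rightarrow> ('k, 'o \<times> ('f \<Rightarrow> 'm), 'm) category_data"
  where "Eg g \<equiv> eqv (Cg g) (St g)"

abbreviation orb :: "'g \<Rightarrow> 'g set"
  where "orb g \<equiv> orbit F \<phi> g"

section \<open>Stabilizers and orbits\<close>

lemma St_iff: "h \<in> St g \<longleftrightarrow> h \<in> carrier F \<and> \<phi> h g = g"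
  by (simp add: stabilizer_def)

lemma St_subgroup: "g \<in> carrier G \<Longrightarrow> subgroup (St g) F"
  using group_action.stabilizer_subgroup[OF action] .

lemma orb_iff: "x \<in> orb g \<longleftrightarrow> (\<exists>t\<in>carrier F. x = \<phi> t g)"
  by (auto simp: orbit_def)

lemma orb_translate:
  assumes "t \<in> carrier F" "x \<in> carrier G" "g \<in> carrier G"
  shows "\<phi> t x \<in> orb g \<longleftrightarrow> x \<in> orb g"
proof
  assume "\<phi> t x \<in> orb g"
  then obtain s where "s \<in> carrier F" "\<phi> t x = \<phi> s g" by (auto simp: orb_iff)
  then have "x = \<phi> (inv\<^bsub>F\<^esub> t \<otimes>\<^bsub>F\<^esub> s) g"
    using assms by (metis \<phi>_inv(2) \<phi>_mult F.inv_closed)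
  then show "x \<in> orb g" using \<open>s \<in> carrier F\<close> assms by (auto simp: orb_iff)
next
  assume "x \<in> orb g"
  then show "\<phi> t x \<in> orb g" using assms by (auto simp: orb_iff simp flip: \<phi>_mult)
qed

lemma equivariant_category_component:
  "g \<in> carrier G \<Longrightarrow> equivariant_category K C F T T2 (Cg g) (St g)"
  by (intro equivariant_category.intro equivariant_category_axioms.intro tensor_action_axioms
      component_sub St_subgroup)

section \<open>The conjugation action of \<open>F\<close> on arrows between underlying
  objects\<close>

definition transport ::
  "'o \<times> ('f \<Rightarrow> 'm) \<Rightarrow> 'o \<times> ('f \<Rightarrow> 'm) \<Rightarrow> 'f \<Rightarrow> ('o, 'm) arrow \<Rightarrow> ('o, 'm) arrow"
  where "transport N N' t f = str N' t \<star> act t f \<star> inv_of (str N t)"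

context
  fixes N N' :: "'o \<times> ('f \<Rightarrow> 'm)"
  assumes N: "N \<in> Obj EG" and N': "N' \<in> Obj EG"
begin

lemma str_simps:
  "fst N \<in> Obj C" "fst N' \<in> Obj C"
  "t \<in> carrier F \<Longrightarrow> isom (str N t)" "t \<in> carrier F \<Longrightarrow> isom (str N' t)"
  using W.E_obj[OF N] W.E_obj[OF N'] by auto

lemma transport_valid:
  assumes "t \<in> carrier F" "valid f" "src f = fst N" "tgt f = fst N'"
  shows "valid (transport N N' t f)" "src (transport N N' t f) = fst N" "tgt (transport N N' t f) = fst N'"
  using assms str_simps by (simp_all add: transport_def)

lemma transport_eq_iff:
  assumes t: "t \<in> carrier F" and f: "valid f" "src f = fst N" "tgt f = fst N'"
    and k: "valid k" "src k = fst N" "tgt k = fst N'"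
  shows "transport N N' t f = k \<longleftrightarrow> k \<star> str N t = str N' t \<star> act t f"
proof
  assume "transport N N' t f = k"
  then show "k \<star> str N t = str N' t \<star> act t f"
    using assms str_simps by (auto simp: transport_def)
next
  assume e: "k \<star> str N t = str N' t \<star> act t f"
  have "k = (k \<star> str N t) \<star> inv_of (str N t)"
    using assms str_simps by simp
  also have "\<dots> = transport N N' t f"
    unfolding e using assms str_simps by (simp add: transport_def)
  finally show "transport N N' t f = k" ..
qed

lemma transport_cmp_str:
  assumes "t \<in> carrier F" "valid f" "src f = fst N" "tgt f = fst N'"
  shows "transport N N' t f \<star> str N t = str N' t \<star> act t f"
  using transport_eq_iff[OF assms transport_valid[OF assms]] by simp

lemma transport_one:
  assumes "valid f" "src f = fst N" "tgt f = fst N'"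
  shows "transport N N' \<one>\<^bsub>F\<^esub> f = f"
  using assms str_simps W.E_obj(6)[OF N] W.E_obj(6)[OF N'] by (subst transport_eq_iff) auto

lemma transport_zer:
  "t \<in> carrier F \<Longrightarrow> transport N N' t (zer (fst N) (fst N')) = zer (fst N) (fst N')"
  using str_simps by (simp add: transport_def)

text \<open>Composing with the invertible \<open>coh s t (fst N)\<close> exposes the cocycle
  conditions of \<open>N\<close> and \<open>N'\<close>; naturality of \<open>T2\<close> then matches
  the two sides. With \<open>transport_one\<close> this makes \<open>transport\<close> a group
  action.\<close>

lemma transport_mult:
  assumes st: "s \<in> carrier F" "t \<in> carrier F" and f: "valid f" "src f = fst N" "tgt f = fst N'"
  shows "transport N N' s (transport N N' t f) = transport N N' (s \<otimes>\<^bsub>F\<^esub> t) f"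
proof -
  let ?u = "transport N N' t f"
  let ?m = "transport N N' s ?u"
  note u = transport_valid[OF st(2) f]
  note m = transport_valid[OF st(1) u]
  note simps = str_simps st f u m
  have "?m \<star> str N (s \<otimes>\<^bsub>F\<^esub> t) = str N' (s \<otimes>\<^bsub>F\<^esub> t) \<star> act (s \<otimes>\<^bsub>F\<^esub> t) f"
  proof (rule isom_epic[of "coh s t (fst N)"])
    have "(?m \<star> str N (s \<otimes>\<^bsub>F\<^esub> t)) \<star> coh s t (fst N) = ?m \<star> str N (s \<otimes>\<^bsub>F\<^esub> t) \<star> coh s t (fst N)"
      using simps by simp
    also have "\<dots> = (?m \<star> str N s) \<star> act s (str N t)"
      using simps W.E_obj(5)[OF N st] by simp
    also have "?m \<star> str N s = str N' s \<star> act s ?u"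
      by (rule transport_cmp_str[OF st(1) u])
    also have "\<dots> \<star> act s (str N t) = str N' s \<star> act s (?u \<star> str N t)"
      using simps by simp
    also have "?u \<star> str N t = str N' t \<star> act t f"
      by (rule transport_cmp_str[OF st(2) f])
    also have "str N' s \<star> act s \<dots> = (str N' s \<star> act s (str N' t)) \<star> act s (act t f)"
      using simps by simp
    also have "str N' s \<star> act s (str N' t) = str N' (s \<otimes>\<^bsub>F\<^esub> t) \<star> coh s t (fst N')"
      by (rule W.E_obj(5)[OF N' st])
    also have "\<dots> \<star> act s (act t f) = str N' (s \<otimes>\<^bsub>F\<^esub> t) \<star> coh s t (fst N') \<star> act s (act t f)"
      using simps by simp
    also have "coh s t (fst N') \<star> act s (act t f) = act (s \<otimes>\<^bsub>F\<^esub> t) f \<star> coh s t (fst N)"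
      using coh_natural[OF st f(1)] f by simp
    also have "str N' (s \<otimes>\<^bsub>F\<^esub> t) \<star> \<dots> = (str N' (s \<otimes>\<^bsub>F\<^esub> t) \<star> act (s \<otimes>\<^bsub>F\<^esub> t) f) \<star> coh s t (fst N)"
      using simps by simp
    finally show "(?m \<star> str N (s \<otimes>\<^bsub>F\<^esub> t)) \<star> coh s t (fst N) =
        (str N' (s \<otimes>\<^bsub>F\<^esub> t) \<star> act (s \<otimes>\<^bsub>F\<^esub> t) f) \<star> coh s t (fst N)" .
  qed (use simps in simp_all)
  then show ?thesis
    using simps by (intro transport_eq_iff[THEN iffD2, symmetric]) auto
qed

text \<open>The idempotent passes through the structure arrow by naturality, and there
  \<open>act_hproj\<close> identifies degree \<open>\<phi> t g\<close> with the image of degree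
  \<open>g\<close>.\<close>

lemma transport_hproj:
  assumes t: "t \<in> carrier F" and g: "g \<in> carrier G" and f: "valid f" "src f = fst N" "tgt f = fst N'"
  shows "transport N N' t f \<star> hproj (\<phi> t g) (fst N) = transport N N' t (f \<star> hproj g (fst N))"
proof -
  have "inv_of (str N t) \<star> hproj (\<phi> t g) (fst N) = act t (hproj g (fst N)) \<star> inv_of (str N t)"
    using hproj_natural[of "inv_of (str N t)" "\<phi> t g"] t g str_simps by (simp add: act_hproj)
  then show ?thesis
    using t g f str_simps by (simp add: transport_def)
qed

lemma eqhom_transport:
  assumes "eqhom (carrier F) N N' f" "t \<in> carrier F"
  shows "transport N N' t f = f"
  using assms by (subst transport_eq_iff) (auto simp: eqhom_def)

lemma eqhom_transportI:
  assumes "valid f" "src f = fst N" "tgt f = fst N'" "\<And>t. t \<in> carrier F \<Longrightarrow> transport N N' t f = f"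
  shows "eqhom (carrier F) N N' f"
  using assms transport_eq_iff[OF _ assms(1-3) assms(1-3)] by (auto simp: eqhom_def)

end

section \<open>Homogeneous components with inclusion and retraction\<close>

definition component ::
  "'g \<Rightarrow> 'o \<times> ('f \<Rightarrow> 'm) \<Rightarrow> 'o \<times> ('f \<Rightarrow> 'm) \<Rightarrow> ('o, 'm) arrow \<Rightarrow> ('o, 'm) arrow \<Rightarrow> bool"
  where "component g M N j p \<longleftrightarrow> g \<in> carrier G \<and> M \<in> Obj (Eg g) \<and> N \<in> Obj EG \<and> eqhom (St g) M N j \<and>
    valid p \<and> src p = fst N \<and> tgt p = fst M \<and> p \<star> j = idt (fst M) \<and> j \<star> p = hproj g (fst N)"

definition full :: "'g \<Rightarrow> 'o \<times> ('f \<Rightarrow> 'm) \<Rightarrow> bool"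
  where "full g N \<longleftrightarrow> (\<forall>x\<in>carrier G. x \<notin> orb g \<longrightarrow> hproj x (fst N) = zer (fst N) (fst N))"

lemma eqhomD:
  assumes "eqhom H N N' f"
  shows "valid f" "src f = fst N" "tgt f = fst N'"
  using assms by (auto simp: eqhom_def)

lemma componentD:
  assumes "component g M N j p"
  shows "g \<in> carrier G" "M \<in> Obj (Eg g)" "N \<in> Obj EG" "fst M \<in> Obj C" "fst N \<in> Obj C"
    "valid j" "src j = fst M" "tgt j = fst N" "valid p" "src p = fst N" "tgt p = fst M"
    "p \<star> j = idt (fst M)" "j \<star> p = hproj g (fst N)" "p \<star> hproj g (fst N) = p" "hproj g (fst N) \<star> j = j"
proof -
  show *: "g \<in> carrier G" "M \<in> Obj (Eg g)" "N \<in> Obj EG"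
    "valid j" "src j = fst M" "tgt j = fst N" "valid p" "src p = fst N" "tgt p = fst M"
    "p \<star> j = idt (fst M)" and jp: "j \<star> p = hproj g (fst N)"
    using assms by (auto simp: component_def eqhom_def)
  show "fst M \<in> Obj C" "fst N \<in> Obj C"
    using * valid_src[of j] valid_src[of p] by auto
  have "p \<star> j \<star> p = (p \<star> j) \<star> p" using *(4-9) by simp
  also have "\<dots> = p" using * \<open>fst M \<in> Obj C\<close> by (simp del: cmp_assoc)
  finally show "p \<star> hproj g (fst N) = p" by (simp add: jp)
  have "(j \<star> p) \<star> j = j" using * \<open>fst M \<in> Obj C\<close> by simp
  then show "hproj g (fst N) \<star> j = j" by (simp add: jp)
qed

lemma component_str_valid:
  assumes "component g M N j p" "h \<in> St g"
  shows "h \<in> carrier F" "\<phi> h g = g" "isom (str M h)" "isom (str N h)"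
  using equivariant_category.E_obj(3)[OF equivariant_category_component componentD(2)] componentD[OF assms(1)]
    assms W.E_obj(3) by (auto simp: St_iff)

text \<open>For \<open>h\<close> in the stabilizer the idempotent of degree \<open>g\<close>
  commutes with the structure arrow. Writing it as \<open>j \<star> p\<close> turns equivariance of
  \<open>j\<close> into equivariance of \<open>p\<close>.\<close>

lemma component_proj_eqhom:
  assumes c: "component g M N j p"
  shows "eqhom (St g) N M p"
proof -
  note d = componentD[OF c]
  have "p \<star> str N h = str M h \<star> act h p" if h: "h \<in> St g" for h
  proof -
    note s = component_str_valid[OF c h]
    have j: "j \<star> str M h = str N h \<star> act h j"
      using c h by (auto simp: component_def eqhom_def)
    have "p \<star> str N h = (p \<star> hproj g (fst N)) \<star> str N h"
      by (simp add: d)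
    also have "\<dots> = p \<star> hproj g (fst N) \<star> str N h"
      using d s by (intro cmp_assoc) auto
    also have "hproj g (fst N) \<star> str N h = str N h \<star> act h (hproj g (fst N))"
      using hproj_natural[of "str N h" g] d s by (simp add: act_hproj)
    also have "hproj g (fst N) = j \<star> p" using d by simp
    also have "p \<star> str N h \<star> act h (j \<star> p) = p \<star> (str N h \<star> act h j) \<star> act h p"
      using d(4-12) s by simp
    also have "str N h \<star> act h j = j \<star> str M h" by (simp add: j)
    also have "p \<star> (j \<star> str M h) \<star> act h p = (p \<star> j) \<star> str M h \<star> act h p"
      using d(4-11) s by simp
    also have "\<dots> = str M h \<star> act h p"
      using d(4-11) s unfolding d(12) by simp
    finally show ?thesis .
  qed
  then show ?thesis using d by (simp add: eqhom_def)
qed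

lemma component_restrict:
  assumes c: "component g M N j p" and c': "component g M' N' j' p'" and f: "eqhom (carrier F) N N' f"
  shows "eqhom (St g) M M' (p' \<star> f \<star> j)"
proof -
  have sub: "St g \<subseteq> carrier F" by (auto simp: St_iff)
  have f': "eqhom (St g) N N' f" and j: "eqhom (St g) M N j"
    using f sub c by (auto simp: eqhom_def component_def)
  note v = component_str_valid(3,4)[OF c, THEN isom_valid] component_str_valid(3,4)[OF c', THEN isom_valid]
  have fj: "eqhom (St g) M N' (f \<star> j)"
    by (rule eqhom_cmp_general[OF sub v(1,2,4) j f'])
  show ?thesis
    by (rule eqhom_cmp_general[OF sub v(1,4,3) fj component_proj_eqhom[OF c']])
qed

text \<open>By naturality of the idempotents \<open>f\<close> preserves degree \<open>g\<close>, so
  \<open>f \<star> j\<close> factors through \<open>j'\<close>.\<close>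

lemma component_factor:
  assumes c: "component g M N j p" and c': "component g M' N' j' p'"
    and f: "valid f" "src f = fst N" "tgt f = fst N'"
  shows "f \<star> j = j' \<star> p' \<star> f \<star> j" "f \<star> hproj g (fst N) = j' \<star> (p' \<star> f \<star> j) \<star> p"
proof -
  note d = componentD[OF c] and d' = componentD[OF c']
  have "f \<star> j = f \<star> hproj g (fst N) \<star> j" by (simp add: d)
  also have "\<dots> = (f \<star> hproj g (fst N)) \<star> j" using d f by simp
  also have "f \<star> hproj g (fst N) = hproj g (fst N') \<star> f"
    using hproj_natural[OF f(1) d(1)] f by simp
  also have "\<dots> \<star> j = (j' \<star> p') \<star> f \<star> j"
    using d d' f by simp
  also have "\<dots> = j' \<star> p' \<star> f \<star> j"
    using d(4-11) d'(4-11) f by (intro cmp_assoc) auto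
  finally show *: "f \<star> j = j' \<star> p' \<star> f \<star> j" .
  have "f \<star> hproj g (fst N) = (f \<star> j) \<star> p"
    using d f by simp
  also have "\<dots> = (j' \<star> p' \<star> f \<star> j) \<star> p"
    using * by (rule arg_cong)
  also have "\<dots> = j' \<star> (p' \<star> f \<star> j) \<star> p"
    using d(4-11) d'(4-11) f by simp
  finally show "f \<star> hproj g (fst N) = j' \<star> (p' \<star> f \<star> j) \<star> p" .
qed

text \<open>The inner \<open>j' \<star> p'\<close> is an idempotent that acts trivially on
  \<open>f \<star> j\<close>. Thus restriction to components is functorial.\<close>

lemma component_restrict_cmp:
  assumes c: "component g M N j p" and c': "component g M' N' j' p'" and c'': "component g M'' N'' j'' p''"
    and f: "valid f" "src f = fst N" "tgt f = fst N'" and f': "valid f'" "src f' = fst N'" "tgt f' = fst N''"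
  shows "p'' \<star> (f' \<star> f) \<star> j = (p'' \<star> f' \<star> j') \<star> (p' \<star> f \<star> j)"
proof -
  note d = componentD(4-11)[OF c] and d' = componentD(4-11)[OF c'] and d'' = componentD(4-11)[OF c'']
  have "p'' \<star> (f' \<star> f) \<star> j = p'' \<star> f' \<star> f \<star> j"
    using d d' d'' f f' by simp
  also have "f \<star> j = j' \<star> p' \<star> f \<star> j"
    by (rule component_factor(1)[OF c c' f])
  also have "p'' \<star> f' \<star> \<dots> = (p'' \<star> f' \<star> j') \<star> (p' \<star> f \<star> j)"
    using d d' d'' f f' by simp
  finally show ?thesis .
qed

text \<open>Faithfulness. An equivariant arrow is fixed by \<open>transport\<close>, so on degree
  \<open>\<phi> t g\<close> it is the transport of its part in degree \<open>g\<close>. Agreement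
  off the orbit is left as a hypothesis because it can come from a full source, a full target or a
  direct computation.\<close>

lemma component_eqI:
  assumes c: "component g M N j p" and c': "component g M' N' j' p'"
    and f: "eqhom (carrier F) N N' f" and f': "eqhom (carrier F) N N' f'"
    and eq: "p' \<star> f \<star> j = p' \<star> f' \<star> j"
    and off: "\<And>x. \<lbrakk>x \<in> carrier G; x \<notin> orb g\<rbrakk> \<Longrightarrow> f \<star> hproj x (fst N) = f' \<star> hproj x (fst N)"
  shows "f = f'"
proof (rule graded_ext)
  note d = componentD[OF c] and d' = componentD[OF c']
  fix x assume x: "x \<in> carrier G"
  show "f \<star> hproj x (fst N) = f' \<star> hproj x (fst N)"
  proof (cases "x \<in> orb g")
    case True
    then obtain t where t: "t \<in> carrier F" "x = \<phi> t g" by (auto simp: orb_iff)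
    have *: "k \<star> hproj x (fst N) = transport N N' t (j' \<star> (p' \<star> k \<star> j) \<star> p)"
      if k: "eqhom (carrier F) N N' k" for k
    proof -
      have "k \<star> hproj x (fst N) = transport N N' t k \<star> hproj x (fst N)"
        using eqhom_transport[OF d(3) d'(3) k t(1)] by simp
      also have "\<dots> = transport N N' t (k \<star> hproj g (fst N))"
        unfolding t(2) by (rule transport_hproj[OF d(3) d'(3) t(1) d(1) eqhomD[OF k]])
      finally show ?thesis
        using component_factor(2)[OF c c' eqhomD[OF k]] by simp
    qed
    show ?thesis using *[OF f] *[OF f'] eq by simp
  qed (use off x in simp)
qed (use eqhomD[OF f] eqhomD[OF f'] in auto)

text \<open>
  On the component of degree \<open>\<phi> t g\<close> the extension has to be the transport by \<open>t\<close> of the given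
  morphism; by equivariance under the stabilizer this does not depend on the choice of \<open>t\<close>.
\<close>

lemma component_extend:
  assumes c: "component g M N j p" and c': "component g M' N' j' p'" and u: "eqhom (St g) M M' u"
  obtains f where "eqhom (carrier F) N N' f" "p' \<star> f \<star> j = u"
    "\<And>x. \<lbrakk>x \<in> carrier G; x \<notin> orb g\<rbrakk> \<Longrightarrow> f \<star> hproj x (fst N) = zer (fst N) (fst N')"
proof -
  note d = componentD[OF c] and d' = componentD[OF c']
  note g = d(1) and NN = d(3) d'(3)
  have sub: "St g \<subseteq> carrier F" by (auto simp: St_iff)
  \<comment> \<open>\<open>u\<close> viewed as an arrow between the whole objects, concentrated in
    degree \<open>g\<close>.\<close>
  define f0 where "f0 = j' \<star> u \<star> p"
  have f0: "valid f0" "src f0 = fst N" "tgt f0 = fst N'"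
    using d d' eqhomD[OF u] by (auto simp: f0_def)
  note v = component_str_valid(3,4)[OF c, THEN isom_valid] component_str_valid(3,4)[OF c', THEN isom_valid]
  have f0_eq: "eqhom (St g) N N' f0"
  proof -
    have up: "eqhom (St g) N M' (u \<star> p)"
      by (rule eqhom_cmp_general[OF sub v(2,1,3) component_proj_eqhom[OF c] u])
    have j': "eqhom (St g) M' N' j'" using c' by (simp add: component_def)
    show ?thesis
      unfolding f0_def by (rule eqhom_cmp_general[OF sub v(2,3,4) up j'])
  qed
  have f0_fix: "transport N N' h f0 = f0" if "h \<in> St g" for h
    using f0_eq that sub by (subst transport_eq_iff[OF NN _ f0 f0]) (auto simp: eqhom_def)
  have indep: "transport N N' s f0 = transport N N' t f0"
    if st: "s \<in> carrier F" "t \<in> carrier F" "\<phi> s g = \<phi> t g" for s t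
  proof -
    \<comment> \<open>Two elements that move \<open>g\<close> to the same degree differ by an
      element of the stabilizer, which fixes \<open>f0\<close>.\<close>
    let ?h = "inv\<^bsub>F\<^esub> t \<otimes>\<^bsub>F\<^esub> s"
    have h: "?h \<in> St g"
      using st g by (simp add: St_iff \<phi>_mult)
    have "transport N N' s f0 = transport N N' (t \<otimes>\<^bsub>F\<^esub> ?h) f0"
      using st by (simp flip: F.m_assoc)
    also have "\<dots> = transport N N' t (transport N N' ?h f0)"
      using st by (intro transport_mult[OF NN _ _ f0, symmetric]) auto
    finally show ?thesis using f0_fix[OF h] by simp
  qed
  \<comment> \<open>The value zero off the orbit is what yields the last claim; it also makes the
    family compatible with transport, since translation preserves the complement of the
    orbit.\<close>
  define k where "k x = (if x \<in> orb g then transport N N' (SOME t. t \<in> carrier F \<and> x = \<phi> t g) f0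
    else zer (fst N) (fst N'))" for x
  have k_orb: "k (\<phi> t g) = transport N N' t f0" if t: "t \<in> carrier F" for t
  proof -
    let ?s = "SOME s. s \<in> carrier F \<and> \<phi> t g = \<phi> s g"
    have "?s \<in> carrier F \<and> \<phi> t g = \<phi> ?s g"
      by (rule someI[of _ t]) (use t in simp)
    then have "transport N N' ?s f0 = transport N N' t f0" using indep t by metis
    then show ?thesis using t by (auto simp: k_def orb_iff)
  qed
  have k: "valid (k x) \<and> src (k x) = fst N \<and> tgt (k x) = fst N'" for x
  proof (cases "x \<in> orb g")
    case True
    then show ?thesis using k_orb transport_valid[OF NN _ f0] by (auto simp: orb_iff)
  next
    case False
    then show ?thesis using d d' by (simp add: k_def)
  qed
  have k_transport: "transport N N' t (k x) = k (\<phi> t x)" if t: "t \<in> carrier F" and x: "x \<in> carrier G" for t x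
  proof (cases "x \<in> orb g")
    case True
    then obtain s where s: "s \<in> carrier F" "x = \<phi> s g" by (auto simp: orb_iff)
    then show ?thesis
      using t g k_orb[OF s(1)] k_orb[of "t \<otimes>\<^bsub>F\<^esub> s"] transport_mult[OF NN t s(1) f0] by (simp add: \<phi>_mult)
  next
    case False
    then have "\<phi> t x \<notin> orb g" using orb_translate t x g by simp
    then show ?thesis using False transport_zer[OF NN t] by (simp add: k_def)
  qed
  obtain f where f: "valid f" "src f = fst N" "tgt f = fst N'"
    and f_hproj: "\<And>x. x \<in> carrier G \<Longrightarrow> f \<star> hproj x (fst N) = k x \<star> hproj x (fst N)"
    using graded_glue[OF d(5) d'(5), of k] k by blast
  have "eqhom (carrier F) N N' f"
  proof (rule eqhom_transportI[OF NN f])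
    fix t assume t: "t \<in> carrier F"
    note tf = transport_valid[OF NN t f]
    show "transport N N' t f = f"
    proof (rule graded_ext[OF tf(1) f(1) tf(2) f(2)])
      show "tgt (transport N N' t f) = tgt f" using tf f by simp
      fix y assume y: "y \<in> carrier G"
      \<comment> \<open>The degree that \<open>t\<close> moves to \<open>y\<close>; invariance of
        \<open>f\<close> in degree \<open>y\<close> is read off from its value in degree
        \<open>x\<close>.\<close>
      define x where "x = \<phi> (inv\<^bsub>F\<^esub> t) y"
      have x: "x \<in> carrier G" "\<phi> t x = y" using y t by (simp_all add: x_def)
      have kx: "valid (k x)" "src (k x) = fst N" "tgt (k x) = fst N'" using k by auto
      have "transport N N' t f \<star> hproj y (fst N) = transport N N' t (f \<star> hproj x (fst N))"
        using transport_hproj[OF NN t x(1) f] x by simp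
      also have "\<dots> = transport N N' t (k x) \<star> hproj y (fst N)"
        using transport_hproj[OF NN t x(1) kx] x f_hproj by simp
      also have "\<dots> = f \<star> hproj y (fst N)"
        using k_transport[OF t x(1)] x f_hproj[OF y] by simp
      finally show "transport N N' t f \<star> hproj y (fst N) = f \<star> hproj y (fst N)" .
    qed
  qed
  moreover have "p' \<star> f \<star> j = u"
  proof -
    have kg: "k g = f0"
      using k_orb[of "\<one>\<^bsub>F\<^esub>"] g transport_one[OF NN f0] by simp
    have "p' \<star> f \<star> j = p' \<star> (f \<star> hproj g (fst N)) \<star> j"
      using d d' f by simp
    also have "f \<star> hproj g (fst N) = f0 \<star> hproj g (fst N)"
      using f_hproj[OF g] kg by simp
    also have "p' \<star> \<dots> \<star> j = p' \<star> f0 \<star> j"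
      using d d' f0 by simp
    also have "\<dots> = (p' \<star> j') \<star> u \<star> (p \<star> j)"
      using d(4-11) d'(4-11) eqhomD[OF u] by (simp add: f0_def)
    also have "\<dots> = u"
      using d(4) d'(4) eqhomD[OF u] unfolding d(12) d'(12) by simp
    finally show ?thesis .
  qed
  moreover have "f \<star> hproj x (fst N) = zer (fst N) (fst N')" if "x \<in> carrier G" "x \<notin> orb g" for x
    using f_hproj[OF that(1)] that d d' by (simp add: k_def)
  ultimately show thesis by (rule that)
qed

text \<open>Structure arrows are compressed to \<open>p \<star> str N h \<star> act h j\<close>. For
  \<open>h\<close> in the stabilizer the idempotent \<open>j \<star> p\<close> commutes with
  \<open>str N h\<close>, so compression loses nothing and the cocycle condition survives.\<close>

lemma component_exists:
  assumes N: "N \<in> Obj EG" and g: "g \<in> carrier G"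
  obtains M j p where "component g M N j p"
proof -
  let ?A = "fst N"
  have A: "?A \<in> Obj C" using W.E_obj(2)[OF N] .
  obtain V j p where V: "V \<in> Cg g" and j: "valid j" "src j = V" "tgt j = ?A"
    and p: "valid p" "src p = ?A" "tgt p = V" and pj: "p \<star> j = idt V" and jp: "j \<star> p = hproj g ?A"
    using hproj_split[OF A g] by metis
  have VC: "V \<in> Obj C" using V g by simp
  have St: "h \<in> carrier F" "\<phi> h g = g" "isom (str N h)" if "h \<in> St g" for h
    using that W.E_obj(3)[OF N] by (auto simp: St_iff)
  have one: "\<one>\<^bsub>F\<^esub> \<in> St g" using g by (simp add: St_iff)
  have mult: "h \<otimes>\<^bsub>F\<^esub> k \<in> St g" if "h \<in> St g" "k \<in> St g" for h k
    using subgroup.m_closed[OF St_subgroup[OF g] that] .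
  define M where "M = (V, \<lambda>h\<in>St g. mor (p \<star> str N h \<star> act h j))"
  have fstM [simp]: "fst M = V" by (simp add: M_def)
  have strM: "str M h = p \<star> str N h \<star> act h j" if "h \<in> St g" for h
    using that St[OF that] j p by (intro arrow_eqI) (auto simp: str_def M_def)
  have vM: "valid (str M h)" if "h \<in> St g" for h
    using St[OF that] j p A by (simp add: strM[OF that])
  have hj: "hproj g ?A \<star> j = j"
    using pj j p VC by (simp flip: jp)
  have ph: "p \<star> hproj g ?A = p"
    using cmp_reassoc[OF pj, of p] pj j p VC by (simp flip: jp)
  have act_hj: "act h (hproj g ?A) \<star> act h j = act h j" if "h \<in> St g" for h
    using St[OF that] j A g hj by (simp flip: act_cmp)
  have str_h: "str N h \<star> act h (hproj g ?A) = hproj g ?A \<star> str N h" if "h \<in> St g" for h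
    using hproj_natural[of "str N h" g] St[OF that] A g by (simp add: act_hproj)
  have equiv: "j \<star> str M h = str N h \<star> act h j" if h: "h \<in> St g" for h
  proof -
    have "j \<star> str M h = (j \<star> p) \<star> str N h \<star> act h j"
      using St[OF h] j p A by (simp add: strM[OF h])
    also have "\<dots> = (hproj g ?A \<star> str N h) \<star> act h j"
      using St[OF h] j p A g by (simp add: jp)
    also have "\<dots> = str N h \<star> act h (hproj g ?A) \<star> act h j"
      using St[OF h] j p A g by (simp flip: str_h[OF h])
    finally show ?thesis using act_hj[OF h] by simp
  qed
  have cocycle: "str M h \<star> act h (str M k) = str M (h \<otimes>\<^bsub>F\<^esub> k) \<star> coh h k V"
    if h: "h \<in> St g" and k: "k \<in> St g" for h k
  proof -
    note s = St[OF h] St[OF k] St[OF mult[OF h k]]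
    have "str M h \<star> act h (str M k) = p \<star> str N h \<star> act h (j \<star> str M k)"
      using s j p A vM[OF k] by (simp add: strM[OF h])
    also have "\<dots> = p \<star> (str N h \<star> act h (str N k)) \<star> act h (act k j)"
      unfolding equiv[OF k] using s j p A by simp
    also have "str N h \<star> act h (str N k) = str N (h \<otimes>\<^bsub>F\<^esub> k) \<star> coh h k ?A"
      using W.E_obj(5)[OF N] s by simp
    also have "p \<star> \<dots> \<star> act h (act k j) = p \<star> str N (h \<otimes>\<^bsub>F\<^esub> k) \<star> coh h k ?A \<star> act h (act k j)"
      using s j p A by simp
    also have "coh h k ?A \<star> act h (act k j) = act (h \<otimes>\<^bsub>F\<^esub> k) j \<star> coh h k V"
      using coh_natural[of h k j] s j by simp
    also have "p \<star> str N (h \<otimes>\<^bsub>F\<^esub> k) \<star> \<dots> = str M (h \<otimes>\<^bsub>F\<^esub> k) \<star> coh h k V"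
      using s j p A VC by (simp add: strM[OF mult[OF h k]])
    finally show ?thesis .
  qed
  have unit: "str M \<one>\<^bsub>F\<^esub> = idt V"
    using W.E_obj(6)[OF N] j p pj by (simp add: strM[OF one])
  have iso: "isom (str M h)" if h: "h \<in> St g" for h
  proof -
    note s = St[OF h]
    \<comment> \<open>The compression of the inverse of \<open>str N h\<close> inverts the
      compression of \<open>str N h\<close>, for the same reason.\<close>
    let ?q = "act h p \<star> inv_of (str N h) \<star> j"
    have "?q \<star> str M h = act h p \<star> inv_of (str N h) \<star> (j \<star> str M h)"
      using s j p A vM[OF h] by simp
    also have "\<dots> = act h p \<star> act h j"
      unfolding equiv[OF h] using s j p A by simp
    also have "\<dots> = idt (ob h V)"
      using s j p VC pj by (simp flip: act_cmp)
    finally have 1: "?q \<star> str M h = idt (ob h V)" .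
    have "str M h \<star> ?q = p \<star> str N h \<star> (act h j \<star> act h p) \<star> inv_of (str N h) \<star> j"
      using s j p A by (simp add: strM[OF h])
    also have "act h j \<star> act h p = act h (hproj g ?A)"
      using s j p jp by (simp flip: act_cmp)
    also have "p \<star> str N h \<star> act h (hproj g ?A) \<star> inv_of (str N h) \<star> j
        = p \<star> (str N h \<star> act h (hproj g ?A)) \<star> inv_of (str N h) \<star> j"
      using s j p A g by simp
    also have "\<dots> = p \<star> hproj g ?A \<star> str N h \<star> inv_of (str N h) \<star> j"
      unfolding str_h[OF h] using s j p A g by simp
    also have "\<dots> = idt V"
      using s j p A g hj pj by simp
    finally have 2: "str M h \<star> ?q = idt V" .
    show ?thesis
      by (rule isomI[of _ ?q]) (use 1 2 s j p A vM[OF h] in simp_all)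
  qed
  have "M \<in> Obj (Eg g)"
    using V iso cocycle unit
    by (subst eqv_obj_iff[OF component_sub[OF g] St_subgroup[OF g]]) (auto simp: M_def)
  then have "component g M N j p"
    unfolding component_def using g N equiv j p pj jp by (auto simp: eqhom_def)
  then show thesis by (rule that)
qed

text \<open>\<open>R\<close> need not contain the unit. Its representative \<open>t0\<close> of the
  trivial coset lies in the stabilizer, so the summand \<open>T t0 V\<close> is only isomorphic to
  \<open>V\<close>, by \<open>str M t0\<close>. All other summands sit in other degrees of the
  orbit, which gives both the idempotent of degree \<open>g\<close> and fullness.\<close>

lemma induced_component:
  assumes M: "M \<in> Obj (Eg g)" and g: "g \<in> carrier G" and R: "left_transversal F (St g) R"
    and ind: "is_induced C F T T2 (St g) R M N"
  obtains j p where "component g M N j p" "full g N"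
proof -
  interpret E: equivariant_category K C F T T2 "Cg g" "St g"
    by (rule equivariant_category_component[OF g])
  let ?V = "fst M" and ?A = "fst N"
  let ?Y = "\<lambda>t. ob t ?V"
  have N: "N \<in> Obj EG" by (rule E.induced_obj[OF M R ind])
  obtain \<iota> \<pi> where bi: "is_biproduct C R ?Y ?A \<iota> \<pi>" and "snd N \<in> extensional (carrier F)"
    and "\<And>a. a \<in> carrier F \<Longrightarrow> valid (str N a)"
    and str: "\<And>a t s h. \<lbrakk>a \<in> carrier F; t \<in> R; s \<in> R; h \<in> St g; a \<otimes>\<^bsub>F\<^esub> t = s \<otimes>\<^bsub>F\<^esub> h\<rbrakk> \<Longrightarrow>
      str N a \<star> act a (inc ?Y ?A \<iota> t) = inc ?Y ?A \<iota> s \<star> E.ind_comp M a t s h"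
    using E.induced_str[OF M R ind] by blast
  note v = biproduct_valid[OF bi]
  have R_F: "t \<in> carrier F" if "t \<in> R" for t
    using that R by (auto simp: left_transversal_def)
  have V: "?V \<in> Cg g" "?V \<in> Obj C" using E.E_obj(1,2)[OF M] by auto
  have A: "?A \<in> Obj C" using v by simp
  define i where "i t = inc ?Y ?A \<iota> t" for t
  define q where "q t = prj ?Y ?A \<pi> t" for t
  have i [simp]: "valid (i t)" "src (i t) = ob t ?V" "tgt (i t) = ?A"
    and q [simp]: "valid (q t)" "src (q t) = ?A" "tgt (q t) = ob t ?V" if "t \<in> R" for t
    using v(1,2)[OF that] by (simp_all add: i_def q_def del: valid_Arrow)
  note str = str[folded i_def]
  obtain t0 h0 where t0: "t0 \<in> R" and h0: "h0 \<in> St g" "\<one>\<^bsub>F\<^esub> = t0 \<otimes>\<^bsub>F\<^esub> h0"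
    using F.left_transversal_decomp[OF R, of "\<one>\<^bsub>F\<^esub>"] by auto
  have t0F: "t0 \<in> carrier F" using R_F t0 .
  have "t0 = inv\<^bsub>F\<^esub> h0"
    using h0 t0F by (metis F.inv_equality St_iff)
  then have t0S: "t0 \<in> St g" using subgroup.m_inv_closed[OF St_subgroup[OF g] h0(1)] by simp
  \<comment> \<open>A representative in the stabilizer represents the coset of the unit, as
    \<open>t0\<close> does.\<close>
  have t_eq: "t = t0" if t: "t \<in> R" "t \<in> St g" for t
  proof -
    have "inv\<^bsub>F\<^esub> t \<in> St g" using subgroup.m_inv_closed[OF St_subgroup[OF g] t(2)] .
    then have "transversal_rep F (St g) R (t \<otimes>\<^bsub>F\<^esub> inv\<^bsub>F\<^esub> t) = t"
      by (rule F.transversal_rep_eq[OF R St_subgroup[OF g] t(1)])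
    moreover have "transversal_rep F (St g) R (t0 \<otimes>\<^bsub>F\<^esub> h0) = t0"
      by (rule F.transversal_rep_eq[OF R St_subgroup[OF g] t0 h0(1)])
    ultimately show ?thesis using R_F[OF t(1)] h0(2) by simp
  qed
  have hproj_i: "hproj x ?A \<star> i t = (if \<phi> t g = x then i t else zer (ob t ?V) ?A)"
    if "x \<in> carrier G" "t \<in> R" for x t
    using hproj_cmp_homogeneous[of "i t" x "\<phi> t g" ?A] that R_F[OF that(2)] g coherent V(1) by simp
  note s0 = E.E_obj(3)[OF M t0S]
  \<comment> \<open>\<open>str M t0\<close> corrects for the difference between
    \<open>T t0 V\<close> and \<open>V\<close>.\<close>
  define j where "j = i t0 \<star> inv_of (str M t0)"
  define p where "p = str M t0 \<star> q t0"
  have j: "valid j" "src j = ?V" "tgt j = ?A" and p: "valid p" "src p = ?A" "tgt p = ?V"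
    using s0 t0 by (auto simp: j_def p_def)
  have qi: "q t0 \<star> i t0 = idt (ob t0 ?V)"
    using biproduct_cmp[OF bi t0 t0] by (simp add: i_def q_def)
  have pj: "p \<star> j = idt ?V"
    using s0 t0 V t0F by (simp add: p_def j_def cmp_reassoc[OF qi])
  have "j \<star> p = i t0 \<star> q t0"
    using s0 t0 by (simp add: p_def j_def)
  also have "\<dots> = hproj g ?A"
  proof (rule biproduct_ext[OF bi])
    fix t assume t: "t \<in> R"
    have "q t0 \<star> i t = (if t = t0 then idt (ob t0 ?V) else zer (ob t ?V) (ob t0 ?V))"
      using biproduct_cmp[OF bi t t0] by (auto simp: i_def q_def)
    moreover have "\<phi> t g = g \<longleftrightarrow> t = t0"
      using t_eq[OF t] t0S R_F[OF t] unfolding St_iff by blast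
    ultimately have "(i t0 \<star> q t0) \<star> i t = hproj g ?A \<star> i t"
      using t t0 t0F R_F[OF t] V A g by (simp add: hproj_i)
    then show "(i t0 \<star> q t0) \<star> inc ?Y ?A \<iota> t = hproj g ?A \<star> inc ?Y ?A \<iota> t"
      by (simp add: i_def)
  qed (use t0 A g in auto)
  finally have jp: "j \<star> p = hproj g ?A" .
  have equiv: "j \<star> str M h = str N h \<star> act h j" if h: "h \<in> St g" for h
  proof (rule isom_epic[of "act h (str M t0)"])
    have hF: "h \<in> carrier F" using h by simp
    \<comment> \<open>Conjugating \<open>h\<close> by \<open>t0\<close> gives the factorization
      \<open>h t0 = t0 k\<close>, so \<open>str N h\<close> maps the summand of \<open>t0\<close> to
      itself.\<close>
    define k where "k = inv\<^bsub>F\<^esub> t0 \<otimes>\<^bsub>F\<^esub> (h \<otimes>\<^bsub>F\<^esub> t0)"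
    have k: "k \<in> St g"
      unfolding k_def using h t0S
      by (intro subgroup.m_closed[OF St_subgroup[OF g]] subgroup.m_inv_closed[OF St_subgroup[OF g]])
    have kF: "k \<in> carrier F" using k by simp
    have tk: "h \<otimes>\<^bsub>F\<^esub> t0 = t0 \<otimes>\<^bsub>F\<^esub> k"
      using hF t0F by (simp add: k_def flip: F.m_assoc)
    have htS: "t0 \<otimes>\<^bsub>F\<^esub> k \<in> St g" using subgroup.m_closed[OF St_subgroup[OF g] t0S k] .
    note s = E.E_obj(3)[OF M h] E.E_obj(3)[OF M k] E.E_obj(3)[OF M htS] W.E_obj(3)[OF N hF]
    \<comment> \<open>The cocycle condition of \<open>M\<close> at \<open>t0\<close>,
      \<open>k\<close>, solved for the part that occurs in \<open>ind_comp\<close>.\<close>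
    have "act t0 (str M k) \<star> inv_of (coh t0 k ?V) = inv_of (str M t0) \<star> str M (t0 \<otimes>\<^bsub>F\<^esub> k)"
    proof (rule isom_epic[of "coh t0 k ?V"])
      have "inv_of (str M t0) \<star> str M t0 \<star> act t0 (str M k) = inv_of (str M t0) \<star> str M (t0 \<otimes>\<^bsub>F\<^esub> k) \<star> coh t0 k ?V"
        using E.E_obj(5)[OF M t0S k] by simp
      then show "(act t0 (str M k) \<star> inv_of (coh t0 k ?V)) \<star> coh t0 k ?V
          = (inv_of (str M t0) \<star> str M (t0 \<otimes>\<^bsub>F\<^esub> k)) \<star> coh t0 k ?V"
        using s s0 t0F kF V by simp
    qed (use s s0 t0F kF V in simp_all)
    note e = cmp_reassoc[OF this]
    have "(str N h \<star> act h j) \<star> act h (str M t0) = str N h \<star> act h (j \<star> str M t0)"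
      using s s0 hF j by simp
    also have "j \<star> str M t0 = i t0"
      using s0 t0 by (simp add: j_def)
    also have "str N h \<star> act h (i t0) = i t0 \<star> E.ind_comp M h t0 t0 k"
      using hF t0 k tk by (intro str)
    also have "E.ind_comp M h t0 t0 k = inv_of (str M t0) \<star> str M (t0 \<otimes>\<^bsub>F\<^esub> k) \<star> coh h t0 ?V"
      unfolding E.ind_comp_def using s s0 hF t0F kF V tk by (simp add: e)
    also have "str M (t0 \<otimes>\<^bsub>F\<^esub> k) \<star> coh h t0 ?V = str M h \<star> act h (str M t0)"
      using E.E_obj(5)[OF M h t0S] tk by simp
    also have "i t0 \<star> inv_of (str M t0) \<star> \<dots> = (j \<star> str M h) \<star> act h (str M t0)"
      using s s0 t0 hF by (simp add: j_def)
    finally show "(j \<star> str M h) \<star> act h (str M t0) = (str N h \<star> act h j) \<star> act h (str M t0)" ..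
  qed (use h s0 E.E_obj(3)[OF M h] W.E_obj(3)[OF N] j in auto)
  have "component g M N j p"
    unfolding component_def using g M N equiv j p pj jp by (auto simp: eqhom_def)
  moreover have "full g N"
    unfolding full_def
  proof (intro ballI impI)
    fix x assume x: "x \<in> carrier G" "x \<notin> orb g"
    show "hproj x ?A = zer ?A ?A"
    proof (rule biproduct_ext[OF bi])
      fix t assume t: "t \<in> R"
      then have "\<phi> t g \<noteq> x" using x R_F by (auto simp: orb_iff)
      then have "hproj x ?A \<star> i t = zer ?A ?A \<star> i t"
        using hproj_i[OF x(1) t] t A by simp
      then show "hproj x ?A \<star> inc ?Y ?A \<iota> t = zer ?A ?A \<star> inc ?Y ?A \<iota> t"
        by (simp add: i_def)
    qed (use x A in auto)
  qed
  ultimately show thesis by (rule that)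
qed

text \<open>Taking components is essentially surjective on full objects: induce along any set of
  representatives, which is finite because \<open>F\<close> is.\<close>

lemma full_component_exists:
  assumes M: "M \<in> Obj (Eg g)" and g: "g \<in> carrier G"
  obtains N j p where "component g M N j p" "full g N"
proof -
  obtain R where R: "left_transversal F (St g) R"
    using F.left_transversal_exists[OF St_subgroup[OF g]] ..
  then have "finite R"
    using finite_F by (auto simp: left_transversal_def intro: finite_subset)
  then obtain N where "is_induced C F T T2 (St g) R M N"
    using equivariant_category.induced_exists[OF equivariant_category_component[OF g] M R] by blast
  then show thesis using induced_component[OF M g R] that by metis
qed

section \<open>Simple equivariant objects\<close>

lemma full_source:
  "\<lbrakk>full g N; x \<in> carrier G; x \<notin> orb g; valid f; src f = fst N\<rbrakk> \<Longrightarrow>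
    f \<star> hproj x (fst N) = zer (fst N) (tgt f)"
  using valid_src[of f] by (simp add: full_def)

lemma full_target:
  assumes "full g N" "x \<in> carrier G" "x \<notin> orb g" "valid f" "tgt f = fst N"
  shows "f \<star> hproj x (src f) = zer (src f) (fst N)"
  using hproj_natural[OF assms(4,2)] assms valid_tgt[of f] by (simp add: full_def)

text \<open>The inverse of the restricted arrow is equivariant for the stabilizer and extends to
  \<open>k\<close>. Both composites of \<open>f\<close> and \<open>k\<close> restrict to identities,
  and off the orbit everything vanishes by fullness, so \<open>component_eqI\<close>
  applies.\<close>

lemma component_isom_iff:
  assumes c: "component g M N j p" and c': "component g M' N' j' p'" and full: "full g N" "full g N'"
    and f: "eqhom (carrier F) N N' f"
  shows "isom (p' \<star> f \<star> j) \<longleftrightarrow> isom f"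
proof
  note d = componentD[OF c] and d' = componentD[OF c'] and fD = eqhomD[OF f]
  let ?u = "p' \<star> f \<star> j"
  have uv: "valid ?u" "src ?u = fst M" "tgt ?u = fst M'" using d d' fD by auto
  have idt: "p \<star> idt (fst N) \<star> j = idt (fst M)" "p' \<star> idt (fst N') \<star> j' = idt (fst M')"
    using d d' by simp_all
  show "isom ?u" if i: "isom f"
  proof (rule isomI[of _ "p \<star> inv_of f \<star> j'"])
    have inv: "valid (inv_of f)" "src (inv_of f) = fst N'" "tgt (inv_of f) = fst N"
      using i fD by auto
    show "(p \<star> inv_of f \<star> j') \<star> ?u = idt (src ?u)"
      using component_restrict_cmp[OF c c' c fD inv] i fD idt uv by simp
    show "?u \<star> p \<star> inv_of f \<star> j' = idt (tgt ?u)"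
      using component_restrict_cmp[OF c' c c' inv fD] i fD idt uv by simp
  qed (use i d d' fD in auto)
  show "isom f" if i: "isom ?u"
  proof -
    interpret E: equivariant_category K C F T T2 "Cg g" "St g"
      by (rule equivariant_category_component[OF d(1)])
    have "eqhom (St g) M' M (inv_of ?u)"
      by (rule E.eqhom_inv_of[OF d(2) d'(2) component_restrict[OF c c' f] i])
    then obtain k where k: "eqhom (carrier F) N' N k" and pk: "p \<star> k \<star> j' = inv_of ?u"
      using component_extend[OF c' c] by metis
    note kD = eqhomD[OF k]
    show ?thesis
    proof (rule isomI[of _ k])
      have "k \<star> f = idt (fst N)"
      proof (rule component_eqI[OF c c W.eqhom_cmp[OF d(3) d'(3) d(3) f k] W.eqhom_idt[OF d(3)]])
        show "p \<star> (k \<star> f) \<star> j = p \<star> idt (fst N) \<star> j"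
          unfolding component_restrict_cmp[OF c c' c fD kD] pk idt using i uv by simp
        show "(k \<star> f) \<star> hproj x (fst N) = idt (fst N) \<star> hproj x (fst N)"
          if x: "x \<in> carrier G" "x \<notin> orb g" for x
          using full_source[OF full(1) x, of "k \<star> f"] full_source[OF full(1) x, of "idt (fst N)"] fD kD d(5) by simp
      qed
      then show "k \<star> f = idt (src f)" using fD by simp
      have "f \<star> k = idt (fst N')"
      proof (rule component_eqI[OF c' c' W.eqhom_cmp[OF d'(3) d(3) d'(3) k f] W.eqhom_idt[OF d'(3)]])
        show "p' \<star> (f \<star> k) \<star> j' = p' \<star> idt (fst N') \<star> j'"
          unfolding component_restrict_cmp[OF c' c c' kD fD] pk idt using i uv by simp
        show "(f \<star> k) \<star> hproj x (fst N') = idt (fst N') \<star> hproj x (fst N')"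
          if x: "x \<in> carrier G" "x \<notin> orb g" for x
          using full_source[OF full(2) x, of "f \<star> k"] full_source[OF full(2) x, of "idt (fst N')"] fD kD d'(5) by simp
      qed
      then show "f \<star> k = idt (tgt f)" using fD by simp
    qed (use fD kD in auto)
  qed
qed

lemma component_isomorphic_iff:
  assumes c: "component g M N j p" and c': "component g M' N' j' p'" and full: "full g N" "full g N'"
  shows "isomorphic (Eg g) M M' \<longleftrightarrow> isomorphic EG N N'"
proof -
  note d = componentD[OF c] and d' = componentD[OF c']
  interpret E: equivariant_category K C F T T2 "Cg g" "St g"
    by (rule equivariant_category_component[OF d(1)])
  have "(\<exists>u. eqhom (St g) M M' u \<and> isom u) \<longleftrightarrow> (\<exists>f. eqhom (carrier F) N N' f \<and> isom f)"
  proof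
    assume "\<exists>u. eqhom (St g) M M' u \<and> isom u"
    then obtain u f where "isom u" "eqhom (carrier F) N N' f" "p' \<star> f \<star> j = u"
      using component_extend[OF c c'] by metis
    then show "\<exists>f. eqhom (carrier F) N N' f \<and> isom f"
      using component_isom_iff[OF c c' full] by blast
  next
    assume "\<exists>f. eqhom (carrier F) N N' f \<and> isom f"
    then show "\<exists>u. eqhom (St g) M M' u \<and> isom u"
      using component_isom_iff[OF c c' full] component_restrict[OF c c'] by blast
  qed
  then show ?thesis
    using E.E_isomorphic[OF d(2) d'(2)] W.E_isomorphic[OF d(3) d'(3)] by blast
qed

text \<open>One end supported on the orbit is enough, since naturality moves an idempotent from one
  end of \<open>f\<close> to the other.\<close>

lemma component_zer_iff:
  assumes c: "component g M N j p" and c': "component g M' N' j' p'" and full: "full g N \<or> full g N'"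
    and f: "eqhom (carrier F) N N' f"
  shows "p' \<star> f \<star> j = zer (fst M) (fst M') \<longleftrightarrow> f = zer (fst N) (fst N')"
proof
  note d = componentD[OF c] and d' = componentD[OF c'] and fD = eqhomD[OF f]
  show "f = zer (fst N) (fst N')" if "p' \<star> f \<star> j = zer (fst M) (fst M')"
  proof (rule component_eqI[OF c c' f W.eqhom_zer[OF d(3) d'(3)]])
    show "p' \<star> f \<star> j = p' \<star> zer (fst N) (fst N') \<star> j"
      using that d d' by simp
    show "f \<star> hproj x (fst N) = zer (fst N) (fst N') \<star> hproj x (fst N)"
      if x: "x \<in> carrier G" "x \<notin> orb g" for x
      using full full_source[of g N x f] full_target[of g N' x f] x fD d(5) d'(5) by auto
  qed
  show "p' \<star> f \<star> j = zer (fst M) (fst M')" if "f = zer (fst N) (fst N')"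
    using that d d' by simp
qed

lemma component_nonzero_iff:
  assumes c: "component g M N j p" and full: "full g N"
  shows "idt (fst M) = zer (fst M) (fst M) \<longleftrightarrow> idt (fst N) = zer (fst N) (fst N)"
  using component_zer_iff[OF c c _ W.eqhom_idt] full componentD[OF c] by simp

text \<open>
  The object induced from the \<open>g\<close>-component of \<open>N\<close> is a direct summand of \<open>N\<close>, so for simple \<open>N\<close>
  it is everything or zero.
\<close>

lemma simple_object_full:
  assumes N: "simple_object EG N" and g: "g \<in> carrier G" and nz: "hproj g (fst N) \<noteq> zer (fst N) (fst N)"
  shows "full g N"
proof -
  have simple: "N \<in> Obj EG" "\<And>Y f. \<lbrakk>Y \<in> Obj EG; W.eqmono Y N f\<rbrakk> \<Longrightarrow> f = zer (fst Y) (fst N) \<or> isom f"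
    using N W.E_simple_object[of N] by auto
  obtain M j p where c: "component g M N j p"
    using component_exists[OF simple(1) g] .
  note d = componentD[OF c]
  obtain A ja pa where ca: "component g M A ja pa" and full: "full g A"
    using full_component_exists[OF d(2) g] .
  note da = componentD[OF ca]
  interpret E: equivariant_category K C F T T2 "Cg g" "St g"
    by (rule equivariant_category_component[OF g])
  \<comment> \<open>The identity of \<open>M\<close> is extended in both directions between
    \<open>A\<close> and \<open>N\<close>. The composite on \<open>A\<close> is the identity because
    \<open>A\<close> is full; \<open>f\<close> is thereby split monic, and simplicity of
    \<open>N\<close> can be applied to it.\<close>
  obtain f where f: "eqhom (carrier F) A N f" and pf: "p \<star> f \<star> ja = idt (fst M)"
    using component_extend[OF ca c E.eqhom_idt[OF d(2)]] by metis
  obtain k where k: "eqhom (carrier F) N A k" and pk: "pa \<star> k \<star> j = idt (fst M)"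
    using component_extend[OF c ca E.eqhom_idt[OF d(2)]] by metis
  note fD = eqhomD[OF f] and kD = eqhomD[OF k]
  have kf: "k \<star> f = idt (fst A)"
  proof (rule component_eqI[OF ca ca W.eqhom_cmp[OF da(3) d(3) da(3) f k] W.eqhom_idt[OF da(3)]])
    show "pa \<star> (k \<star> f) \<star> ja = pa \<star> idt (fst A) \<star> ja"
      unfolding component_restrict_cmp[OF ca c ca fD kD] pf pk using da by simp
    show "(k \<star> f) \<star> hproj x (fst A) = idt (fst A) \<star> hproj x (fst A)"
      if x: "x \<in> carrier G" "x \<notin> orb g" for x
      using full_source[OF full x, of "k \<star> f"] full_source[OF full x, of "idt (fst A)"] fD kD da(5) by simp
  qed
  have "W.eqmono A N f"
    unfolding W.eqmono_def
  proof (intro conjI f ballI allI impI)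
    fix Z u v assume "eqhom (carrier F) Z A u" "eqhom (carrier F) Z A v" and eq: "f \<star> u = f \<star> v"
    note uD = eqhomD[OF this(1)] and vD = eqhomD[OF this(2)]
    have "u = k \<star> f \<star> u" using cmp_reassoc[OF kf] uD fD kD by simp
    also have "\<dots> = k \<star> f \<star> v" by (simp add: eq)
    also have "\<dots> = v" using cmp_reassoc[OF kf] vD fD kD by simp
    finally show "u = v" .
  qed
  then have "f = zer (fst A) (fst N) \<or> isom f"
    by (rule simple(2)[OF da(3)])
  \<comment> \<open>If \<open>f\<close> were zero, so would be the identity of \<open>M\<close>, and
    with it the idempotent that factors through \<open>M\<close>.\<close>
  moreover have "f \<noteq> zer (fst A) (fst N)"
  proof
    assume "f = zer (fst A) (fst N)"
    then have "idt (fst M) = zer (fst M) (fst M)"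
      using pf d da by simp
    then have "j \<star> idt (fst M) \<star> p = zer (fst N) (fst N)"
      using d by simp
    then show False using d nz by simp
  qed
  ultimately have i: "isom f" by simp
  show ?thesis
    unfolding full_def
  proof (intro ballI impI)
    fix x assume x: "x \<in> carrier G" "x \<notin> orb g"
    show "hproj x (fst N) = zer (fst N) (fst N)"
    proof (rule isom_epic[OF i])
      have "hproj x (fst N) \<star> f = f \<star> hproj x (fst A)"
        using hproj_natural[OF fD(1) x(1)] fD by simp
      also have "\<dots> = zer (fst N) (fst N) \<star> f"
        using full_source[OF full x fD(1,2)] fD d(5) by simp
      finally show "hproj x (fst N) \<star> f = zer (fst N) (fst N) \<star> f" .
    qed (use fD x d in auto)
  qed
qed

text \<open>A monomorphism into \<open>N\<close> is restricted to components, where \<open>M\<close>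
  decides. Two things are needed: its source \<open>Y\<close> must be full, so that the restriction
  determines it, and the restriction must be monic among objects of \<open>Eg g\<close>.\<close>

lemma component_simple_imp:
  assumes c: "component g M N j p" and full: "full g N" and M: "simple_object (Eg g) M"
  shows "simple_object EG N"
proof -
  note d = componentD[OF c]
  interpret E: equivariant_category K C F T T2 "Cg g" "St g"
    by (rule equivariant_category_component[OF d(1)])
  have simple: "idt (fst M) \<noteq> zer (fst M) (fst M)"
      "\<And>Y f. \<lbrakk>Y \<in> Obj (Eg g); E.eqmono Y M f\<rbrakk> \<Longrightarrow> f = zer (fst Y) (fst M) \<or> isom f"
    using M E.E_simple_object[of M] by auto
  have "f = zer (fst Y) (fst N) \<or> isom f" if Y: "Y \<in> Obj EG" and mono: "W.eqmono Y N f" for Y f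
  proof -
    have f: "eqhom (carrier F) Y N f"
      and cancel: "\<And>Z u v. \<lbrakk>Z \<in> Obj EG; eqhom (carrier F) Z Y u; eqhom (carrier F) Z Y v; f \<star> u = f \<star> v\<rbrakk> \<Longrightarrow> u = v"
      using mono unfolding W.eqmono_def by auto
    note fD = eqhomD[OF f]
    obtain M' j' p' where c': "component g M' Y j' p'"
      using component_exists[OF Y d(1)] .
    note d' = componentD[OF c']
    \<comment> \<open>\<open>e\<close> is the projection of \<open>Y\<close> onto its degrees in the
      orbit. As \<open>N\<close> is full, \<open>f\<close> does not see the rest, so
      \<open>f \<star> e = f\<close>, and \<open>f\<close> being monic forces \<open>e\<close> to be
      the identity.\<close>
    obtain e where e: "eqhom (carrier F) Y Y e" "p' \<star> e \<star> j' = idt (fst M')"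
      and off: "\<And>x. \<lbrakk>x \<in> carrier G; x \<notin> orb g\<rbrakk> \<Longrightarrow> e \<star> hproj x (fst Y) = zer (fst Y) (fst Y)"
      using component_extend[OF c' c' E.eqhom_idt[OF d'(2)]] by metis
    note eD = eqhomD[OF e(1)]
    have "f \<star> e = f"
    proof (rule component_eqI[OF c' c W.eqhom_cmp[OF Y Y d(3) e(1) f] f])
      have "valid (p \<star> f \<star> j')" "src (p \<star> f \<star> j') = fst M'"
        using d d' fD by auto
      then show "p \<star> (f \<star> e) \<star> j' = p \<star> f \<star> j'"
        unfolding component_restrict_cmp[OF c' c' c eD fD] e(2) by simp
      show "(f \<star> e) \<star> hproj x (fst Y) = f \<star> hproj x (fst Y)" if x: "x \<in> carrier G" "x \<notin> orb g" for x
        using off[OF x] full_target[OF full x fD(1,3)] fD eD x d'(5) by simp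
    qed
    then have "e = idt (fst Y)"
      using fD by (intro cancel[OF Y e(1) W.eqhom_idt[OF Y]]) simp
    then have fullY: "full g Y"
      using off d'(5) by (simp add: full_def)
    let ?u = "p \<star> f \<star> j'"
    have u: "eqhom (St g) M' M ?u"
      by (rule component_restrict[OF c' c f])
    have "E.eqmono M' M ?u"
      unfolding E.eqmono_def
    proof (intro conjI u ballI allI impI)
      fix Z a b assume Z: "Z \<in> Obj (Eg g)" and a: "eqhom (St g) Z M' a" and b: "eqhom (St g) Z M' b"
        and eq: "?u \<star> a = ?u \<star> b"
      \<comment> \<open>The test object of \<open>Eg g\<close> becomes one of \<open>EG\<close> by
        induction, and the two test arrows are extended with it.\<close>
      obtain NZ jz pz where cz: "component g Z NZ jz pz" and fullz: "full g NZ"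
        using full_component_exists[OF Z d(1)] .
      note dz = componentD[OF cz]
      obtain a' where a': "eqhom (carrier F) NZ Y a'" "p' \<star> a' \<star> jz = a"
        using component_extend[OF cz c' a] by metis
      obtain b' where b': "eqhom (carrier F) NZ Y b'" "p' \<star> b' \<star> jz = b"
        using component_extend[OF cz c' b] by metis
      note aD = eqhomD[OF a'(1)] and bD = eqhomD[OF b'(1)]
      have "f \<star> a' = f \<star> b'"
      proof (rule component_eqI[OF cz c W.eqhom_cmp[OF dz(3) Y d(3) a'(1) f] W.eqhom_cmp[OF dz(3) Y d(3) b'(1) f]])
        show "p \<star> (f \<star> a') \<star> jz = p \<star> (f \<star> b') \<star> jz"
          unfolding component_restrict_cmp[OF cz c' c aD fD] component_restrict_cmp[OF cz c' c bD fD] a'(2) b'(2)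
          by (rule eq)
        show "(f \<star> a') \<star> hproj x (fst NZ) = (f \<star> b') \<star> hproj x (fst NZ)"
          if x: "x \<in> carrier G" "x \<notin> orb g" for x
          using full_source[OF fullz x, of "f \<star> a'"] full_source[OF fullz x, of "f \<star> b'"] aD bD fD by simp
      qed
      then have "a' = b'" by (rule cancel[OF dz(3) a'(1) b'(1)])
      then show "a = b" using a'(2) b'(2) by simp
    qed
    then have "?u = zer (fst M') (fst M) \<or> isom ?u"
      by (rule simple(2)[OF d'(2)])
    then show ?thesis
      using component_zer_iff[OF c' c _ f] component_isom_iff[OF c' c fullY full f] full by simp
  qed
  then show ?thesis
    unfolding W.E_simple_object using simple(1) component_nonzero_iff[OF c full] d(3) by blast
qed

text \<open>Here a monomorphism into \<open>M\<close> is extended to the object induced from its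
  source. A test object of \<open>EG\<close> is replaced by its component; fullness of the common
  target makes the test arrows vanish off the orbit, so their restrictions determine them.\<close>

lemma component_simple_rev:
  assumes c: "component g M N j p" and full: "full g N" and N: "simple_object EG N"
  shows "simple_object (Eg g) M"
proof -
  note d = componentD[OF c]
  interpret E: equivariant_category K C F T T2 "Cg g" "St g"
    by (rule equivariant_category_component[OF d(1)])
  have simple: "idt (fst N) \<noteq> zer (fst N) (fst N)"
      "\<And>Y f. \<lbrakk>Y \<in> Obj EG; W.eqmono Y N f\<rbrakk> \<Longrightarrow> f = zer (fst Y) (fst N) \<or> isom f"
    using N W.E_simple_object[of N] by auto
  have "u = zer (fst Y) (fst M) \<or> isom u" if Y: "Y \<in> Obj (Eg g)" and mono: "E.eqmono Y M u" for Y u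
  proof -
    have u: "eqhom (St g) Y M u"
      and cancel: "\<And>Z a b. \<lbrakk>Z \<in> Obj (Eg g); eqhom (St g) Z Y a; eqhom (St g) Z Y b; u \<star> a = u \<star> b\<rbrakk> \<Longrightarrow> a = b"
      using mono unfolding E.eqmono_def by auto
    obtain N' j' p' where c': "component g Y N' j' p'" and full': "full g N'"
      using full_component_exists[OF Y d(1)] .
    note d' = componentD[OF c']
    obtain f where f: "eqhom (carrier F) N' N f" and pf: "p \<star> f \<star> j' = u"
      using component_extend[OF c' c u] by metis
    note fD = eqhomD[OF f]
    have "W.eqmono N' N f"
      unfolding W.eqmono_def
    proof (intro conjI f ballI allI impI)
      fix Z a b assume Z: "Z \<in> Obj EG" and a: "eqhom (carrier F) Z N' a" and b: "eqhom (carrier F) Z N' b"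
        and eq: "f \<star> a = f \<star> b"
      note aD = eqhomD[OF a] and bD = eqhomD[OF b]
      obtain MZ jz pz where cz: "component g MZ Z jz pz"
        using component_exists[OF Z d(1)] .
      note dz = componentD[OF cz]
      show "a = b"
      proof (rule component_eqI[OF cz c' a b])
        show "p' \<star> a \<star> jz = p' \<star> b \<star> jz"
        proof (rule cancel[OF dz(2) component_restrict[OF cz c' a] component_restrict[OF cz c' b]])
          show "u \<star> p' \<star> a \<star> jz = u \<star> p' \<star> b \<star> jz"
            using component_restrict_cmp[OF cz c' c aD fD] component_restrict_cmp[OF cz c' c bD fD] eq pf by simp
        qed
        show "a \<star> hproj x (fst Z) = b \<star> hproj x (fst Z)" if x: "x \<in> carrier G" "x \<notin> orb g" for x
          using full_target[OF full' x aD(1,3)] full_target[OF full' x bD(1,3)] aD bD by simp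
      qed
    qed
    then have "f = zer (fst N') (fst N) \<or> isom f"
      by (rule simple(2)[OF d'(3)])
    then show ?thesis
      using component_zer_iff[OF c' c _ f] component_isom_iff[OF c' c full' full f] full pf by simp
  qed
  then show ?thesis
    unfolding E.E_simple_object using simple(1) component_nonzero_iff[OF c full] d(2) by blast
qed

lemma hproj_nonzero:
  assumes c: "component g M N j p" and M: "simple_object (Eg g) M"
  shows "hproj g (fst N) \<noteq> zer (fst N) (fst N)"
proof
  note d = componentD[OF c]
  interpret E: equivariant_category K C F T T2 "Cg g" "St g"
    by (rule equivariant_category_component[OF d(1)])
  assume "hproj g (fst N) = zer (fst N) (fst N)"
  then have "idt (fst M) = p \<star> zer (fst N) (fst N) \<star> j"
    using d by simp
  also have "\<dots> = zer (fst M) (fst M)" using d by simp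
  finally show False using M E.E_simple_object[of M] by simp
qed

lemma hproj_zer_isomorphic:
  assumes N: "N \<in> Obj EG" "N' \<in> Obj EG" and i: "isomorphic EG N N'" and g: "g \<in> carrier G"
    and z: "hproj g (fst N') = zer (fst N') (fst N')"
  shows "hproj g (fst N) = zer (fst N) (fst N)"
proof -
  obtain f where f: "eqhom (carrier F) N N' f" "isom f"
    using i W.E_isomorphic[OF N] by blast
  note fD = eqhomD[OF f(1)] and o = W.E_obj(2)[OF N(1)] W.E_obj(2)[OF N(2)]
  show ?thesis
  proof (rule isom_monic[OF f(2)])
    show "f \<star> hproj g (fst N) = f \<star> zer (fst N) (fst N)"
      using hproj_natural[OF fD(1) g] fD z o by simp
  qed (use fD g o in auto)
qed

section \<open>The bijection on isomorphism classes\<close>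

definition induced_class :: "'g \<Rightarrow> ('o \<times> ('f \<Rightarrow> 'm)) set \<Rightarrow> ('o \<times> ('f \<Rightarrow> 'm)) set"
  where "induced_class g c = (SOME c'. \<exists>M N j p. M \<in> c \<and> component g M N j p \<and> full g N \<and> c' = iso_class EG N)"

text \<open>Any full object with component \<open>M\<close> represents the class: by
  \<open>component_isomorphic_iff\<close> neither the representative of the class of
  \<open>M\<close> nor the full object matters. No set of coset representatives enters the
  definition.\<close>

lemma induced_class_eq:
  assumes c: "component g M N j p" and full: "full g N"
  shows "induced_class g (iso_class (Eg g) M) = iso_class EG N"
  unfolding induced_class_def
proof (rule some_equality)
  note d = componentD[OF c]
  interpret E: equivariant_category K C F T T2 "Cg g" "St g"
    by (rule equivariant_category_component[OF d(1)])
  have "M \<in> iso_class (Eg g) M"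
    using E.E_isomorphic_refl[OF d(2)] d(2) by (simp add: iso_class_def)
  then show "\<exists>M' N' j p. M' \<in> iso_class (Eg g) M \<and> component g M' N' j p \<and> full g N' \<and>
      iso_class EG N = iso_class EG N'"
    using c full by blast
  fix c' assume "\<exists>M' N' j p. M' \<in> iso_class (Eg g) M \<and> component g M' N' j p \<and> full g N' \<and> c' = iso_class EG N'"
  then obtain M' N' j' p' where *: "isomorphic (Eg g) M M'" "component g M' N' j' p'" "full g N'" "c' = iso_class EG N'"
    by (auto simp: iso_class_def)
  then have "isomorphic EG N N'"
    using component_isomorphic_iff[OF c *(2) full *(3)] by simp
  then show "c' = iso_class EG N"
    using W.E_iso_class_eq_iff[OF d(3) componentD(3)[OF *(2)]] *(4) by simp
qed

text \<open>For injectivity, the support of \<open>N\<close> recovers the orbit and hence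
  \<open>g\<close>, and \<open>component_isomorphic_iff\<close> recovers \<open>M\<close>. For
  surjectivity, some degree of a simple object is nonzero, and it can be moved to the element of
  \<open>\<Gamma>\<close> in its orbit.\<close>

lemma induced_class_bij:
  assumes \<Gamma>: "orbit_representatives F (carrier G) \<phi> \<Gamma>"
  shows "bij_betw (\<lambda>(g, c). induced_class g c) (SIGMA g:\<Gamma>. simple_classes (Eg g)) (simple_classes EG)"
proof -
  have \<Gamma>G: "\<Gamma> \<subseteq> carrier G" using \<Gamma> by (simp add: orbit_representatives_def)
  have rep: "\<exists>!g. g \<in> \<Gamma> \<inter> orb x" if "x \<in> carrier G" for x
    using \<Gamma> that by (auto simp: orbit_representatives_def orbits_def)
  have self: "x \<in> orb x" if "x \<in> carrier G" for x
    using that by (auto simp: orb_iff intro!: bexI[of _ "\<one>\<^bsub>F\<^esub>"])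
  have simple: "\<exists>M N j p. c = iso_class (Eg g) M \<and> simple_object (Eg g) M \<and> component g M N j p \<and> full g N"
    if gc: "g \<in> \<Gamma>" "c \<in> simple_classes (Eg g)" for g c
  proof -
    obtain M where M: "c = iso_class (Eg g) M" "simple_object (Eg g) M"
      using gc(2) unfolding simple_classes_def by blast
    then have "M \<in> Obj (Eg g)" by (simp add: simple_object_def)
    then show ?thesis
      using full_component_exists[of M g] gc(1) \<Gamma>G M by (metis subsetD)
  qed
  show ?thesis
    unfolding bij_betw_def
  proof (intro conjI inj_onI subset_antisym subsetI)
    fix x y
    assume "x \<in> (SIGMA g:\<Gamma>. simple_classes (Eg g))" "y \<in> (SIGMA g:\<Gamma>. simple_classes (Eg g))"
      and eq: "(case x of (g, c) \<Rightarrow> induced_class g c) = (case y of (g, c) \<Rightarrow> induced_class g c)"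
    then obtain g c g' c' where x: "x = (g, c)" "g \<in> \<Gamma>" "c \<in> simple_classes (Eg g)"
      and y: "y = (g', c')" "g' \<in> \<Gamma>" "c' \<in> simple_classes (Eg g')"
      by auto
    obtain M N j p where M: "c = iso_class (Eg g) M" "simple_object (Eg g) M" "component g M N j p" "full g N"
      using simple[OF x(2,3)] by metis
    obtain M' N' j' p' where M': "c' = iso_class (Eg g') M'" "simple_object (Eg g') M'" "component g' M' N' j' p'" "full g' N'"
      using simple[OF y(2,3)] by metis
    note d = componentD[OF M(3)] and d' = componentD[OF M'(3)]
    have iso: "isomorphic EG N N'"
      using eq x y M M' induced_class_eq[OF M(3,4)] induced_class_eq[OF M'(3,4)] W.E_iso_class_eq_iff[OF d(3) d'(3)] by simp
    \<comment> \<open>Vanishing of a degree is invariant under isomorphism, so \<open>N'\<close> is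
      nonzero in degree \<open>g\<close>; being full over \<open>g'\<close>, it puts
      \<open>g\<close> into the orbit of \<open>g'\<close>.\<close>
    have "hproj g (fst N') \<noteq> zer (fst N') (fst N')"
      using hproj_zer_isomorphic[OF d(3) d'(3) iso d(1)] hproj_nonzero[OF M(3,2)] by blast
    then have "g \<in> orb g'"
      using M'(4) d(1) by (auto simp: full_def)
    then have gg: "g = g'"
      using rep[OF d'(1)] self[OF d'(1)] x(2) y(2) by blast
    interpret E: equivariant_category K C F T T2 "Cg g" "St g"
      by (rule equivariant_category_component[OF d(1)])
    have "isomorphic (Eg g) M M'"
      using component_isomorphic_iff[OF M(3) _ M(4)] M'(3,4) iso gg by blast
    then have "c = c'"
      using E.E_iso_class_eq_iff[OF d(2)] d'(2) M(1) M'(1) gg by simp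
    then show "x = y" using x y gg by simp
  next
    fix z assume "z \<in> (\<lambda>(g, c). induced_class g c) ` (SIGMA g:\<Gamma>. simple_classes (Eg g))"
    then obtain g c where g: "g \<in> \<Gamma>" "c \<in> simple_classes (Eg g)" and z: "z = induced_class g c" by auto
    obtain M N j p where M: "c = iso_class (Eg g) M" "simple_object (Eg g) M" "component g M N j p" "full g N"
      using simple[OF g] by metis
    then show "z \<in> simple_classes EG"
      using z induced_class_eq[OF M(3,4)] component_simple_imp[OF M(3,4,2)] by (simp add: simple_classes_def)
  next
    fix z assume "z \<in> simple_classes EG"
    then obtain N where N: "simple_object EG N" and z: "z = iso_class EG N"
      unfolding simple_classes_def by blast
    have NE: "N \<in> Obj EG" and nz: "idt (fst N) \<noteq> zer (fst N) (fst N)"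
      using N W.E_simple_object[of N] by auto
    note o = W.E_obj(2)[OF NE]
    \<comment> \<open>If all idempotents vanished, the identity would agree with zero in every
      degree.\<close>
    obtain x where x: "x \<in> carrier G" "hproj x (fst N) \<noteq> zer (fst N) (fst N)"
    proof (rule ccontr)
      assume "\<not> thesis"
      then have "\<And>x. x \<in> carrier G \<Longrightarrow> hproj x (fst N) = zer (fst N) (fst N)" using that by blast
      then have "idt (fst N) = zer (fst N) (fst N)"
        using o by - (rule graded_ext[of _ _ "fst N"], auto)
      then show False using nz by simp
    qed
    obtain g where g: "g \<in> \<Gamma>" "g \<in> orb x" using rep[OF x(1)] by blast
    then have gG: "g \<in> carrier G" using \<Gamma>G by blast
    have "full x N" by (rule simple_object_full[OF N x])
    obtain t where t: "t \<in> carrier F" "g = \<phi> t x" using g by (auto simp: orb_iff)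
    have "hproj g (fst N) \<noteq> zer (fst N) (fst N)"
    proof
      assume z: "hproj g (fst N) = zer (fst N) (fst N)"
      \<comment> \<open>The identity is equivariant, hence fixed by transport, so transport maps
        idempotents of \<open>N\<close> to idempotents of the moved degree.\<close>
      have "hproj (\<phi> (inv\<^bsub>F\<^esub> t) g) (fst N) = transport N N (inv\<^bsub>F\<^esub> t) (hproj g (fst N))"
        using transport_hproj[OF NE NE _ gG, of "inv\<^bsub>F\<^esub> t" "idt (fst N)"]
          eqhom_transport[OF NE NE W.eqhom_idt[OF NE], of "inv\<^bsub>F\<^esub> t"] t(1) gG o by simp
      also have "\<dots> = zer (fst N) (fst N)"
        unfolding z using t(1) by (intro transport_zer[OF NE NE]) simp
      also have "\<phi> (inv\<^bsub>F\<^esub> t) g = x" unfolding t(2) using t(1) x by simp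
      finally have "hproj x (fst N) = zer (fst N) (fst N)" .
      then show False using x by simp
    qed
    then have full: "full g N" by (rule simple_object_full[OF N gG])
    obtain M j p where c: "component g M N j p" using component_exists[OF NE gG] .
    have "simple_object (Eg g) M" by (rule component_simple_rev[OF c full N])
    then have "(g, iso_class (Eg g) M) \<in> (SIGMA g:\<Gamma>. simple_classes (Eg g))"
      using g by (auto simp: simple_classes_def)
    moreover have "z = induced_class g (iso_class (Eg g) M)"
      using induced_class_eq[OF c full] z by simp
    ultimately show "z \<in> (\<lambda>(g, c). induced_class g c) ` (SIGMA g:\<Gamma>. simple_classes (Eg g))"
      by (force simp: image_iff)
  qed
qed

end

text \<open>Automorphisms compose as permutations do, so the homomorphism into
  \<open>AutoGroup G\<close> is also one into \<open>BijGroup (carrier G)\<close>.\<close>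

lemma (in group) group_action_of_auto:
  assumes "group_hom H (AutoGroup G) \<phi>"
  shows "group_action H (carrier G) \<phi>"
proof -
  interpret group_hom H "AutoGroup G" \<phi> by fact
  have "\<phi> \<in> hom H (BijGroup (carrier G))"
    using homh by (auto simp: hom_def AutoGroup_def auto_def BijGroup_def Pi_iff)
  then show ?thesis
    unfolding group_action_def group_hom_def group_hom_axioms_def
    using group_BijGroup by auto
qed

theorem proposition5p13:
  fixes K :: "('k, 'c) ring_scheme"
    and F :: "('f, 'a) monoid_scheme"
    and G :: "('g, 'b) monoid_scheme"
    and \<phi> :: "'f \<Rightarrow> 'g \<Rightarrow> 'g"
    and C :: "('k, 'o, 'm, 'z) tensor_category_data_scheme"
    and Cg :: "'g \<Rightarrow> 'o set"
    and T :: "'f \<Rightarrow> ('o, 'm) tensor_functor_data"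
    and T2 :: "'f \<Rightarrow> 'f \<Rightarrow> 'o \<Rightarrow> 'm"
    and \<Gamma> :: "'g set"
  defines "CF \<equiv> equivariantization C F T T2 (Obj C) (carrier F)"
    and "CgFg \<equiv> \<lambda>g. equivariantization C F T T2 (Cg g) (stabilizer F \<phi> g)"
  assumes "algebraically_closed K"
    and "group F" and "finite (carrier F)"
    and "group G" and "finite (carrier G)"
    and "group_hom F (AutoGroup G) \<phi>"
    and "graded_fusion_category K C G Cg"
    and "tensor_action K C F T T2"
    and coherent: "\<And>x g M. \<lbrakk>x \<in> carrier F; g \<in> carrier G; M \<in> Cg g\<rbrakk> \<Longrightarrow> FObj (T x) M \<in> Cg (\<phi> x g)"
    and "orbit_representatives F (carrier G) \<phi> \<Gamma>"
  shows "\<exists>\<Phi>. bij_betw \<Phi> (SIGMA g:\<Gamma>. simple_classes (CgFg g)) (simple_classes CF) \<and>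
    (\<forall>g\<in>\<Gamma>. \<forall>M. simple_object (CgFg g) M \<longrightarrow>
      (\<forall>R. left_transversal F (stabilizer F \<phi> g) R \<longrightarrow>
        (\<exists>N. is_induced C F T T2 (stabilizer F \<phi> g) R M N) \<and>
        (\<forall>N. is_induced C F T T2 (stabilizer F \<phi> g) R M N \<longrightarrow>
          simple_object CF N \<and> \<Phi> (g, iso_class (CgFg g) M) = iso_class CF N)))"
proof -
  have "group_action F (carrier G) \<phi>"
    using \<open>group G\<close> \<open>group_hom F (AutoGroup G) \<phi>\<close> by (rule group.group_action_of_auto)
  then interpret graded_action K C G Cg F T T2 \<phi>
    using assms by (intro graded_action.intro graded_action_axioms.intro)
  \<comment> \<open>The bijection is \<open>induced_class\<close>, whose definition does not mention
    \<open>R\<close>. One map therefore serves all sets of representatives, and each induced object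
    qualifies by \<open>induced_component\<close>.\<close>
  have "(\<exists>N. is_induced C F T T2 (St g) R M N) \<and>
      (\<forall>N. is_induced C F T T2 (St g) R M N \<longrightarrow>
        simple_object EG N \<and> induced_class g (iso_class (Eg g) M) = iso_class EG N)"
    if g: "g \<in> \<Gamma>" and M: "simple_object (Eg g) M" and R: "left_transversal F (St g) R" for g M R
  proof (intro conjI allI impI)
    have gG: "g \<in> carrier G"
      using g \<open>orbit_representatives F (carrier G) \<phi> \<Gamma>\<close> by (auto simp: orbit_representatives_def)
    have ME: "M \<in> Obj (Eg g)" using M by (simp add: simple_object_def)
    have "finite R"
      using R finite_F by (auto simp: left_transversal_def intro: finite_subset)
    then show "\<exists>N. is_induced C F T T2 (St g) R M N"
      by (rule equivariant_category.induced_exists[OF equivariant_category_component[OF gG] ME R])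
    fix N assume "is_induced C F T T2 (St g) R M N"
    then obtain j p where "component g M N j p" "full g N"
      by (rule induced_component[OF ME gG R])
    then show "simple_object EG N" "induced_class g (iso_class (Eg g) M) = iso_class EG N"
      using component_simple_imp M induced_class_eq by blast+
  qed
  then show ?thesis
    unfolding CF_def CgFg_def
    using induced_class_bij[OF \<open>orbit_representatives F (carrier G) \<phi> \<Gamma>\<close>]
    by (intro exI[of _ "\<lambda>(g, c). induced_class g c"]) auto
qed

end
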